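(* Let $\mathcal{E}$ be a $q$-ary Deza graph with parameters $(6,2,1,0;2)$, with its edge set regarded as a set of lines of $\mathrm{PG}(5,2)$. Then, up to a projectivity (an element of $\mathrm{PGL}(6,2)$), the edge set of $\mathcal{E}$ is either (a) the set of the $63$ lines of the split Cayley hexagon $\mathcal{H}(2)$ in its regular embedding in $\mathrm{PG}(5,2)$; or (b) one of the orbits, under the action of the group $K=\langle\sigma^3,\varphi\rangle$ on lines of $\mathrm{PG}(5,2)$, of one of the three lines $\langle(1,0,0,0,0,0),(0,1,1,0,0,0)\rangle$, $\langle(1,0,0,0,0,0),(0,0,1,1,0,0)\rangle$, $\langle(0,1,0,0,0,0),(0,0,1,1,0,0)\rangle$ (these three orbits are projectively equivalent to each other), where $\sigma,\varphi$ are the matrices given in the context.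
   Context: A $q$-ary graph $\mathcal{E}$ on $\mathbb{F}_q^v$ is a pair $(V,E)$ where $V$ is the set of all $1$-dimensional subspaces of $\mathbb{F}_q^v$ (vertices) and $E$ is a set of $2$-dimensional subspaces of $\mathbb{F}_q^v$ (edges). Distinct vertices $X,Y$ are adjacent if $\langle X,Y\rangle\in E$. The neighborhood $N_{\mathcal{E}}(X)$ is the set consisting of $X$ and all vertices adjacent to $X$. $\mathcal{E}$ is $k$-regular if for every vertex $X$ the set $N_{\mathcal{E}}(X)$ is (the set of $1$-subspaces of) a $(k+1)$-dimensional subspace. A $k$-regular $q$-ary graph $\mathcal{E}$ on $\mathbb{F}_q^v$ is a $q$-ary Deza graph with parameters $(v,k,b,a;q)$, $a\le b$, if $|(N_{\mathcal{E}}(X)\cap N_{\mathcal{E}}(Y))\setminus\{X,Y\}|\in\{a,b\}$ for all vertices $X\ne Y$. For $v=6$, $q=2$, the vertices are the points and the edges are lines of the projective space $\mathrm{PG}(5,2)$. Generalized hexagon: a point-line geometry $(\mathcal{P},\mathcal{L})$ whose (bipartite) incidence graph has diameter $6$ and girth $12$; it has order $(s,t)$ if every line has $s+1$ points and every point is on $t+1$ lines. Up to isomorphism there are exactly two generalized hexagons of order $(2,2)$: the split Cayley hexagon $\mathcal{H}(2)$ and its dual. $\mathcal{H}(2)$ has a regular embedding in $\mathrm{PG}(5,2)$, unique up to projectivity: here $\mathcal{P}$ is the set of all points of $\mathrm{PG}(5,2)$ and $\mathcal{L}$ is a set of $63$ lines of $\mathrm{PG}(5,2)$ such that the lines of $\mathcal{L}$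 through any point are coplanar, and for any given point the points at distance at most $4$ from it in the incidence graph are contained in a hyperplane. An explicit model: in $\mathrm{PG}(6,2)$ with coordinates $X_0,\dots,X_6$, take all points of the quadric $X_0X_4+X_1X_5+X_2X_6=X_3^2$ and all lines on this quadric whose Grassmann (Plücker) coordinates $p_{ij}=x_iy_j-x_jy_i$ satisfy $p_{12}=p_{34}$, $p_{54}=p_{32}$, $p_{20}=p_{35}$, $p_{65}=p_{30}$, $p_{01}=p_{36}$, $p_{46}=p_{31}$; then project from the point $(0,0,0,1,0,0,0)$ onto $\mathrm{PG}(5,2)$ by deleting the coordinate $X_3$. Group $K$: points of $\mathrm{PG}(5,2)$ are row vectors and matrices of $\mathrm{GL}(6,2)=\mathrm{PGL}(6,2)$ act by multiplication on the right. Let $$\sigma=\begin{pmatrix}0&1&0&0&0&0\\0&0&1&0&0&0\\0&0&0&1&0&0\\0&0&0&0&1&0\\0&0&0&0&0&1\\1&1&0&1&1&0\end{pmatrix},\qquad \varphi=\begin{pmatrix}0&0&0&1&0&1\\1&1&0&0&0&0\\0&0&0&0&1&1\\0&1&0&0&0&0\\0&0&0&0&0&1\\1&0&1&0&1&1\end{pmatrix},$$ and $K=\langle\sigma^3,\varphi\rangle$, a group of order $63$. *)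

theory Defs
  imports
    "HOL-Analysis.Cartesian_Space"
    "HOL-Library.Z2"
    "HOL-Library.Numeral_Type"
    "HOL-Algebra.Generated_Groups"
begin

section \<open>q-ary graphs and q-ary Deza graphs\<close>

text \<open>
  The space \<open>\<bbbF>\<^sub>q\<^sup>v\<close> is \<^typ>\<open>'a ^ 'n\<close> over a finite field \<^typ>\<open>'a\<close>, so \<open>q = CARD('a)\<close> and
  \<open>v = CARD('n)\<close>. Subspaces are sets of vectors, including the zero vector.
\<close>

definition subspaces_of_dim :: "nat \<Rightarrow> ('a::field ^ 'n) set set" where
  "subspaces_of_dim d = {U. vec.subspace U \<and> vec.dim U = d}"

abbreviation vertices :: "('a::field ^ 'n) set set" where
  "vertices \<equiv> subspaces_of_dim 1"

definition qary_graph :: "('a::{field,finite} ^ 'n) set set \<Rightarrow> bool" where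
  "qary_graph E \<longleftrightarrow> E \<subseteq> subspaces_of_dim 2"

definition adjacent ::
  "('a::field ^ 'n) set set \<Rightarrow> ('a ^ 'n) set \<Rightarrow> ('a ^ 'n) set \<Rightarrow> bool" where
  "adjacent E X Y \<longleftrightarrow> X \<in> vertices \<and> Y \<in> vertices \<and> X \<noteq> Y \<and> vec.span (X \<union> Y) \<in> E"

definition neighborhood ::
  "('a::field ^ 'n) set set \<Rightarrow> ('a ^ 'n) set \<Rightarrow> ('a ^ 'n) set set" where
  "neighborhood E X = insert X {Y. adjacent E X Y}"

definition qary_regular :: "nat \<Rightarrow> ('a::field ^ 'n) set set \<Rightarrow> bool" where
  "qary_regular k E \<longleftrightarrow>
    (\<forall>X\<in>vertices. \<exists>U\<in>subspaces_of_dim (k + 1). neighborhood E X = {Y\<in>vertices. Y \<subseteq> U})"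

definition qary_deza_graph ::
  "nat \<Rightarrow> nat \<Rightarrow> nat \<Rightarrow> nat \<Rightarrow> nat \<Rightarrow> ('a::{field,finite} ^ 'n) set set \<Rightarrow> bool" where
  "qary_deza_graph v k b a q E \<longleftrightarrow>
    CARD('n) = v \<and> CARD('a) = q \<and> a \<le> b \<and> qary_graph E \<and> qary_regular k E \<and>
    (\<forall>X\<in>vertices. \<forall>Y\<in>vertices. X \<noteq> Y \<longrightarrow>
      card (neighborhood E X \<inter> neighborhood E Y - {X, Y}) \<in> {a, b})"

section \<open>Projectivities\<close>

text \<open>
  Vectors are row vectors and matrices act by multiplication on the right. A projectivity is
  the map on subspaces induced by an invertible matrix.
\<close>

definition subspace_image :: "('a::field ^ 'n) set \<Rightarrow> 'a ^ 'n ^ 'n \<Rightarrow> ('a ^ 'n) set" where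
  "subspace_image L A = (\<lambda>x. x v* A) ` L"

definition projectively_equivalent ::
  "('a::field ^ 'n) set set \<Rightarrow> ('a ^ 'n) set set \<Rightarrow> bool" where
  "projectively_equivalent E F \<longleftrightarrow> (\<exists>A. invertible A \<and> (\<lambda>L. subspace_image L A) ` E = F)"

definition GL :: "('a::field ^ 'n ^ 'n) monoid" where
  "GL = \<lparr>carrier = {A. invertible A}, monoid.mult = (**), one = mat 1\<rparr>"

section \<open>The binary field\<close>

lemma UNIV_bit: "(UNIV :: bit set) = {0, 1}"
  by (auto intro: bit.exhaust)

instance bit :: finite
  by standard (simp add: UNIV_bit)

lemma card_bit: "CARD(bit) = 2"
  by (simp add: UNIV_bit)

lemma vector_6 [simp]:
  fixes a b c d e f :: "'a::zero"
  defines "w \<equiv> vector [a, b, c, d, e, f] :: 'a ^ 6"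
  shows "w $ 1 = a" "w $ 2 = b" "w $ 3 = c" "w $ 4 = d" "w $ 5 = e" "w $ 6 = f"
  unfolding w_def vector_def by simp_all

section \<open>The split Cayley hexagon H(2)\<close>

text \<open>
  Coordinates \<open>X\<^sub>0, \<dots>, X\<^sub>6\<close> of \<open>PG(6,2)\<close> are \<open>x $ 0, \<dots>, x $ 6\<close> in \<^typ>\<open>bit ^ 7\<close>.
\<close>

definition parabolic_quadric :: "(bit ^ 7) set" where
  "parabolic_quadric = {x. x$0 * x$4 + x$1 * x$5 + x$2 * x$6 = (x$3)^2}"

definition pluecker :: "'a::comm_ring ^ 'n \<Rightarrow> 'a ^ 'n \<Rightarrow> 'n \<Rightarrow> 'n \<Rightarrow> 'a" where
  "pluecker x y i j = x$i * y$j - x$j * y$i"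

text \<open>
  The Pluecker coordinates of a line are determined up to a common nonzero factor, so it does
  not matter which spanning pair \<open>x, y\<close> is used below.
\<close>

definition hexagon_lines_PG6 :: "(bit ^ 7) set set" where
  "hexagon_lines_PG6 = {L \<in> subspaces_of_dim 2. L \<subseteq> parabolic_quadric \<and>
    (\<exists>x y. L = vec.span {x, y} \<and>
      (let p = pluecker x y in
        p 1 2 = p 3 4 \<and> p 5 4 = p 3 2 \<and> p 2 0 = p 3 5 \<and>
        p 6 5 = p 3 0 \<and> p 0 1 = p 3 6 \<and> p 4 6 = p 3 1))}"

text \<open>Projection from the nucleus \<open>(0,0,0,1,0,0,0)\<close> of the quadric: delete \<open>X\<^sub>3\<close>.\<close>

definition delete_X3 :: "bit ^ 7 \<Rightarrow> bit ^ 6" where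
  "delete_X3 x = vector [x$0, x$1, x$2, x$4, x$5, x$6]"

text \<open>
  The line set of H(2) in its regular embedding in \<open>PG(5,2)\<close>. The point set of the embedded
  hexagon is the set of all points of \<open>PG(5,2)\<close>, so the lines determine the hexagon.
\<close>

definition split_Cayley_hexagon_lines :: "(bit ^ 6) set set" where
  "split_Cayley_hexagon_lines = (\<lambda>L. delete_X3 ` L) ` hexagon_lines_PG6"

section \<open>The group K and its line orbits\<close>

definition sigma :: "bit ^ 6 ^ 6" where
  "sigma = vector
    [vector [0, 1, 0, 0, 0, 0],
     vector [0, 0, 1, 0, 0, 0],
     vector [0, 0, 0, 1, 0, 0],
     vector [0, 0, 0, 0, 1, 0],
     vector [0, 0, 0, 0, 0, 1],
     vector [1, 1, 0, 1, 1, 0]]"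

definition phi :: "bit ^ 6 ^ 6" where
  "phi = vector
    [vector [0, 0, 0, 1, 0, 1],
     vector [1, 1, 0, 0, 0, 0],
     vector [0, 0, 0, 0, 1, 1],
     vector [0, 1, 0, 0, 0, 0],
     vector [0, 0, 0, 0, 0, 1],
     vector [1, 0, 1, 0, 1, 1]]"

definition group_K :: "(bit ^ 6 ^ 6) set" where
  "group_K = generate GL {sigma [^]\<^bsub>GL\<^esub> (3::nat), phi}"

definition K_orbit :: "(bit ^ 6) set \<Rightarrow> (bit ^ 6) set set" where
  "K_orbit L = {subspace_image L A | A. A \<in> group_K}"

definition line1 :: "(bit ^ 6) set" where
  "line1 = vec.span {vector [1, 0, 0, 0, 0, 0], vector [0, 1, 1, 0, 0, 0]}"

definition line2 :: "(bit ^ 6) set" where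
  "line2 = vec.span {vector [1, 0, 0, 0, 0, 0], vector [0, 0, 1, 1, 0, 0]}"

definition line3 :: "(bit ^ 6) set" where
  "line3 = vec.span {vector [0, 1, 0, 0, 0, 0], vector [0, 0, 1, 1, 0, 0]}"

end

theory Submission
  imports Defs
begin

text \<open>
  Identify the vertices with the nonzero vectors of \<open>\<bbbF>\<^sub>2\<^sup>6\<close>. Regularity says that a point \<open>x\<close>, its six
  neighbours and \<open>0\<close> form a three-dimensional space \<open>P x\<close>, and the Deza condition says that two points
  have no common neighbour besides the third point of an edge joining them, or at most one if they are
  not adjacent. So the edges are 63 lines, three coplanar ones through each point, without triangles
  or quadrangles.
  
  The key is a count in a hyperplane \<open>H\<close>. A plane \<open>P x\<close> that is not contained in \<open>H\<close> has exactly four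
  vectors outside \<open>H\<close>. Counting the pairs \<open>(x, y)\<close> with \<open>y \<in> P x\<close> and \<open>y \<notin> H\<close> from the side of \<open>y\<close>
  gives \<open>7 \<cdot> 32 = 4 \<cdot> 56\<close>, so exactly seven points \<open>x\<close> are deep, which means \<open>P x \<subseteq> H\<close>
  (\<open>card_deep\<close>). Two deep planes meet, as they lie in dimension five, and the meeting point is again
  deep: any two deep points are adjacent or have a deep common neighbour (\<open>deep_common_neighbour\<close>).
  
  Now take an edge and a hyperplane that contains the planes of its three points. Seven deep points,
  no triangles and no quadrangles leave only two shapes (\<open>hyperplane_configuration\<close>): either the deep
  points are all the points of one plane \<open>P p\<close>, with centre \<open>p\<close>, or they form a wheel, in which a hub
  \<open>w\<close> has deep neighbours \<open>a\<close>, \<open>u\<close>, \<open>v\<close>, one for each of the points \<open>x\<close>, \<open>y\<close>, \<open>x + y\<close> of the edge.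
  In both cases there is a basis in which all 15 edges inside \<open>H\<close> are known, up to one binary choice
  for a centre (\<open>complete_centre\<close>) and without any choice for a wheel (\<open>wheel_complete_frame\<close>).
  
  What remains are the planes of the 24 points \<open>n\<close> of \<open>H\<close> that are not deep. Such a point lies on one
  edge inside \<open>H\<close>, and its neighbours outside \<open>H\<close> form a coset of that edge; a point outside \<open>H\<close> is
  adjacent to exactly three points of \<open>H\<close>, which are collinear. These two rules propagate so well that
  a small case tree determines all solutions. Its correctness is \<open>search_sound\<close>, and the trees are
  evaluated by the simplifier. Every leaf contains a copy of the split Cayley hexagon in the case
  of a centre and a copy of the first orbit of \<open>K\<close> in the case of a wheel. A copy is
  the whole edge set, because it already has three lines through each point (\<open>has_copy_equivalent\<close>).
\<close>

section \<open>Vector spaces over the field with two elements\<close>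

lemma bit_vec_add_self [simp]: "x + x = (0 :: bit ^ 'n)"
  by (simp add: vec_eq_iff)

lemma bit_vec_add_self_left [simp]: "x + (x + y) = (y :: bit ^ 'n)"
  by (simp add: add.assoc [symmetric])

lemma bit_vec_add_self_right [simp]: "(y + x) + x = (y :: bit ^ 'n)"
  by (simp add: add.assoc)

lemma bit_vec_diff [simp]: "x - y = (x + y :: bit ^ 'n)"
  by (simp add: vec_eq_iff)

lemma bit_vec_eq_iff_add [simp]: "x + y = 0 \<longleftrightarrow> x = (y :: bit ^ 'n)"
  by (metis add_0 bit_vec_add_self_right bit_vec_add_self)

lemma subspace_bit_iff:
  "vec.subspace (U :: (bit ^ 'n) set) \<longleftrightarrow> 0 \<in> U \<and> (\<forall>x\<in>U. \<forall>y\<in>U. x + y \<in> U)"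
proof -
  have "c *s x \<in> U" if "0 \<in> U" "x \<in> U" for c and x :: "bit ^ 'n"
    using that by (cases c) simp_all
  then show ?thesis
    by (auto simp: vec.subspace_def)
qed

lemma span_insert_bit:
  "vec.span (insert a S) = vec.span S \<union> (+) a ` vec.span (S :: (bit ^ 'n) set)"
proof -
  have 1: "(\<exists>k. x - k *s a \<in> vec.span S) \<longleftrightarrow> x \<in> vec.span S \<or> x + a \<in> vec.span S" for x
  proof
    assume "\<exists>k. x - k *s a \<in> vec.span S"
    then obtain k where "x - k *s a \<in> vec.span S" by blast
    then show "x \<in> vec.span S \<or> x + a \<in> vec.span S" by (cases k) simp_all
  next
    assume "x \<in> vec.span S \<or> x + a \<in> vec.span S"
    then show "\<exists>k. x - k *s a \<in> vec.span S"
    proof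
      assume "x \<in> vec.span S"
      then have "x - 0 *s a \<in> vec.span S" by simp
      then show ?thesis by blast
    next
      assume "x + a \<in> vec.span S"
      then have "x - 1 *s a \<in> vec.span S" by simp
      then show ?thesis by blast
    qed
  qed
  have 2: "x + a \<in> vec.span S \<longleftrightarrow> x \<in> (+) a ` vec.span S" for x
  proof
    assume "x + a \<in> vec.span S"
    then show "x \<in> (+) a ` vec.span S"
      by (rule rev_image_eqI) (simp add: add.commute [of x])
  next
    assume "x \<in> (+) a ` vec.span S"
    then obtain y where "y \<in> vec.span S" "x = a + y" by blast
    then show "x + a \<in> vec.span S"
      by (simp add: add.commute [of a])
  qed
  show ?thesis
    by (rule Set.set_eqI) (simp only: vec.span_insert mem_Collect_eq Un_iff 1 2)
qed

lemma span_singleton_bit: "vec.span {x :: bit ^ 'n} = {0, x}"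
  by (auto simp: span_insert_bit)

lemma span_pair_bit: "vec.span {x, y :: bit ^ 'n} = {0, x, y, x + y}"
  by (auto simp: span_insert_bit)

lemma card_span_bit:
  fixes B :: "(bit ^ 'n) set"
  assumes "vec.independent B"
  shows "card (vec.span B) = 2 ^ card B"
proof -
  have "finite B"
    by simp
  then show ?thesis
    using assms
  proof (induction B rule: finite_induct)
    case (insert a B)
    have a: "a \<notin> vec.span B" "vec.independent B"
      using insert.prems insert.hyps by (simp_all add: vec.independent_insert)
    have "vec.span B \<inter> (+) a ` vec.span B = {}"
    proof (rule ccontr)
      assume "vec.span B \<inter> (+) a ` vec.span B \<noteq> {}"
      then obtain y where y: "y \<in> vec.span B" "a + y \<in> vec.span B" by auto
      have "a + y + y \<in> vec.span B"
        using vec.span_add [OF y(2,1)] .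
      then show False
        using a by (simp add: add.assoc)
    qed
    then have "card (vec.span (insert a B)) = card (vec.span B) + card ((+) a ` vec.span B)"
      unfolding span_insert_bit by (intro card_Un_disjoint) simp_all
    also have "card ((+) a ` vec.span B) = card (vec.span B)"
      by (rule card_image) simp
    finally show ?case
      using insert a by simp
  qed simp
qed

lemma card_subspace_bit:
  assumes "U \<in> subspaces_of_dim d"
  shows "card (U :: (bit ^ 'n) set) = 2 ^ d"
proof -
  obtain B where "B \<subseteq> U" "vec.independent B" "U \<subseteq> vec.span B" "card B = vec.dim U"
    using vec.basis_exists .
  moreover from this have "vec.span B = U"
    using assms by (simp add: subspaces_of_dim_def vec.span_subspace)
  ultimately show ?thesis
    using assms card_span_bit [of B] by (simp add: subspaces_of_dim_def)
qed

lemma vertices_bit: "vertices = {{0, x} | x :: bit ^ 'n. x \<noteq> 0}"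
proof (intro Set.set_eqI iffI)
  fix U :: "(bit ^ 'n) set"
  assume U: "U \<in> vertices"
  then have "card U = 2" "0 \<in> U"
    using card_subspace_bit [OF U] vec.subspace_0 by (auto simp: subspaces_of_dim_def)
  then obtain a b where "U = {a, b}" "a \<noteq> b" "a = 0 \<or> b = 0"
    by (auto simp: card_2_iff)
  then obtain x where "U = {0, x}" "x \<noteq> 0"
    by (auto simp: insert_commute)
  then show "U \<in> {{0, x} | x. x \<noteq> 0}" by blast
next
  fix U :: "(bit ^ 'n) set"
  assume "U \<in> {{0, x} | x. x \<noteq> 0}"
  then obtain x where x: "U = {0, x}" "x \<noteq> 0" by blast
  then have "U = vec.span {x}" by (simp add: span_singleton_bit)
  moreover have "vec.dim (vec.span {x}) = 1"
    using x by (simp add: vec.dim_eq_card_independent)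
  ultimately show "U \<in> vertices"
    by (simp add: subspaces_of_dim_def)
qed

lemma line_in_subspaces_of_dim_2:
  assumes "x \<noteq> 0" "y \<noteq> 0" "x \<noteq> (y :: bit ^ 'n)"
  shows "{0, x, y, x + y} \<in> subspaces_of_dim 2"
proof -
  have "vec.independent {x, y}"
    using assms by (auto simp: vec.independent_insert span_singleton_bit)
  then have "vec.dim (vec.span {x, y}) = 2"
    using assms vec.dim_eq_card_independent [of "{x, y}"] by simp
  then have "vec.span {x, y} \<in> subspaces_of_dim 2"
    by (simp add: subspaces_of_dim_def)
  then show ?thesis
    by (simp only: span_pair_bit)
qed

lemma line_of_points:
  assumes "U \<in> subspaces_of_dim 2" "x \<in> U" "y \<in> U" "x \<noteq> 0" "y \<noteq> 0" "x \<noteq> (y :: bit ^ 'n)"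
  shows "U = {0, x, y, x + y}"
proof -
  have "0 \<in> U" "x + y \<in> U"
    using assms by (auto simp: subspaces_of_dim_def subspace_bit_iff)
  then have "{0, x, y, x + y} \<subseteq> U"
    using assms by simp
  moreover have "card {0, x, y, x + y} = card U"
    using card_subspace_bit [OF assms(1)]
      card_subspace_bit [OF line_in_subspaces_of_dim_2 [OF assms(4-6)]] by simp
  ultimately show ?thesis
    by (metis card_subset_eq finite)
qed

section \<open>Neighbourhoods as maps on vectors\<close>

text \<open>
  The plane of \<open>x\<close> as a set of vectors; for \<open>x \<noteq> y\<close> nonzero the quadruple is the line joining them.
\<close>

definition nbhd :: "(bit ^ 'n) set set \<Rightarrow> bit ^ 'n \<Rightarrow> (bit ^ 'n) set" where
  "nbhd E x = {y. y = 0 \<or> y = x \<or> {0, x, y, x + y} \<in> E}"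

text \<open>
  The properties of \<open>x \<mapsto> P x\<close> on which everything below depends. The last one excludes triangles and
  quadrangles at the same time.
\<close>

locale deza_nbhd =
  fixes P :: "bit ^ 6 \<Rightarrow> (bit ^ 6) set"
  assumes zero_mem: "x \<noteq> 0 \<Longrightarrow> 0 \<in> P x"
    and self_mem: "x \<noteq> 0 \<Longrightarrow> x \<in> P x"
    and add_mem: "x \<noteq> 0 \<Longrightarrow> y \<in> P x \<Longrightarrow> z \<in> P x \<Longrightarrow> y + z \<in> P x"
    and card_nbhd: "x \<noteq> 0 \<Longrightarrow> card (P x) = 8"
    and nbhd_sym: "x \<noteq> 0 \<Longrightarrow> y \<noteq> 0 \<Longrightarrow> y \<in> P x \<longleftrightarrow> x \<in> P y"
    and common_unique: "\<lbrakk>x \<noteq> 0; y \<noteq> 0; x \<noteq> y; k \<in> P x; k \<in> P y; k' \<in> P x; k' \<in> P y;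
      k \<notin> {0, x, y}; k' \<notin> {0, x, y}\<rbrakk> \<Longrightarrow> k = k'"

lemma qary_deza_graph_nbhd:
  fixes E :: "(bit ^ 6) set set"
  assumes "qary_deza_graph 6 2 1 0 2 E"
  shows "deza_nbhd (nbhd E)" and "E = {{0, x, y, x + y} | x y. x \<noteq> 0 \<and> y \<noteq> 0 \<and> x \<noteq> y \<and> y \<in> nbhd E x}"
proof -
  have E: "E \<subseteq> subspaces_of_dim 2"
    using assms unfolding qary_deza_graph_def qary_graph_def by blast
  have reg: "\<exists>U\<in>subspaces_of_dim 3. neighborhood E X = {Y\<in>vertices. Y \<subseteq> U}"
    if "X \<in> vertices" for X
  proof -
    have "qary_regular 2 E"
      using assms unfolding qary_deza_graph_def by blast
    then have "\<exists>U\<in>subspaces_of_dim (2 + 1). neighborhood E X = {Y\<in>vertices. Y \<subseteq> U}"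
      using that unfolding qary_regular_def by blast
    then show ?thesis by simp
  qed
  have deza: "card (neighborhood E X \<inter> neighborhood E Y - {X, Y}) \<le> 1"
    if "X \<in> vertices" "Y \<in> vertices" "X \<noteq> Y" for X Y
  proof -
    have "card (neighborhood E X \<inter> neighborhood E Y - {X, Y}) \<in> {0, 1}"
      using assms that unfolding qary_deza_graph_def by blast
    then show ?thesis by (metis empty_iff insert_iff order_refl zero_le_one)
  qed
  have vert: "{0, x} \<in> vertices" if "x \<noteq> 0" for x :: "bit ^ 6"
    using that unfolding vertices_bit by blast
  have pt_eq: "{0, x} = {0, y} \<longleftrightarrow> x = y" if "x \<noteq> 0" "y \<noteq> 0" for x y :: "bit ^ 6"
    using that by (auto simp: doubleton_eq_iff)
  have nb: "{0, y} \<in> neighborhood E {0, x} \<longleftrightarrow> y \<in> nbhd E x" if "x \<noteq> 0" "y \<noteq> 0" for x y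
  proof -
    have "vec.span ({0, x} \<union> {0, y}) = {0, x, y, x + y}"
      by (auto simp: span_insert_bit)
    moreover have "{0, x} = {0, y} \<Longrightarrow> y = x" "{0, y} = {0, x} \<longleftrightarrow> y = x"
      using that pt_eq by blast+
    ultimately show ?thesis
      using that vert [of x] vert [of y]
      by (auto simp only: neighborhood_def adjacent_def nbhd_def insert_iff mem_Collect_eq)
  qed
  have plane: "nbhd E x \<in> subspaces_of_dim 3" if "x \<noteq> 0" for x
  proof -
    obtain U where U: "U \<in> subspaces_of_dim 3" "neighborhood E {0, x} = {Y\<in>vertices. Y \<subseteq> U}"
      using reg [OF vert [OF \<open>x \<noteq> 0\<close>]] by blast
    then have U0: "0 \<in> U"
      by (auto simp: subspaces_of_dim_def subspace_bit_iff)
    have "y \<in> nbhd E x \<longleftrightarrow> y \<in> U" for y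
    proof (cases "y = 0")
      case False
      then show ?thesis
        using nb [OF that False] U U0 vert [OF False] by auto
    qed (use U0 in \<open>simp add: nbhd_def\<close>)
    then have "nbhd E x = U" by auto
    with U show ?thesis by simp
  qed
  show "deza_nbhd (nbhd E)"
  proof
    fix x y z :: "bit ^ 6"
    assume x: "x \<noteq> 0"
    show "0 \<in> nbhd E x" "x \<in> nbhd E x"
      by (auto simp: nbhd_def)
    show "y \<in> nbhd E x \<Longrightarrow> z \<in> nbhd E x \<Longrightarrow> y + z \<in> nbhd E x"
      using plane [OF x] by (auto simp: subspaces_of_dim_def subspace_bit_iff)
    show "card (nbhd E x) = 8"
      using card_subspace_bit [OF plane [OF x]] by simp
    show "y \<in> nbhd E x \<longleftrightarrow> x \<in> nbhd E y" if "y \<noteq> 0"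
      using x that by (auto simp: nbhd_def insert_commute add.commute)
  next
    fix x y k k' :: "bit ^ 6"
    assume *: "x \<noteq> 0" "y \<noteq> 0" "x \<noteq> y" "k \<in> nbhd E x" "k \<in> nbhd E y" "k' \<in> nbhd E x" "k' \<in> nbhd E y"
      "k \<notin> {0, x, y}" "k' \<notin> {0, x, y}"
    let ?C = "neighborhood E {0, x} \<inter> neighborhood E {0, y} - {{0, x}, {0, y}}"
    have "{0, k} \<in> ?C" "{0, k'} \<in> ?C"
      using * nb pt_eq by auto
    moreover have "card ?C \<le> 1"
      using * vert pt_eq by (intro deza) auto
    ultimately have "{0, k} = {0, k'}"
      by (metis card_le_Suc0_iff_eq finite One_nat_def)
    then show "k = k'"
      using * pt_eq by auto
  qed
  show "E = {{0, x, y, x + y} | x y. x \<noteq> 0 \<and> y \<noteq> 0 \<and> x \<noteq> y \<and> y \<in> nbhd E x}" (is "_ = ?R")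
  proof (intro Set.set_eqI iffI)
    fix l assume "l \<in> E"
    with E have l: "l \<in> subspaces_of_dim 2" by auto
    then have "card l = 4" "0 \<in> l"
      using card_subspace_bit [OF l] by (auto simp: subspaces_of_dim_def subspace_bit_iff)
    then have "card (l - {0}) = 3"
      by simp
    then obtain x y z where "l - {0} = {x, y, z}" "x \<noteq> y"
      by (auto simp: card_3_iff)
    then have xy: "x \<in> l" "y \<in> l" "x \<noteq> 0" "y \<noteq> 0" "x \<noteq> y"
      by auto
    then have "l = {0, x, y, x + y}"
      using line_of_points l by blast
    with xy \<open>l \<in> E\<close> show "l \<in> ?R"
      by (auto simp: nbhd_def)
  next
    fix l assume "l \<in> ?R"
    then show "l \<in> E"
      by (auto simp: nbhd_def)
  qed
qed

section \<open>Hyperplanes\<close>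

definition hyperplane :: "(bit ^ 6) set \<Rightarrow> bool" where
  "hyperplane H \<longleftrightarrow> 0 \<in> H \<and> (\<forall>u\<in>H. \<forall>v\<in>H. u + v \<in> H) \<and>
     (\<forall>u. \<forall>v. u \<notin> H \<longrightarrow> v \<notin> H \<longrightarrow> u + v \<in> H) \<and> card H = 32"

lemma card_bit_6: "card (UNIV :: (bit ^ 6) set) = 64"
  by (simp add: CARD_vec card_bit)

lemma hyperplane_add_iff:
  assumes "hyperplane H"
  shows "u + v \<in> H \<longleftrightarrow> (u \<in> H \<longleftrightarrow> v \<in> H)"
proof
  assume "u \<in> H \<longleftrightarrow> v \<in> H"
  then show "u + v \<in> H"
    using assms by (auto simp: hyperplane_def)
next
  assume uv: "u + v \<in> H"
  have add: "\<And>s t. s \<in> H \<Longrightarrow> t \<in> H \<Longrightarrow> s + t \<in> H"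
    using assms by (auto simp: hyperplane_def)
  have "u \<in> H \<Longrightarrow> u + (u + v) \<in> H" "v \<in> H \<Longrightarrow> (u + v) + v \<in> H"
    using add uv by blast+
  then show "u \<in> H \<longleftrightarrow> v \<in> H"
    by auto
qed

text \<open>
  Five linear conditions on a functional cannot be independent on six coordinates: two of the 64
  functionals agree on the five vectors, and their difference vanishes there.
\<close>

lemma hyperplane_through_five:
  obtains H where "hyperplane H" "{a, b, c, d, e} \<subseteq> H"
proof -
  define dot :: "bit ^ 6 \<Rightarrow> bit ^ 6 \<Rightarrow> bit" where "dot h v = (\<Sum>i\<in>UNIV. h $ i * v $ i)" for h v
  have dot_add: "dot h (u + v) = dot h u + dot h v" "dot (u + v) h = dot u h + dot v h" for h u v
    by (simp_all only: dot_def vector_add_component distrib_left distrib_right sum.distrib)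
  define f where "f h = (dot h a, dot h b, dot h c, dot h d, dot h e)" for h
  have "\<not> inj f"
  proof
    assume "inj f"
    then have "card (UNIV :: (bit ^ 6) set) \<le> card (UNIV :: (bit \<times> bit \<times> bit \<times> bit \<times> bit) set)"
      using card_inj_on_le [of f UNIV UNIV] by simp
    then show False
      by (simp add: card_bit_6 card_bit)
  qed
  then obtain h h' where "f h = f h'" "h \<noteq> h'"
    by (auto simp: inj_def)
  define k where "k = h + h'"
  define H where "H = {v. dot k v = 0}"
  have "k \<noteq> 0"
    using \<open>h \<noteq> h'\<close> by (simp add: k_def bit_vec_eq_iff_add)
  then obtain i where i: "k $ i = 1"
    by (auto simp: vec_eq_iff)
  define t :: "bit ^ 6" where "t = axis i 1"
  have "dot k t = (\<Sum>j\<in>UNIV. if j = i then 1 else 0)"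
    using i unfolding dot_def t_def axis_def by (intro sum.cong) auto
  then have t: "dot k t = 1"
    by simp
  have "(+) t ` H = - H"
  proof (intro Set.set_eqI iffI)
    fix v assume "v \<in> (+) t ` H"
    then show "v \<in> - H" by (auto simp: H_def dot_add t)
  next
    fix v assume "v \<in> - H"
    then have "dot k v = 1" by (auto simp: H_def)
    then have "t + v \<in> H" by (simp add: H_def dot_add t)
    then show "v \<in> (+) t ` H" by (rule rev_image_eqI) simp
  qed
  then have "card (- H) = card H"
    by (metis card_image inj_on_add)
  moreover have "card H + card (- H) = 64"
    by (metis card_bit_6 card_Un_disjoint Compl_disjoint Compl_partition finite)
  ultimately have "card H = 32"
    by simp
  moreover have "0 \<in> H"
    by (simp add: H_def dot_def)
  moreover have "u + v \<in> H" if "u \<in> H \<longleftrightarrow> v \<in> H" for u v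
    using that by (auto simp: H_def dot_add)
  ultimately have "hyperplane H"
    by (auto simp: hyperplane_def)
  moreover have "{a, b, c, d, e} \<subseteq> H"
    using \<open>f h = f h'\<close> by (auto simp: H_def k_def f_def dot_add)
  ultimately show thesis
    by (rule that)
qed

section \<open>Points whose plane lies in a given hyperplane\<close>

context deza_nbhd begin

definition deep :: "(bit ^ 6) set \<Rightarrow> (bit ^ 6) set" where
  "deep H = {x. x \<noteq> 0 \<and> P x \<subseteq> H}"

text \<open>
  Translation by a vector of the plane outside \<open>H\<close> exchanges the two halves.
\<close>

lemma split_by_hyperplane:
  assumes "hyperplane H" "x \<noteq> 0" "\<not> P x \<subseteq> H"
  shows "card (P x \<inter> H) = 4" "card (P x - H) = 4"
proof -
  obtain t where t: "t \<in> P x" "t \<notin> H"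
    using assms by blast
  have "(+) t ` (P x \<inter> H) = P x - H"
  proof (intro Set.set_eqI iffI)
    fix v assume "v \<in> (+) t ` (P x \<inter> H)"
    then show "v \<in> P x - H"
      using t assms by (auto simp: hyperplane_add_iff add_mem)
  next
    fix v assume v: "v \<in> P x - H"
    then have "t + v \<in> P x \<inter> H"
      using t assms by (auto simp: hyperplane_add_iff add_mem)
    then show "v \<in> (+) t ` (P x \<inter> H)" by (rule rev_image_eqI) simp
  qed
  then have "card (P x - H) = card (P x \<inter> H)"
    by (metis card_image inj_on_add)
  moreover have "card (P x \<inter> H) + card (P x - H) = 8"
    using card_nbhd [OF assms(2)] by (metis card_Diff_subset_Int card_Int_Diff finite)
  ultimately show "card (P x \<inter> H) = 4" "card (P x - H) = 4"
    by simp_all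
qed

text \<open>
  The double count: each of the 32 vectors outside \<open>H\<close> lies in the planes of seven points, and each
  point that is not deep contributes four such vectors.
\<close>

lemma card_deep:
  assumes "hyperplane H"
  shows "card (deep H) = 7"
proof -
  have 0: "y \<noteq> 0" if "y \<notin> H" for y
    using assms that by (auto simp: hyperplane_def)
  have sym: "y \<notin> H \<Longrightarrow> x \<noteq> 0 \<Longrightarrow> y \<in> P x \<longleftrightarrow> x \<in> P y" for x y
    using 0 nbhd_sym by blast
  have "bij_betw prod.swap (Sigma (- {0}) (\<lambda>x. P x - H)) (Sigma (- H) (\<lambda>y. P y - {0}))"
    by (rule bij_betwI [where g = prod.swap]) (auto dest: sym [THEN iffD1] sym [THEN iffD2])
  then have "card (Sigma (- {0}) (\<lambda>x. P x - H)) = card (Sigma (- H) (\<lambda>y. P y - {0}))"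
    by (rule bij_betw_same_card)
  then have "(\<Sum>x\<in>- {0}. card (P x - H)) = (\<Sum>y\<in>- H. card (P y - {0}))"
    by (simp add: card_SigmaI)
  also have "\<dots> = (\<Sum>y\<in>- H. 7)"
    using 0 zero_mem card_nbhd by (intro sum.cong) (auto simp: card_Diff_singleton)
  also have "\<dots> = 7 * card (- H)"
    by simp
  also have "card (- H) = 32"
    using assms by (simp add: Compl_eq_Diff_UNIV card_Diff_subset CARD_vec card_bit hyperplane_def)
  finally have "(\<Sum>x\<in>- {0}. card (P x - H)) = 224"
    by simp
  moreover have "(\<Sum>x\<in>- {0}. card (P x - H)) = (\<Sum>x\<in>- {0} - deep H. 4)"
  proof (rule sum.mono_neutral_cong_right)
    show "\<forall>x\<in>- {0} - (- {0} - deep H). card (P x - H) = 0"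
      by (auto simp: deep_def)
    show "card (P x - H) = 4" if "x \<in> - {0} - deep H" for x
      using that split_by_hyperplane(2) [OF assms] by (auto simp: deep_def)
  qed auto
  ultimately have "card (- {0} - deep H) = 56"
    by simp
  moreover have "card (- {0} - deep H) = card (- {0 :: bit ^ 6}) - card (deep H)"
    by (rule card_Diff_subset) (auto simp: deep_def)
  moreover have "card (- {0 :: bit ^ 6}) = 63"
    by (simp add: Compl_eq_Diff_UNIV card_Diff_subset CARD_vec card_bit)
  moreover have "card (deep H) \<le> card (- {0 :: bit ^ 6})"
    by (rule card_mono) (auto simp: deep_def)
  ultimately show ?thesis
    by simp
qed

definition adj :: "bit ^ 6 \<Rightarrow> bit ^ 6 \<Rightarrow> bool" where
  "adj x y \<longleftrightarrow> x \<noteq> 0 \<and> y \<noteq> 0 \<and> x \<noteq> y \<and> y \<in> P x"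

lemma adj_sym: "adj x y \<Longrightarrow> adj y x"
  by (auto simp: adj_def nbhd_sym)

lemma adj_third: "adj x y \<Longrightarrow> adj x (x + y)"
  using add_mem self_mem by (auto simp: adj_def bit_vec_eq_iff_add)

lemma adj_triangle: "adj x y \<Longrightarrow> adj x z \<Longrightarrow> adj y z \<Longrightarrow> z = x + y"
  using common_unique [of x y z "x + y"] adj_third [of x y] adj_third [of y x] adj_sym [of x y]
  by (auto simp: adj_def add.commute)

lemma adj_quadrangle: "adj x y \<Longrightarrow> adj y z \<Longrightarrow> adj z t \<Longrightarrow> adj t x \<Longrightarrow> x \<noteq> z \<Longrightarrow> y = t"
  using common_unique [of x z y t] by (auto simp: adj_def nbhd_sym)

text \<open>
  The sum map \<open>P x \<times> P y \<rightarrow> H\<close> goes from 64 to 32 elements, so the planes share a nonzero vector \<open>z\<close>.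
  If \<open>z\<close> were not deep, its plane would meet \<open>H\<close> in four vectors only, but it contains \<open>0\<close>, the line
  through \<open>x\<close> and \<open>z\<close>, and \<open>y\<close>.
\<close>

lemma deep_common_neighbour:
  assumes "hyperplane H" "x \<in> deep H" "y \<in> deep H" "x \<noteq> y" "\<not> adj x y"
  obtains z where "z \<in> deep H" "adj x z" "adj z y"
proof -
  have xy: "x \<noteq> 0" "y \<noteq> 0" "P x \<subseteq> H" "P y \<subseteq> H" "y \<notin> P x" "x \<notin> P y"
    using assms nbhd_sym by (auto simp: deep_def adj_def)
  let ?f = "\<lambda>(r, s). r + s"
  have "?f ` (P x \<times> P y) \<subseteq> H"
    using xy assms(1) by (auto simp: hyperplane_add_iff)
  moreover have "card H < card (P x \<times> P y)"
    using xy assms(1) by (simp add: hyperplane_def card_nbhd)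
  ultimately have "\<not> inj_on ?f (P x \<times> P y)"
    by (metis card_inj_on_le finite leD)
  then obtain r s r' s' where rs: "r \<in> P x" "r' \<in> P x" "s \<in> P y" "s' \<in> P y" "r + s = r' + s'"
    "(r, s) \<noteq> (r', s')"
    unfolding inj_on_def by auto
  define z where "z = r + r'"
  have "r + r' = s + s'"
    using rs(5) by (metis (no_types) add.assoc add.commute bit_vec_add_self_left)
  then have "z = s + s'"
    by (simp add: z_def)
  then have z: "z \<in> P x" "z \<in> P y"
    using rs xy add_mem z_def by metis+
  have "z \<noteq> 0"
    using rs by (auto simp: z_def bit_vec_eq_iff_add)
  have adjs: "adj x z" "adj z y"
    using z xy \<open>z \<noteq> 0\<close> by (auto simp: adj_def nbhd_sym)
  have "P z \<subseteq> H"
  proof (rule ccontr)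
    assume "\<not> P z \<subseteq> H"
    then have "card (P z \<inter> H) = 4"
      using split_by_hyperplane assms(1) \<open>z \<noteq> 0\<close> by blast
    moreover have "{0, x, z, x + z, y} \<subseteq> P z \<inter> H"
      using xy z \<open>z \<noteq> 0\<close> zero_mem self_mem add_mem nbhd_sym by auto
    moreover have "card {0, x, z, x + z, y} = 5"
    proof -
      have "y \<noteq> x + z"
        using adj_third [OF adjs(1)] assms(5) by auto
      moreover have "x + z \<noteq> 0" "x + z \<noteq> x" "x + z \<noteq> z"
        using xy adjs by (auto simp: bit_vec_eq_iff_add adj_def)
      ultimately show ?thesis
        using adjs assms(4) by (auto simp: adj_def)
    qed
    ultimately show False
      using card_mono [of "P z \<inter> H" "{0, x, z, x + z, y}"] by simp
  qed
  then have "z \<in> deep H"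
    using \<open>z \<noteq> 0\<close> by (simp add: deep_def)
  then show thesis
    using that adjs by blast
qed

end

section \<open>The two shapes of the set of deep points\<close>

context deza_nbhd begin

lemma nbhd_eqI:
  assumes "x \<noteq> 0" "card S = 8" "S \<subseteq> P x"
  shows "P x = S"
  using assms by (metis card_nbhd card_subset_eq finite)

lemma nbhd_plane:
  assumes "adj x y" "a \<in> P x" "a \<notin> {0, x, y, x + y}"
  shows "P x = {0, x, y, x + y, a, a + x, a + y, a + (x + y)}"
proof (rule nbhd_eqI)
  show x: "x \<noteq> 0" using assms by (simp add: adj_def)
  show "{0, x, y, x + y, a, a + x, a + y, a + (x + y)} \<subseteq> P x"
    using assms x zero_mem self_mem add_mem by (simp add: adj_def)
  define l where "l = {0, x, y, x + y}"
  have l: "r + s \<in> l" if "r \<in> l" "s \<in> l" for r s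
    using that unfolding l_def by (elim insertE emptyE) (simp_all add: add.commute add.left_commute)
  have "card l = 4"
    using assms by (auto simp: adj_def l_def)
  moreover from this have "card ((+) a ` l) = 4"
    by (metis card_image inj_on_add)
  moreover have "a + r \<notin> l" if "r \<in> l" for r
    using l [OF _ that, of "a + r"] assms(3) by (auto simp: l_def [symmetric])
  then have "l \<inter> (+) a ` l = {}"
    by blast
  ultimately have "card (l \<union> (+) a ` l) = 8"
    by (subst card_Un_disjoint) simp_all
  moreover have "{0, x, y, x + y, a, a + x, a + y, a + (x + y)} = l \<union> (+) a ` l"
    unfolding l_def image_insert image_empty Un_insert_left Un_empty_left add.right_neutral ..
  ultimately show "card {0, x, y, x + y, a, a + x, a + y, a + (x + y)} = 8"
    by (simp only:)
qed

lemma outside_line: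
  assumes "adj x y"
  obtains a where "a \<in> P x" "a \<notin> {0, x, y, x + y}"
proof -
  have "card {0, x, y, x + y} \<le> 4"
    by (intro order_trans [OF card_insert_le_m1]) auto
  then have "\<not> P x \<subseteq> {0, x, y, x + y}"
    using card_mono [of "{0, x, y, x + y}" "P x"] card_nbhd [of x] assms
    by (auto simp: adj_def)
  then show thesis using that by blast
qed

text \<open>
  If every deep point is on or adjacent to the line of \<open>p\<close> and \<open>q\<close>, then all deep points off the line
  see it in the same point: otherwise the deep common neighbour of two of them, wherever it is attached
  to the line, closes a triangle or a quadrangle.
\<close>

lemma adjacent_to_common_point:
  assumes H: "hyperplane H" and D: "deep H \<subseteq> {d. d \<in> {p, q, p + q} \<or> adj d p \<or> adj d q \<or> adj d (p + q)}"
    and pq: "adj p q"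
    and d: "d \<in> deep H" "d \<notin> {p, q, p + q}" "adj d p"
    and d': "d' \<in> deep H" "d' \<notin> {p, q, p + q}" "adj d' q"
  shows False
proof -
  have third: "adj p (p + q)" "adj q (p + q)"
    using adj_third [OF pq] adj_third [OF adj_sym [OF pq]] by (simp_all add: add.commute)
  have "\<not> adj d d'"
    using adj_quadrangle [of d p q d'] pq d d' adj_sym by blast
  moreover have "d \<noteq> d'"
    using adj_triangle [of p q d] pq d d' adj_sym by blast
  ultimately obtain e where e: "e \<in> deep H" "adj d e" "adj e d'"
    using deep_common_neighbour [OF H d(1) d'(1)] by blast
  consider "e = p" | "e = q" | "e = p + q" | "e \<notin> {p, q, p + q}" "adj e p"
    | "e \<notin> {p, q, p + q}" "adj e q" | "e \<notin> {p, q, p + q}" "adj e (p + q)"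
    using D e(1) by blast
  then show False
  proof cases
    case 1
    then show ?thesis using adj_triangle [of p q d'] e d' pq adj_sym by blast
  next
    case 2
    then show ?thesis using adj_triangle [of p q d] e d pq adj_sym by blast
  next
    case 3
    then show ?thesis using adj_triangle [of p "p + q" d] e d third adj_sym by simp
  next
    case 4
    then show ?thesis using adj_quadrangle [of e p q d'] e d' pq adj_sym by blast
  next
    case 5
    then show ?thesis using adj_quadrangle [of e q p d] e d pq adj_sym by blast
  next
    case 6
    then show ?thesis using adj_quadrangle [of e "p + q" p d] e d third adj_sym by blast
  qed
qed

text \<open>
  Start from a line \<open>{x, y, x + y}\<close> and a hyperplane that contains its three planes. If some deep point
  has no neighbour on the line, it is a hub, and its common neighbours with the points of the line
  complete the wheel. Otherwise the previous lemma makes all seven deep points adjacent to one of \<open>x\<close>,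
  \<open>y\<close>, \<open>x + y\<close>.
\<close>

lemma hyperplane_configuration:
  obtains (centre) H p where "hyperplane H" "p \<noteq> 0" "\<And>n. n \<in> P p \<Longrightarrow> n \<noteq> 0 \<Longrightarrow> P n \<subseteq> H"
  | (wheel) H x y a u v w where "hyperplane H" "{x, y, x + y, a, u, v, w} \<subseteq> deep H"
      "adj x y" "adj x a" "adj y u" "adj (x + y) v" "adj w a" "adj w u" "adj w v"
      "w \<notin> {x, y, x + y}" "\<not> adj w x" "\<not> adj w y" "\<not> adj w (x + y)"
proof -
  define x :: "bit ^ 6" where "x = axis 1 1"
  have "x \<noteq> 0" by (simp add: x_def)
  have "\<not> P x \<subseteq> {0, x}"
    using card_mono [of "{0, x}" "P x"] card_nbhd [OF \<open>x \<noteq> 0\<close>] by (auto simp: card_insert_if split: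
        if_splits)
  then obtain y where "y \<in> P x" "y \<notin> {0, x}" by blast
  then have xy: "adj x y"
    using \<open>x \<noteq> 0\<close> by (auto simp: adj_def)
  then have yx: "adj y x" and zx: "adj (x + y) x"
    using adj_third adj_sym by blast+
  have third: "x + y + x = y"
    by (metis add.commute bit_vec_add_self_left)
  obtain a where a: "a \<in> P x" "a \<notin> {0, x, y, x + y}"
    using outside_line [OF xy] .
  obtain u where u: "u \<in> P y" "u \<notin> {0, y, x, y + x}"
    using outside_line [OF yx] .
  obtain v where v: "v \<in> P (x + y)" "v \<notin> {0, x + y, x, x + y + x}"
    using outside_line [OF zx] .
  obtain H where H: "hyperplane H" "{x, y, a, u, v} \<subseteq> H"
    using hyperplane_through_five .
  then have "0 \<in> H" by (simp add: hyperplane_def)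
  have "P x \<subseteq> H" "P y \<subseteq> H" "P (x + y) \<subseteq> H"
    unfolding nbhd_plane [OF xy a] nbhd_plane [OF yx u] nbhd_plane [OF zx v] third
    using H \<open>0 \<in> H\<close> by (simp_all add: hyperplane_add_iff)
  then have D3: "x \<in> deep H" "y \<in> deep H" "x + y \<in> deep H"
    using xy yx zx by (simp_all only: deep_def adj_def mem_Collect_eq simp_thms)
  show thesis
  proof (cases "\<exists>w\<in>deep H. w \<notin> {x, y, x + y} \<and> \<not> adj w x \<and> \<not> adj w y \<and> \<not> adj w (x + y)")
    case True
    then obtain w where w: "w \<in> deep H" "w \<notin> {x, y, x + y}" "\<not> adj w x" "\<not> adj w y" "\<not> adj w (x + y)"
      by blast
    obtain a' where "a' \<in> deep H" "adj w a'" "adj a' x"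
      using deep_common_neighbour [OF H(1) w(1) D3(1)] w by blast
    moreover obtain u' where "u' \<in> deep H" "adj w u'" "adj u' y"
      using deep_common_neighbour [OF H(1) w(1) D3(2)] w by blast
    moreover obtain v' where "v' \<in> deep H" "adj w v'" "adj v' (x + y)"
      using deep_common_neighbour [OF H(1) w(1) D3(3)] w by blast
    ultimately show thesis
      using wheel [of H x y a' u' v' w] H(1) D3 w xy adj_sym by simp
  next
    case False
    then have D: "deep H \<subseteq> {d. d \<in> {x, y, x + y} \<or> adj d x \<or> adj d y \<or> adj d (x + y)}"
      by blast
    let ?l = "{x, y, x + y}"
    have "card ?l \<le> 3"
      by (intro order_trans [OF card_insert_le_m1]) auto
    then have "\<not> deep H \<subseteq> ?l"
      using card_deep [OF H(1)] card_mono [of ?l "deep H"] by auto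
    then obtain d where d: "d \<in> deep H" "d \<notin> ?l" by blast
    with D obtain p where p: "p \<in> ?l" "adj d p" by blast
    have sums: "y + x = x + y" "y + (x + y) = x" "x + y + x = y"
      using third by (metis add.commute bit_vec_add_self_right)+
    have adjs: "adj x y" "adj y x" "adj x (x + y)" "adj (x + y) x" "adj y (x + y)" "adj (x + y) y"
      using xy yx adj_third [OF xy] adj_third [OF yx] adj_sym unfolding sums by blast+
    have line: "{p, q, p + q} = ?l \<and> adj p q" if "p \<in> ?l" "q \<in> ?l" "p \<noteq> q" for p q
      using that by (elim insertE emptyE) (simp_all add: sums adjs insert_commute)
    have unique: "adj e p" if e: "e \<in> deep H" "e \<notin> ?l" for e
    proof (rule ccontr)
      assume "\<not> adj e p"
      then obtain q where q: "q \<in> ?l" "adj e q" "q \<noteq> p"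
        using D e by blast
      then have l: "{p, q, p + q} = ?l" "adj p q"
        using line [of p q] p q by blast+
      have "deep H \<subseteq> {d. d \<in> {p, q, p + q} \<or> (\<exists>r\<in>{p, q, p + q}. adj d r)}"
        using D unfolding l(1) by blast
      then have "deep H \<subseteq> {d. d \<in> {p, q, p + q} \<or> adj d p \<or> adj d q \<or> adj d (p + q)}"
        by (simp only: bex_simps simp_thms)
      moreover have "d \<notin> {p, q, p + q}" "e \<notin> {p, q, p + q}"
        using d(2) e(2) unfolding l(1) .
      ultimately show False
        using adjacent_to_common_point [OF H(1) _ l(2) d(1) _ p(2) e(1) _ q(2)] by blast
    qed
    have "deep H \<subseteq> P p - {0}"
    proof
      fix e assume e: "e \<in> deep H"
      show "e \<in> P p - {0}"
      proof (cases "e \<in> ?l")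
        case True
        then have "e = p \<or> adj p e"
          using line [of p e] p by blast
        moreover have "e \<noteq> 0"
          using e by (simp add: deep_def)
        ultimately show ?thesis
          by (metis Diff_iff adj_def self_mem singletonD)
      next
        case False
        then show ?thesis
          using adj_sym [OF unique [OF e]] by (auto simp only: adj_def Diff_iff singleton_iff)
      qed
    qed
    moreover have "p \<noteq> 0"
      using p(2) by (simp add: adj_def)
    moreover have "card (P p - {0}) = 7"
      using card_nbhd zero_mem \<open>p \<noteq> 0\<close> by (simp add: card_Diff_singleton)
    ultimately have "deep H = P p - {0}"
      using card_deep [OF H(1)] by (metis card_subset_eq finite)
    then have deep: "n \<in> deep H" if "n \<in> P p" "n \<noteq> 0" for n
      using that by simp
    show thesis
    proof (rule centre [OF H(1) \<open>p \<noteq> 0\<close>])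
      show "P n \<subseteq> H" if "n \<in> P p" "n \<noteq> 0" for n
        using deep [OF that] by (simp add: deep_def)
    qed
  qed
qed

end

unbundle bit_operations_syntax

section \<open>Vectors labelled by integers\<close>

text \<open>
  Bit \<open>i\<close> of \<open>k\<close> is the coefficient of the \<open>i\<close>-th basis vector, so addition of vectors becomes \<open>XOR\<close> of
  integers, which the simplifier can evaluate. The function \<open>lin\<close> below is the same combination for
  vectors that are themselves given by integers.
\<close>

fun comb :: "(bit ^ 'n) list \<Rightarrow> int \<Rightarrow> bit ^ 'n" where
  "comb [] k = 0"
| "comb (b # bs) k = (if even k then comb bs (k div 2) else b + comb bs (k div 2))"

fun lin :: "int list \<Rightarrow> int \<Rightarrow> int" where
  "lin [] k = 0"
| "lin (f # fs) k = (if even k then lin fs (k div 2) else f XOR lin fs (k div 2))"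

lemma xor_div_2: "(j XOR k) div 2 = (j div 2) XOR (k div 2 :: int)"
  using drop_bit_xor [of 1 j k] by (simp add: drop_bit_eq_div)

lemma comb_xor: "comb bs (j XOR k) = comb bs j + comb bs k"
  by (induction bs arbitrary: j k) (simp_all add: xor_div_2 even_xor_iff add.assoc add.left_commute)

lemma comb_0: "comb bs 0 = 0"
  by (induction bs) simp_all

lemma comb_lin: "comb bs (lin fs k) = comb (map (comb bs) fs) k"
  by (induction fs arbitrary: k) (simp_all add: comb_xor comb_0)

lemma comb_append:
  "comb (bs @ [b]) k = comb bs k + (if even (k div 2 ^ length bs) then 0 else b)"
  by (induction bs arbitrary: k) (simp_all add: add.assoc zdiv_zmult2_eq power_Suc2 mult.commute)

lemma xor_range:
  assumes "0 \<le> j" "j < 2 ^ n" "0 \<le> k" "k < 2 ^ n"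
  shows "0 \<le> j XOR k \<and> j XOR k < (2 ^ n :: int)"
  using assms by (simp add: XOR_upper)

lemma xor_cancel [simp]: "j XOR (j XOR k) = (k :: int)" "(j XOR k) XOR k = (j :: int)"
  by (simp_all flip: xor.assoc) (simp add: xor.assoc)

lemma xor_eq_0: "j XOR k = 0 \<longleftrightarrow> j = (k :: int)"
  by (metis xor.right_neutral xor_cancel(1) xor_self_eq)

lemma xor_eq_left [simp]: "j XOR k = j \<longleftrightarrow> k = (0 :: int)" "k XOR j = j \<longleftrightarrow> k = 0" "j = k XOR j \<longleftrightarrow> k = 0"
  "j = j XOR k \<longleftrightarrow> k = 0"
  by (metis xor.right_neutral xor_cancel(1), metis xor.left_neutral xor.commute xor_cancel(1),
      metis xor.left_neutral xor.commute xor_cancel(1), metis xor.right_neutral xor_cancel(1))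

section \<open>Exhaustive search over the planes that leave a hyperplane\<close>

text \<open>
  In these coordinates the points of a hyperplane are \<open>1, \<dots>, 31\<close> and the points outside it \<open>32, \<dots>, 63\<close>.
  The list \<open>L\<close> contains the lines inside the hyperplane. A point that is not deep lies on exactly one of
  them.
\<close>

definition through :: "int list list \<Rightarrow> int \<Rightarrow> int list list" where
  "through L n = filter (\<lambda>l. n \<in> set l) L"

definition own_line :: "int list list \<Rightarrow> int \<Rightarrow> int list" where
  "own_line L n = (case through L n of [l] \<Rightarrow> l | _ \<Rightarrow> [])"

text \<open>
  A necessary condition for a point outside the hyperplane to be adjacent to both \<open>n\<close> and \<open>m\<close>: their sum
  is then a third neighbour, which is not deep, and \<open>n\<close>, \<open>m\<close> have no common neighbour inside.
\<close>

definition compat :: "int list list \<Rightarrow> int \<Rightarrow> int \<Rightarrow> bool" where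
  "compat L n m \<longleftrightarrow> own_line L (n XOR m) \<noteq> [] \<and>
     (let l = own_line L m in \<forall>x\<in>set (own_line L n). x \<in> set l \<longrightarrow> x = n \<or> x = m)"

text \<open>
  The neighbours of an outer point in the hyperplane are \<open>n\<close>, \<open>m\<close> and \<open>n XOR m\<close>; the inequality chooses
  one name for each such triple.
\<close>

definition candidates :: "int list list \<Rightarrow> int \<Rightarrow> int list" where
  "candidates L n = filter (\<lambda>m. own_line L m \<noteq> [] \<and> m < n XOR m \<and> compat L n m) [1..31]"

text \<open>
  Known adjacencies are stored by the outer point. A state has moreover one outer neighbour for each inner
  point whose outer neighbours are known; they form a coset of its own line.
\<close>

type_synonym incidences = "(int \<times> int list) list"

type_synonym state = "(int \<times> int) list \<times> incidences"

fun look :: "incidences \<Rightarrow> int \<Rightarrow> int list" where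
  "look [] s = []"
| "look ((s', ns) # S) s = (if s = s' then ns else look S s)"

fun put :: "int \<Rightarrow> int \<Rightarrow> incidences \<Rightarrow> incidences" where
  "put s n [] = [(s, [n])]"
| "put s n ((s', ns) # S) = (if s = s' then (s', n # ns) # S else (s', ns) # put s n S)"

text \<open>
  Enters \<open>n\<close> as a neighbour of the outer points in the list and appends the sums that become neighbours
  as well to the queue. The result \<open>None\<close> signals a contradiction.
\<close>

primrec spread :: "int list list \<Rightarrow> int \<Rightarrow> int list \<Rightarrow> incidences \<Rightarrow> (int \<times> int) list
    \<Rightarrow> (incidences \<times> (int \<times> int) list) option" where
  "spread L n [] S q = Some (S, q)"
| "spread L n (s # ss) S q = (let ms = filter (\<lambda>m. m \<noteq> n) (look S s) in
     if list_all (compat L n) ms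
     then spread L n ss (put s n S) (map (\<lambda>m. (n XOR m, s)) ms @ q)
     else None)"

text \<open>
  The natural number bounds the number of steps. When it is used up, the state is returned as it is; this
  loses no solutions.
\<close>

primrec propagate :: "int list list \<Rightarrow> nat \<Rightarrow> (int \<times> int) list \<Rightarrow> state \<Rightarrow> state option" where
  "propagate L 0 q st = Some st"
| "propagate L (Suc f) q st = (case q of [] \<Rightarrow> Some st | (n, s) # q' \<Rightarrow>
     (case map_of (fst st) n of
       Some s' \<Rightarrow> if s XOR s' \<in> set (0 # own_line L n) then propagate L f q' st else None
     | None \<Rightarrow> (case spread L n (map (\<lambda>x. s XOR x) (0 # own_line L n)) (snd st) q' of
         None \<Rightarrow> None
       | Some (S, q'') \<Rightarrow> propagate L f q'' ((n, s) # fst st, S))))"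

text \<open>
  A case tree. A node \<open>Branch n s\<close> distinguishes the triples of neighbours of \<open>s\<close> that contain \<open>n\<close>, a
  node \<open>Cosets n\<close> the outer neighbours of \<open>n\<close>; only the cases that survive propagation have subtrees.
  A leaf gives a linear map and its inverse on the unit vectors, that is, an embedding of the geometry
  that is looked for.
\<close>

datatype cert = Branch int int "cert list" | Cosets int cert | Leaf "int list" "int list"

definition on_line :: "int list list \<Rightarrow> incidences \<Rightarrow> int \<Rightarrow> int \<Rightarrow> bool" where
  "on_line L S i j = (
     if i < 32 then if j < 32 then list_ex (\<lambda>l. i \<in> set l \<and> j \<in> set l) L else i \<in> set (look S j)
     else if j < 32 then j \<in> set (look S i) else i XOR j \<in> set (look S i))"

definition survivors :: "int list list \<Rightarrow> (int \<times> int) list list \<Rightarrow> state \<Rightarrow> state list" where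
  "survivors L qs st = List.map_filter (\<lambda>q. propagate L 200 q st) qs"

primrec check :: "int list list \<Rightarrow> (int \<times> int) list \<Rightarrow> cert \<Rightarrow> state \<Rightarrow> bool"
  and check_all :: "int list list \<Rightarrow> (int \<times> int) list \<Rightarrow> cert list \<Rightarrow> state list \<Rightarrow> bool" where
  "check L T (Branch n s cs) st = (n \<in> set (look (snd st) s) \<and>
     check_all L T cs (survivors L (map (\<lambda>m. [(m, s), (n XOR m, s)]) (candidates L n)) st))"
| "check L T (Cosets n c) st = (own_line L n \<noteq> [] \<and>
     list_all (check L T c) (survivors L (map (\<lambda>s. [(n, s)]) [32..63]) st))"
| "check L T (Leaf F G) st = (length F = 6 \<and> map (lin F) G = [1, 2, 4, 8, 16, 32] \<and>
     list_all (\<lambda>(a, b). on_line L (snd st) (lin F a) (lin F b)) T)"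
| "check_all L T [] sts = (sts = [])"
| "check_all L T (c # cs) sts = (case sts of [] \<Rightarrow> False | st # sts' \<Rightarrow> check L T c st \<and> check_all L T
    cs sts')"

text \<open>
  The order of the entries matters: the first two are the pair whose adjacency is assumed in
  \<open>hyperplane_frame\<close>.
\<close>

fun is_line :: "int list \<Rightarrow> bool" where
  "is_line [i, j, k] \<longleftrightarrow> 0 < i \<and> i < 32 \<and> 0 < j \<and> j < 32 \<and> i \<noteq> j \<and> k = i XOR j"
| "is_line _ \<longleftrightarrow> False"

definition well_formed :: "int list \<Rightarrow> int list list \<Rightarrow> bool" where
  "well_formed D L \<longleftrightarrow> list_all is_line L \<and> distinct D \<and> length D = 7 \<and>
     list_all (\<lambda>n. 0 < n \<and> n < 32 \<and> length (remdups (concat (through L n))) = 7) D"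

definition covered :: "int list list \<Rightarrow> int \<Rightarrow> bool" where
  "covered L n \<longleftrightarrow> list_ex (\<lambda>l. n \<in> set l) L"

definition complete :: "int list \<Rightarrow> int list list \<Rightarrow> bool" where
  "complete D L \<longleftrightarrow> list_all (\<lambda>n. n \<in> set D \<or> own_line L n \<noteq> []) [1..31] \<and> list_all (\<lambda>n. own_line L n
      = []) (0 # D)"

section \<open>Frames: coordinates in which the lines of a hyperplane are known\<close>

locale labelled_hyperplane = deza_nbhd +
  fixes H :: "(bit ^ 6) set" and g :: "int \<Rightarrow> bit ^ 6"
  assumes hyperplane: "hyperplane H"
    and g_xor: "g (j XOR k) = g j + g k"
    and g_eq_0: "0 \<le> k \<Longrightarrow> k < 64 \<Longrightarrow> g k = 0 \<Longrightarrow> k = 0"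
    and g_in_H: "0 \<le> k \<Longrightarrow> k < 64 \<Longrightarrow> g k \<in> H \<longleftrightarrow> k < 32"
begin

lemma g_0: "g 0 = 0"
  using g_xor [of 0 0] by simp

lemma g_inj: "0 \<le> j \<Longrightarrow> j < 64 \<Longrightarrow> 0 \<le> k \<Longrightarrow> k < 64 \<Longrightarrow> g j = g k \<longleftrightarrow> j = k"
  using g_eq_0 [of "j XOR k"] xor_range [of j 6 k] by (auto simp: g_xor xor_eq_0)

lemma g_image: "g ` {0..<64} = UNIV"
proof -
  have "inj_on g {0..<64}"
    by (rule inj_onI) (simp add: g_inj)
  then have "card (g ` {0..<64}) = 64"
    by (simp add: card_image)
  then show ?thesis
    by (metis card_bit_6 card_subset_eq finite subset_UNIV)
qed

lemma g_surj: obtains k where "0 \<le> k" "k < 64" "g k = v"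
proof -
  have "v \<in> g ` {0..<64}"
    unfolding g_image ..
  then show thesis
    using that by auto
qed

lemma g_surj_H:
  assumes "v \<in> H"
  obtains k where "0 \<le> k" "k < 32" "g k = v"
  using assms g_surj [of v] g_in_H by metis

abbreviation Q :: "int \<Rightarrow> int \<Rightarrow> bool" where
  "Q j k \<equiv> g k \<in> P (g j)"

lemma g_nonzero: "0 < k \<Longrightarrow> k < 64 \<Longrightarrow> g k \<noteq> 0"
  using g_eq_0 [of k] by auto

lemma Q_sym: "0 < j \<Longrightarrow> j < 64 \<Longrightarrow> 0 < k \<Longrightarrow> k < 64 \<Longrightarrow> Q j k \<longleftrightarrow> Q k j"
  using g_nonzero nbhd_sym by simp

lemma Q_xor: "0 < j \<Longrightarrow> j < 64 \<Longrightarrow> Q j k \<Longrightarrow> Q j m \<Longrightarrow> Q j (k XOR m)"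
  using g_nonzero add_mem by (simp add: g_xor)

lemma Q_self: "0 < j \<Longrightarrow> j < 64 \<Longrightarrow> Q j j"
  using g_nonzero self_mem by simp

lemma xor_bounds: "0 < i \<Longrightarrow> i < 32 \<Longrightarrow> 0 < j \<Longrightarrow> j < 32 \<Longrightarrow> i \<noteq> j \<Longrightarrow> 0 < i XOR j \<and> i XOR j < (32 :: int)"
  using xor_range [of i 5 j] xor_eq_0 [of i j] by (auto simp: less_le)

end

locale hyperplane_frame = labelled_hyperplane +
  fixes D :: "int list" and L :: "int list list"
  assumes well_formed: "well_formed D L"
    and deep_points: "n \<in> set D \<Longrightarrow> P (g n) \<subseteq> H"
    and lines: "[i, j, k] \<in> set L \<Longrightarrow> Q i j"
begin

lemma line_cases:
  assumes "l \<in> set L"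
  obtains i j where "l = [i, j, i XOR j]" "0 < i" "i < 32" "0 < j" "j < 32" "i \<noteq> j" "Q i j"
proof -
  have "is_line l"
    using assms well_formed by (simp add: well_formed_def list_all_iff)
  then obtain i j where "l = [i, j, i XOR j]" "0 < i" "i < 32" "0 < j" "j < 32" "i \<noteq> j"
    by (cases l rule: is_line.cases) auto
  with that lines assms show thesis by blast
qed

lemma line_bounds: "l \<in> set L \<Longrightarrow> n \<in> set l \<Longrightarrow> 0 < n \<and> n < 32"
  by (erule line_cases) (auto simp: xor_bounds)

lemma line_card: "l \<in> set L \<Longrightarrow> card (set l) = 3"
  by (erule line_cases) (auto simp: card_insert_if)

lemma line_Q:
  assumes "l \<in> set L" "m \<in> set l" "n \<in> set l"
  shows "Q m n"
proof -
  obtain i j where l: "l = [i, j, i XOR j]" "0 < i" "i < 32" "0 < j" "j < 32" "i \<noteq> j" "Q i j"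
    using line_cases assms by blast
  have 1: "Q j i" "Q i i" "Q j j" using l Q_sym Q_self by auto
  then have 2: "Q i (i XOR j)" "Q j (i XOR j)" using l Q_xor by auto
  then have 3: "Q (i XOR j) i" "Q (i XOR j) j" using l Q_sym xor_bounds [of i j] by auto
  have "Q (i XOR j) (i XOR j)" using Q_self xor_bounds [of i j] l by auto
  with 1 2 3 l assms show ?thesis by auto
qed

lemma deep_eq: "deep H = g ` set D"
proof -
  have D: "0 < n" "n < 32" if "n \<in> set D" for n
    using that well_formed by (auto simp: well_formed_def list_all_iff)
  have "inj_on g (set D)"
  proof (rule inj_onI)
    fix j k assume "j \<in> set D" "k \<in> set D" "g j = g k"
    then show "j = k" using D [of j] D [of k] g_inj [of j k] by simp
  qed
  then have "card (g ` set D) = 7"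
    using well_formed by (simp add: card_image well_formed_def distinct_card)
  moreover have "g n \<in> deep H" if "n \<in> set D" for n
    using D [OF that] deep_points [OF that] g_nonzero [of n] by (simp add: deep_def)
  then have "g ` set D \<subseteq> deep H"
    by blast
  ultimately show ?thesis
    using card_deep [OF hyperplane] by (metis card_subset_eq finite)
qed

lemma deep_iff:
  assumes "0 < n" "n < 32"
  shows "P (g n) \<subseteq> H \<longleftrightarrow> n \<in> set D"
proof
  assume "P (g n) \<subseteq> H"
  then have "g n \<in> g ` set D"
    using g_nonzero assms by (simp add: deep_def flip: deep_eq)
  then obtain m where "m \<in> set D" "g n = g m" by auto
  moreover from this have "0 < m" "m < 32"
    using well_formed by (auto simp: well_formed_def list_all_iff)
  ultimately show "n \<in> set D"
    using assms by (simp add: g_inj)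
qed (rule deep_points)

text \<open>
  Three lines through \<open>n\<close> already fill the plane.
\<close>

lemma deep_nbhd:
  assumes n: "n \<in> set D"
  shows "P (g n) = g ` insert 0 (set (concat (through L n)))"
proof -
  have n': "0 < n" "n < 32" "length (remdups (concat (through L n))) = 7"
    using n well_formed by (auto simp: well_formed_def list_all_iff)
  let ?S = "insert 0 (set (concat (through L n)))"
  have S: "0 < k \<and> k < 32" if "k \<in> set (concat (through L n))" for k
    using that line_bounds by (auto simp: through_def)
  have "card (set (concat (through L n))) = 7"
    using n'(3) by (metis length_remdups_card_conv)
  moreover have "0 \<notin> set (concat (through L n))"
    using S by blast
  ultimately have "card ?S = 8"
    by simp
  moreover have "inj_on g ?S"
  proof (rule inj_onI)
    fix j k assume "j \<in> ?S" "k \<in> ?S" "g j = g k"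
    moreover have "0 \<le> j \<and> j < 64" "0 \<le> k \<and> k < 64"
      using S [of j] S [of k] calculation by force+
    ultimately show "j = k" using g_inj by simp
  qed
  ultimately have "card (g ` ?S) = 8"
    by (simp only: card_image)
  moreover have "g ` ?S \<subseteq> P (g n)"
    using line_Q n' zero_mem g_nonzero by (auto simp: through_def g_0)
  ultimately show ?thesis
    using nbhd_eqI g_nonzero n' by simp
qed

text \<open>
  For a point that is not deep the plane meets \<open>H\<close> in four vectors only, so one line accounts for all
  its neighbours inside.
\<close>

lemma own_nbhd:
  assumes "0 < n" "n < 32" "n \<notin> set D" "l \<in> set L" "n \<in> set l"
  shows "P (g n) \<inter> H = g ` insert 0 (set l)"
proof -
  have "\<not> P (g n) \<subseteq> H"
    using deep_iff assms by blast
  then have "card (P (g n) \<inter> H) = 4"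
    using split_by_hyperplane hyperplane g_nonzero assms by simp
  moreover have l: "0 < k \<and> k < 32" if "k \<in> set l" for k
    using line_bounds assms that by blast
  have "card (insert 0 (set l)) = 4"
    using line_card assms l by (subst card_insert_disjoint) auto
  moreover have "inj_on g (insert 0 (set l))"
  proof (rule inj_onI)
    fix j k assume "j \<in> insert 0 (set l)" "k \<in> insert 0 (set l)" "g j = g k"
    moreover have "0 \<le> j \<and> j < 64" "0 \<le> k \<and> k < 64"
      using l [of j] l [of k] calculation by force+
    ultimately show "j = k" using g_inj by simp
  qed
  ultimately have "card (g ` insert 0 (set l)) = card (P (g n) \<inter> H)"
    by (simp only: card_image)
  moreover have "g ` insert 0 (set l) \<subseteq> P (g n) \<inter> H"
  proof -
    have "0 \<in> P (g n)" "0 \<in> H"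
      using zero_mem g_nonzero assms hyperplane by (simp_all add: hyperplane_def)
    moreover have "g k \<in> P (g n)" "g k \<in> H" if "k \<in> set l" for k
      using that line_Q assms l [OF that] g_in_H [of k] by auto
    ultimately show ?thesis
      by (auto simp: g_0)
  qed
  ultimately show ?thesis
    by (metis card_subset_eq finite)
qed

text \<open>
  A point of \<open>H\<close> that is on no known line is not adjacent to any point that is: the known lines exhaust the
  inner neighbours of the points they cover. Being not deep, it nevertheless has a line inside \<open>H\<close>.
\<close>

lemma uncovered_nbhd:
  assumes r: "0 < r" "r < 32" "\<not> covered L r"
  obtains k where "0 < k" "k < 32" "k \<noteq> r" "Q r k" "\<not> covered L k" "\<not> covered L (r XOR k)"
proof -
  have uncov: "\<not> covered L k" if k: "0 < k" "k < 32" "Q r k" for k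
  proof
    assume "covered L k"
    then obtain l where l: "l \<in> set L" "k \<in> set l"
      by (auto simp: covered_def list_ex_iff)
    have "Q k r" using Q_sym k r by simp
    moreover have "g r \<in> H" using g_in_H r by simp
    ultimately have "\<exists>l'\<in>set L. g r \<in> g ` insert 0 (set l')"
    proof (cases "k \<in> set D")
      case True
      then have "g r \<in> g ` insert 0 (set (concat (through L k)))"
        using \<open>Q k r\<close> deep_nbhd by simp
      then show ?thesis using l by (auto simp: through_def)
    next
      case False
      then show ?thesis
        using own_nbhd [OF k(1,2) _ l] \<open>Q k r\<close> \<open>g r \<in> H\<close> l by blast
    qed
    then obtain l' m where "l' \<in> set L" "m \<in> insert 0 (set l')" "g r = g m"
      by blast
    moreover from this have "0 \<le> m \<and> m < 64"
      using line_bounds by force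
    ultimately have "r \<in> set l'" "l' \<in> set L"
      using r g_inj by auto
    then show False
      using r by (auto simp: covered_def list_ex_iff)
  qed
  have "r \<notin> set D"
  proof
    assume "r \<in> set D"
    then have "length (remdups (concat (through L r))) = 7"
      using well_formed by (auto simp: well_formed_def list_all_iff)
    then have "through L r \<noteq> []" by auto
    then show False
      using r by (auto simp: covered_def through_def list_ex_iff filter_empty_conv)
  qed
  then have "card (P (g r) \<inter> H) = 4"
    using split_by_hyperplane hyperplane g_nonzero r deep_iff by simp
  moreover have "card {0, g r} \<le> 2" "finite {0, g r}"
    by (simp_all add: card_insert_if)
  ultimately have "\<not> P (g r) \<inter> H \<subseteq> {0, g r}"
    using card_mono [of "{0, g r}" "P (g r) \<inter> H"] by linarith
  then obtain v where v: "v \<in> P (g r)" "v \<in> H" "v \<noteq> 0" "v \<noteq> g r"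
    by blast
  obtain k where k: "0 \<le> k" "k < 32" "g k = v"
    using g_surj_H v by blast
  then have k': "0 < k" "k \<noteq> r" "Q r k"
    using v g_0 by (auto simp: less_le)
  then have "Q r (r XOR k)"
    using Q_xor Q_self r by simp
  then show thesis
    using that [of k] uncov k k' xor_bounds [of r k] r by blast
qed

end

section \<open>Soundness of the search\<close>

lemma look_mem: "n \<in> set (look S s) \<Longrightarrow> \<exists>ns. (s, ns) \<in> set S \<and> n \<in> set ns"
  by (induction S s rule: look.induct) (auto split: if_splits)

lemma put_mem: "(s', ns) \<in> set (put s n S) \<Longrightarrow> m \<in> set ns \<Longrightarrow>
    (s' = s \<and> m = n) \<or> (\<exists>ns'. (s', ns') \<in> set S \<and> m \<in> set ns')"
  by (induction s n S rule: put.induct) (auto split: if_splits)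

lemma own_line_mem:
  assumes "own_line L n \<noteq> []"
  shows "own_line L n \<in> set L" "n \<in> set (own_line L n)"
proof -
  obtain l where l: "through L n = [l]"
    using assms by (auto simp: own_line_def split: list.splits)
  then have "l \<in> set (through L n)" by simp
  then show "own_line L n \<in> set L" "n \<in> set (own_line L n)"
    using l by (auto simp: own_line_def through_def)
qed

locale complete_frame = hyperplane_frame +
  assumes complete: "complete D L"
begin

lemma own_line_iff:
  assumes "0 < n" "n < 32"
  shows "own_line L n \<noteq> [] \<longleftrightarrow> n \<notin> set D"
proof -
  have "n \<in> set [1..31]"
    using assms by simp
  then show ?thesis
    using complete by (auto simp: complete_def list_all_iff simp del: set_upto)
qed

text \<open>
  The adjacencies about which the search reasons, between a point of \<open>H\<close> that is not deep and a point
  outside.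
\<close>

definition meets :: "int \<Rightarrow> int \<Rightarrow> bool" where
  "meets n s \<longleftrightarrow> own_line L n \<noteq> [] \<and> 32 \<le> s \<and> s < 64 \<and> Q n s"

lemma own_line_bounds:
  assumes "own_line L n \<noteq> []"
  shows "0 < n" "n < 32" "n \<notin> set D"
proof -
  show *: "0 < n" "n < 32"
    using line_bounds own_line_mem assms by blast+
  show "n \<notin> set D"
    using own_line_iff * assms by blast
qed

lemma xor_outside:
  assumes "32 \<le> s" "s < 64" "0 \<le> x" "x < 32"
  shows "32 \<le> s XOR x \<and> s XOR x < (64 :: int)"
proof -
  have b: "0 \<le> s XOR x" "s XOR x < 64"
    using xor_range [of s 6 x] assms by auto
  have "g (s XOR x) \<notin> H"
    using assms g_in_H [of s] g_in_H [of x] by (simp add: g_xor hyperplane_add_iff [OF hyperplane])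
  with b show ?thesis
    using g_in_H [OF b] by simp
qed

lemma xor_inside:
  assumes "32 \<le> s" "s < 64" "32 \<le> t" "t < 64"
  shows "0 \<le> s XOR t \<and> s XOR t < (32 :: int)"
proof -
  have b: "0 \<le> s XOR t" "s XOR t < 64"
    using xor_range [of s 6 t] assms by auto
  have "g (s XOR t) \<in> H"
    using assms g_in_H [of s] g_in_H [of t] by (simp add: g_xor hyperplane_add_iff [OF hyperplane])
  with b show ?thesis
    using g_in_H [OF b] by simp
qed

lemma meets_coset:
  assumes "meets n s" "x \<in> set (0 # own_line L n)"
  shows "meets n (s XOR x)"
proof -
  have n: "0 < n" "n < 32" "own_line L n \<in> set L" "n \<in> set (own_line L n)" "Q n s" "32 \<le> s" "s < 64"
    using assms(1) own_line_bounds own_line_mem by (auto simp: meets_def)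
  have "0 \<le> x \<and> x < 32" "Q n x"
    using assms(2) n line_bounds [OF n(3)] line_Q [OF n(3,4)] zero_mem g_nonzero g_0 by force+
  then show ?thesis
    using n xor_outside [of s x] Q_xor [of n s x] assms(1) by (simp add: meets_def)
qed

lemma meets_same_coset:
  assumes "meets n s" "meets n s'"
  shows "s XOR s' \<in> set (0 # own_line L n)"
proof -
  have n: "0 < n" "n < 32" "own_line L n \<in> set L" "n \<in> set (own_line L n)" "n \<notin> set D"
    using assms(1) own_line_bounds own_line_mem by (auto simp: meets_def)
  have s: "0 \<le> s XOR s'" "s XOR s' < 32"
    using xor_inside assms by (auto simp: meets_def)
  moreover have "Q n (s XOR s')"
    using assms n Q_xor by (simp add: meets_def)
  ultimately have "g (s XOR s') \<in> P (g n) \<inter> H"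
    using g_in_H by simp
  then have "g (s XOR s') \<in> g ` insert 0 (set (own_line L n))"
    using own_nbhd n by simp
  then obtain x where "x \<in> insert 0 (set (own_line L n))" "g (s XOR s') = g x"
    by blast
  moreover from this have "0 \<le> x" "x < 64"
    using line_bounds [OF n(3)] by force+
  ultimately show ?thesis
    using s g_inj by simp
qed

lemma meets_Q:
  assumes "meets n s"
  shows "Q n s" "Q s n" "0 < n" "n < 32" "32 \<le> s" "s < 64"
  using assms own_line_bounds [of n] Q_sym [of n s] by (auto simp: meets_def)

lemma meetsI:
  assumes "0 < n" "n < 32" "32 \<le> s" "s < 64" "Q s n"
  shows "meets n s"
proof -
  have "Q n s"
    using assms Q_sym by simp
  moreover have "g s \<notin> H"
    using assms g_in_H by simp
  ultimately have "\<not> P (g n) \<subseteq> H"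
    by blast
  then have "own_line L n \<noteq> []"
    using own_line_iff deep_iff assms by blast
  with \<open>Q n s\<close> assms show ?thesis
    by (simp add: meets_def)
qed

text \<open>
  An outer point and a common neighbour inside \<open>H\<close> would be two common neighbours of \<open>n\<close> and \<open>m\<close>.
\<close>

lemma meets_sum:
  assumes "meets n s" "meets m s" "n \<noteq> m"
  shows "meets (n XOR m) s" "compat L n m"
proof -
  note n = meets_Q [OF assms(1)] and m = meets_Q [OF assms(2)]
  show nm: "meets (n XOR m) s"
    using n m assms(3) xor_bounds [of n m] Q_xor [of s n m] by (intro meetsI) auto
  have "x = n \<or> x = m" if x: "x \<in> set (own_line L n)" "x \<in> set (own_line L m)" for x
  proof (rule ccontr)
    assume "\<not> (x = n \<or> x = m)"
    have own: "own_line L n \<in> set L" "n \<in> set (own_line L n)" "own_line L m \<in> set L" "m \<in> set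
        (own_line L m)"
      using own_line_mem assms by (auto simp: meets_def)
    have xb: "0 < x" "x < 32"
      using line_bounds own x by blast+
    have "g x \<in> P (g n)" "g x \<in> P (g m)"
      using line_Q own x by blast+
    moreover have "g x \<notin> {0, g n, g m}" "g s \<notin> {0, g n, g m}" "g n \<noteq> g m" "g x \<noteq> g s"
      using xb n m g_inj [of x n] g_inj [of x m] g_inj [of s n] g_inj [of s m] g_inj [of n m] g_inj [of x s]
        g_nonzero [of x] g_nonzero [of s] \<open>\<not> (x = n \<or> x = m)\<close> assms(3) by auto
    moreover have "g n \<noteq> 0" "g m \<noteq> 0"
      using n m g_nonzero by auto
    ultimately show False
      using common_unique [of "g n" "g m" "g x" "g s"] n(1) m(1) by blast
  qed
  then show "compat L n m"
    using nm by (auto simp: compat_def meets_def Let_def)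
qed

text \<open>
  The plane of an outer point is not contained in \<open>H\<close>, hence meets it in exactly three points.
\<close>

lemma meets_candidates:
  assumes "meets n s"
  shows "\<exists>m\<in>set (candidates L n). meets m s \<and> meets (n XOR m) s"
proof -
  note n = meets_Q [OF assms]
  have "g s \<in> P (g s)" "g s \<notin> H" "g s \<noteq> 0"
    using n g_nonzero self_mem g_in_H by auto
  then have "card (P (g s) \<inter> H) = 4"
    using split_by_hyperplane hyperplane by blast
  moreover have "card {0, g n} \<le> 2" "finite {0, g n}"
    by (simp_all add: card_insert_if)
  ultimately have "\<not> P (g s) \<inter> H \<subseteq> {0, g n}"
    using card_mono [of "{0, g n}" "P (g s) \<inter> H"] by linarith
  then obtain v where v: "v \<in> P (g s)" "v \<in> H" "v \<noteq> 0" "v \<noteq> g n"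
    by blast
  then obtain k where k: "0 \<le> k" "k < 32" "g k = v"
    using g_surj_H by blast
  then have "0 < k" "k \<noteq> n" "Q s k"
    using v g_0 by (auto simp: less_le)
  then have k': "meets k s" "meets (n XOR k) s" "n XOR k \<noteq> n"
    using k n meetsI meets_sum [OF assms] by auto
  \<comment> \<open>both names of the triple are possible; candidates has the smaller one\<close>
  define m where "m = min k (n XOR k)"
  have "m = k \<and> n XOR m = n XOR k \<or> m = n XOR k \<and> n XOR m = k"
    by (auto simp: m_def min_def)
  then have m: "meets m s" "meets (n XOR m) s" "m \<noteq> n" "m \<noteq> n XOR m" "m \<le> n XOR m"
    using k' \<open>k \<noteq> n\<close> n(3) by (auto simp: m_def min_def)
  moreover have "m < n XOR m"
    using m(4,5) by linarith
  ultimately have "m \<in> set (candidates L n)"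
    using meets_sum [OF assms, of m] meets_Q [OF m(1)] by (auto simp: candidates_def meets_def)
  then show ?thesis
    using m by blast
qed

lemma meets_exists:
  assumes "own_line L n \<noteq> []"
  shows "\<exists>s\<in>set [32..63]. meets n s"
proof -
  have n: "0 < n" "n < 32" "n \<notin> set D"
    using own_line_bounds assms by auto
  then obtain v where v: "v \<in> P (g n)" "v \<notin> H"
    using deep_iff by blast
  obtain s where s: "0 \<le> s" "s < 64" "g s = v"
    using g_surj by blast
  then have "32 \<le> s"
    using v g_in_H by force
  then have "meets n s"
    using s v assms by (simp add: meets_def)
  moreover have "s \<in> set [32..63]"
    using s \<open>32 \<le> s\<close> by (simp only: set_upto atLeastAtMost_iff) auto
  ultimately show ?thesis by blast
qed

definition all_meet :: "(int \<times> int) list \<Rightarrow> bool" where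
  "all_meet q \<longleftrightarrow> (\<forall>(n, s)\<in>set q. meets n s)"

definition sound_incidences :: "incidences \<Rightarrow> bool" where
  "sound_incidences S \<longleftrightarrow> (\<forall>(s, ns)\<in>set S. \<forall>n\<in>set ns. meets n s)"

definition sound :: "state \<Rightarrow> bool" where
  "sound st \<longleftrightarrow> all_meet (fst st) \<and> sound_incidences (snd st)"

lemma sound_look: "sound_incidences S \<Longrightarrow> n \<in> set (look S s) \<Longrightarrow> meets n s"
  by (fastforce simp: sound_incidences_def dest: look_mem)

lemma sound_put: "sound_incidences S \<Longrightarrow> meets n s \<Longrightarrow> sound_incidences (put s n S)"
  by (fastforce simp: sound_incidences_def dest: put_mem)

lemma spread_sound:
  assumes "\<forall>s\<in>set ss. meets n s" "sound_incidences S" "all_meet q"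
  shows "\<exists>S' q'. spread L n ss S q = Some (S', q') \<and> sound_incidences S' \<and> all_meet q'"
  using assms
proof (induction ss arbitrary: S q)
  case (Cons s ss)
  define ms where "ms = filter (\<lambda>m. m \<noteq> n) (look S s)"
  have ms: "meets n s" "meets m s" "n \<noteq> m" if "m \<in> set ms" for m
    using that Cons.prems sound_look by (auto simp: ms_def)
  have "list_all (compat L n) ms"
    using meets_sum(2) [OF ms] by (auto simp: list_all_iff)
  moreover have "all_meet (map (\<lambda>m. (n XOR m, s)) ms @ q)"
    using meets_sum(1) [OF ms] Cons.prems by (auto simp: all_meet_def)
  moreover have "sound_incidences (put s n S)"
    using sound_put Cons.prems by simp
  ultimately show ?case
    using Cons.IH Cons.prems by (simp add: Let_def flip: ms_def)
qed simp

lemma propagate_sound: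
  assumes "sound st" "all_meet q"
  shows "\<exists>st'. propagate L f q st = Some st' \<and> sound st'"
  using assms
proof (induction f arbitrary: q st)
  case (Suc f)
  show ?case
  proof (cases q)
    case Nil
    then show ?thesis using Suc.prems by simp
  next
    case (Cons ns q')
    obtain n s where ns: "ns = (n, s)" by fastforce
    have n: "meets n s" "all_meet q'"
      using Suc.prems by (auto simp: all_meet_def Cons ns)
    show ?thesis
    proof (cases "map_of (fst st) n")
      case None
      have "\<forall>t\<in>set (map (\<lambda>x. s XOR x) (0 # own_line L n)). meets n t"
        using meets_coset [OF n(1)] by (simp only: set_map image_iff) blast
      moreover have "sound_incidences (snd st)"
        using Suc.prems by (simp add: sound_def)
      ultimately obtain S q'' where S: "spread L n (map (\<lambda>x. s XOR x) (0 # own_line L n)) (snd st)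
          q' = Some (S, q'')"
          "sound_incidences S" "all_meet q''"
        using spread_sound n(2) by blast
      then have "sound ((n, s) # fst st, S)"
        using n Suc.prems by (simp add: sound_def all_meet_def)
      then show ?thesis
        using Suc.IH [OF _ S(3)] None S(1) by (simp add: Cons ns)
    next
      case (Some s')
      then have "meets n s'"
        using Suc.prems map_of_SomeD by (fastforce simp: sound_def all_meet_def)
      then show ?thesis
        using Suc.IH [OF Suc.prems(1) n(2)] meets_same_coset [OF n(1)] Some by (simp add: Cons ns)
    qed
  qed
qed simp

text \<open>
  The existence of \<open>G\<close> guarantees that the linear map given by \<open>F\<close> is onto.
\<close>

definition embeds :: "(int \<times> int) list \<Rightarrow> bool" where
  "embeds T \<longleftrightarrow> (\<exists>F G. length F = 6 \<and> map (lin F) G = [1, 2, 4, 8, 16, 32] \<and>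
     (\<forall>(a, b)\<in>set T. Q (lin F a) (lin F b)))"

text \<open>
  If both points are outside, their sum is inside, and the sum is what the state records.
\<close>

lemma on_line_sound:
  assumes "sound_incidences S" "on_line L S i j"
  shows "Q i j"
proof -
  consider l where "l \<in> set L" "i \<in> set l" "j \<in> set l" | "i \<in> set (look S j)" | "j \<in> set (look S i)"
    | "i XOR j \<in> set (look S i)"
    using assms(2) by (auto simp: on_line_def list_ex_iff split: if_splits)
  then show ?thesis
  proof cases
    case 4
    then have *: "meets (i XOR j) i"
      using sound_look assms by blast
    then have "Q i (i XOR (i XOR j))"
      using meets_Q [OF *] Q_self [of i] Q_xor [of i i "i XOR j"] by auto
    then show ?thesis by simp
  qed (use line_Q sound_look [OF assms(1)] meets_Q in blast)+
qed

lemma survivors_sound: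
  assumes "sound st" "\<exists>q\<in>set qs. all_meet q"
  shows "\<exists>st'\<in>set (survivors L qs st). sound st'"
  using assms propagate_sound by (fastforce simp: survivors_def List.map_filter_def)

lemma check_all_sound:
  assumes "\<And>c st. c \<in> set cs \<Longrightarrow> check L T c st \<Longrightarrow> sound st \<Longrightarrow> embeds T"
    and "check_all L T cs sts" "\<exists>st\<in>set sts. sound st"
  shows "embeds T"
  using assms
proof (induction cs arbitrary: sts)
  case (Cons c cs)
  then obtain st sts' where sts: "sts = st # sts'" "check L T c st" "check_all L T cs sts'"
    by (auto split: list.splits)
  show ?case
  proof (cases "sound st")
    case True
    then show ?thesis
      using Cons.prems(1) [of c st] sts by simp
  next
    case False
    show ?thesis
    proof (rule Cons.IH)
      show "check_all L T cs sts'" "\<exists>st\<in>set sts'. sound st"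
        using sts False Cons.prems(3) by simp_all
      show "embeds T" if "c' \<in> set cs" "check L T c' st'" "sound st'" for c' st'
        by (rule Cons.prems(1) [OF _ that(2,3)]) (use that(1) in simp)
    qed
  qed
qed simp

lemma check_sound:
  "check L T c st \<Longrightarrow> sound st \<Longrightarrow> embeds T"
proof (induction c arbitrary: st)
  case (Branch n s cs)
  then have "meets n s"
    using sound_look by (auto simp: sound_def)
  then have "\<exists>q\<in>set (map (\<lambda>m. [(m, s), (n XOR m, s)]) (candidates L n)). all_meet q"
    using meets_candidates by (fastforce simp: all_meet_def)
  then have "\<exists>st'\<in>set (survivors L (map (\<lambda>m. [(m, s), (n XOR m, s)]) (candidates L n)) st). sound st'"
    by (rule survivors_sound [OF Branch.prems(2)])
  moreover have "check_all L T cs (survivors L (map (\<lambda>m. [(m, s), (n XOR m, s)]) (candidates L n)) st)"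
    using Branch.prems(1) by simp
  ultimately show ?case
    using check_all_sound Branch.IH by blast
next
  case (Cosets n c)
  then have "\<exists>s\<in>set [32..63]. meets n s"
    using meets_exists by simp
  then have "\<exists>q\<in>set (map (\<lambda>s. [(n, s)]) [32..63]). all_meet q"
    by (auto simp: all_meet_def simp del: set_upto)
  then obtain st' where "st' \<in> set (survivors L (map (\<lambda>s. [(n, s)]) [32..63]) st)" "sound st'"
    using survivors_sound Cosets.prems(2) by blast
  moreover have "list_all (check L T c) (survivors L (map (\<lambda>s. [(n, s)]) [32..63]) st)"
    using Cosets.prems(1) by (simp only: check.simps)
  ultimately have "check L T c st'"
    by (simp only: list_all_iff)
  then show ?case
    using Cosets.IH \<open>sound st'\<close> by blast
next
  case (Leaf F G)
  show ?case
    unfolding embeds_def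
  proof (intro exI conjI)
    show "length F = 6" "map (lin F) G = [1, 2, 4, 8, 16, 32]"
      using Leaf.prems(1) by (simp_all only: check.simps)
    show "\<forall>(a, b)\<in>set T. Q (lin F a) (lin F b)"
      using Leaf.prems on_line_sound by (auto simp: list_all_iff sound_def)
  qed
qed

theorem search_sound:
  assumes "meets n s" "\<forall>st\<in>set (survivors L [[(n, s)]] ([], [])). check L T c st"
  shows "embeds T"
proof -
  have "sound ([], [])" "\<exists>q\<in>set [[(n, s)]]. all_meet q"
    using assms by (simp_all add: sound_def all_meet_def sound_incidences_def)
  then show ?thesis
    using survivors_sound assms(2) check_sound by blast
qed

end

section \<open>Coordinates adapted to a hyperplane\<close>

lemma comb_add_power: "comb bs (2 ^ length bs + j) = comb bs j"
  by (induction bs arbitrary: j) simp_all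

lemma comb_image_Cons:
  "comb (b # bs) ` {0..<2 * m} = comb bs ` {0..<m} \<union> (+) b ` comb bs ` {0..<m}"
proof (intro Set.equalityI subsetI)
  fix v assume "v \<in> comb (b # bs) ` {0..<2 * m}"
  then obtain k where "0 \<le> k" "k < 2 * m" "v = comb (b # bs) k" by auto
  then show "v \<in> comb bs ` {0..<m} \<union> (+) b ` comb bs ` {0..<m}"
    by (cases "even k") (auto intro!: imageI)
next
  fix v assume "v \<in> comb bs ` {0..<m} \<union> (+) b ` comb bs ` {0..<m}"
  then obtain k where k: "0 \<le> k" "k < m" "v = comb (b # bs) (2 * k) \<or> v = comb (b # bs) (2 * k + 1)"
    by auto
  moreover have "2 * k \<in> {0..<2 * m}" "2 * k + 1 \<in> {0..<2 * m}"
    using k by auto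
  ultimately show "v \<in> comb (b # bs) ` {0..<2 * m}"
    by blast
qed

lemma comb_images:
  "comb [] ` {0..<1} = {0}"
  "comb [b0] ` {0..<2} = {0, b0}"
  "comb [b0, b1] ` {0..<4} = {0, b1} \<union> (+) b0 ` {0, b1}"
  "comb [b0, b1, b2] ` {0..<8} = (let S = {0, b2} \<union> (+) b1 ` {0, b2} in S \<union> (+) b0 ` S)"
  "comb [b0, b1, b2, b3] ` {0..<16} =
     (let S = {0, b3} \<union> (+) b2 ` {0, b3}; S' = S \<union> (+) b1 ` S in S' \<union> (+) b0 ` S')"
proof -
  have step: "comb (b # bs) ` {0..<n} = S \<union> (+) b ` S" if "n = 2 * m" "comb bs ` {0..<m} = S" for b bs n m S
    unfolding that(1) comb_image_Cons that(2) ..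
  have "{0..<1 :: int} = {0}" by auto
  then show 0: "comb [] ` {0..<1} = {0}" by simp
  have 1: "comb [b] ` {0..<2} = {0, b}" for b
    using step [OF _ 0, of 2 b] by (simp del: comb.simps add: insert_commute)
  show "comb [b0] ` {0..<2} = {0, b0}" by (rule 1)
  have 2: "comb [b, b'] ` {0..<4} = {0, b'} \<union> (+) b ` {0, b'}" for b b'
    by (rule step [OF _ 1]) simp
  show "comb [b0, b1] ` {0..<4} = {0, b1} \<union> (+) b0 ` {0, b1}" by (rule 2)
  have 3: "comb [b, b', b''] ` {0..<8} = (let S = {0, b''} \<union> (+) b' ` {0, b''} in S \<union> (+) b ` S)"
      for b b' b''
    unfolding Let_def by (rule step [OF _ 2]) simp
  show "comb [b0, b1, b2] ` {0..<8} = (let S = {0, b2} \<union> (+) b1 ` {0, b2} in S \<union> (+) b0 ` S)" by (rule 3)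
  show "comb [b0, b1, b2, b3] ` {0..<16} =
     (let S = {0, b3} \<union> (+) b2 ` {0, b3}; S' = S \<union> (+) b1 ` S in S' \<union> (+) b0 ` S')"
    using step [OF _ 3, of 16 b0 b1 b2 b3] by (simp only: Let_def) simp
qed

text \<open>
  The highest bit decides: a vanishing combination would express a basis vector by the earlier ones.
\<close>

lemma comb_injective:
  assumes "\<And>i. i < length bs \<Longrightarrow> bs ! i \<notin> comb (take i bs) ` {0..<2 ^ i}"
    and "0 \<le> k" "k < 2 ^ length bs" "comb bs k = 0"
  shows "k = 0"
  using assms
proof (induction bs arbitrary: k rule: rev_induct)
  case (snoc b bs)
  let ?n = "length bs"
  have b: "b \<notin> comb bs ` {0..<2 ^ ?n}"
    using snoc.prems(1) [of ?n] by simp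
  have IH: "j = 0" if "0 \<le> j" "j < 2 ^ ?n" "comb bs j = 0" for j
  proof (rule snoc.IH [OF _ that])
    show "bs ! i \<notin> comb (take i bs) ` {0..<2 ^ i}" if "i < ?n" for i
      using snoc.prems(1) [of i] that by (simp add: nth_append)
  qed
  show ?case
  proof (cases "k < 2 ^ ?n")
    case True
    then show ?thesis
      using IH snoc.prems by (simp add: comb_append)
  next
    case False
    define j where "j = k - 2 ^ ?n"
    have j: "0 \<le> j" "j < 2 ^ ?n" "k = 2 ^ ?n + j"
      using False snoc.prems by (simp_all add: j_def)
    have "comb bs k = comb bs j"
      by (simp add: j(3) comb_add_power)
    moreover have "k div 2 ^ ?n = 1"
      using j by (simp add: div_pos_pos_trivial)
    ultimately have "comb bs j + b = 0"
      using snoc.prems(4) by (simp add: comb_append)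
    then have "b = comb bs j"
      by simp
    then show ?thesis
      using b j by auto
  qed
qed simp

lemma (in deza_nbhd) labelled_hyperplaneI:
  assumes H: "hyperplane H" and len: "length bs = 5" and sub: "set bs \<subseteq> H" and t: "t \<notin> H"
    and indep: "\<And>i. i < 5 \<Longrightarrow> bs ! i \<notin> comb (take i bs) ` {0..<2 ^ i}"
  shows "labelled_hyperplane P H (comb (bs @ [t]))"
proof (unfold_locales)
  have in_H: "comb bs k \<in> H" for k
    using sub by (induction bs arbitrary: k) (use H in \<open>simp_all add: hyperplane_add_iff, simp add:
        hyperplane_def\<close>)
  show "hyperplane H" by (rule H)
  show "comb (bs @ [t]) (j XOR k) = comb (bs @ [t]) j + comb (bs @ [t]) k" for j k
    by (rule comb_xor)
  show "comb (bs @ [t]) k \<in> H \<longleftrightarrow> k < 32" if k: "0 \<le> k" "k < 64" for k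
  proof (cases "k < 32")
    case True
    then show ?thesis
      using k in_H by (simp add: comb_append len)
  next
    case False
    then have "k div 32 = 1"
      using k by linarith
    then show ?thesis
      using False in_H t by (simp add: comb_append len hyperplane_add_iff [OF H])
  qed
  show "k = 0" if "0 \<le> k" "k < 64" "comb (bs @ [t]) k = 0" for k
  proof (rule comb_injective [OF _ _ _ that(3)])
    fix i assume "i < length (bs @ [t])"
    then consider "i < 5" | "i = 5"
      using len by fastforce
    then show "(bs @ [t]) ! i \<notin> comb (take i (bs @ [t])) ` {0..<2 ^ i}"
    proof cases
      case 1
      then show ?thesis using indep [of i] len by (simp add: nth_append)
    next
      case 2
      then show ?thesis using len t in_H by (auto simp: nth_append)
    qed
  qed (use that len in simp_all)
qed

lemma (in deza_nbhd) labelled_hyperplane5I: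
  assumes "hyperplane H" "{b0, b1, b2, b3, b4} \<subseteq> H" "t \<notin> H"
    and "b0 \<noteq> 0" "b1 \<notin> {0, b0}" "b2 \<notin> {0, b0, b1, b0 + b1}"
    and "b3 \<notin> (let S = {0, b2} \<union> (+) b1 ` {0, b2} in S \<union> (+) b0 ` S)"
    and "b4 \<notin> (let S = {0, b3} \<union> (+) b2 ` {0, b3}; S' = S \<union> (+) b1 ` S in S' \<union> (+) b0 ` S')"
  shows "labelled_hyperplane P H (comb [b0, b1, b2, b3, b4, t])"
proof -
  have "[b0, b1, b2, b3, b4] ! i \<notin> comb (take i [b0, b1, b2, b3, b4]) ` {0..<2 ^ i}" if "i < 5" for i
  proof -
    consider "i = 0" | "i = 1" | "i = 2" | "i = 3" | "i = 4"
      using \<open>i < 5\<close> by linarith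
    then show ?thesis
    proof cases
      case 1
      then show ?thesis using assms(4) by (simp del: comb.simps add: comb_images(1))
    next
      case 2
      then show ?thesis using assms(5) comb_images(2) [of b0] by (simp del: comb.simps)
    next
      case 3
      then show ?thesis using assms(6) comb_images(3) [of b0 b1] by (simp del: comb.simps)
    next
      case 4
      then show ?thesis using assms(7) comb_images(4) [of b0 b1 b2] by (simp only:) (simp del: comb.simps)
    next
      case 5
      then show ?thesis using assms(8) comb_images(5) [of b0 b1 b2 b3] by (simp only:) (simp del:
          comb.simps)
    qed
  qed
  then show ?thesis
    using labelled_hyperplaneI [of H "[b0, b1, b2, b3, b4]" t] assms(1-3) by simp
qed

section \<open>Hyperplanes with a wheel\<close>

text \<open>
  Basis of the hyperplane: \<open>x, y, a, u, w\<close> are \<open>1, 2, 4, 8, 16\<close>, and \<open>v = a + u + w\<close> is \<open>28\<close>. The thirteen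
  lines pass through a deep point. In the flat variant \<open>v = a + u\<close> is \<open>12\<close>, which will be excluded.
\<close>

definition wheel_points :: "int list" where
  "wheel_points = [1, 2, 3, 4, 8, 28, 16]"

definition wheel_lines :: "int list list" where
  "wheel_lines = [[1, 2, 3], [1, 4, 5], [1, 6, 7], [2, 8, 10], [2, 9, 11], [3, 28, 31], [3, 29, 30],
     [16, 4, 20], [16, 8, 24], [16, 12, 28], [4, 17, 21], [8, 18, 26], [28, 19, 15]]"

definition wheel_hyperplane :: "int list list" where
  "wheel_hyperplane = [[1, 2, 3], [1, 4, 5], [1, 6, 7], [2, 8, 10], [2, 9, 11], [3, 28, 31], [3, 29, 30],
     [16, 4, 20], [16, 8, 24], [16, 12, 28], [4, 17, 21], [8, 18, 26], [28, 19, 15],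
     [13, 22, 27], [14, 23, 25]]"

lemma wheel_hyperplane_eq: "wheel_hyperplane = wheel_lines @ [[13, 22, 27], [14, 23, 25]]"
  by (simp only: wheel_hyperplane_def wheel_lines_def append.simps)

definition flat_wheel_points :: "int list" where
  "flat_wheel_points = [1, 2, 3, 4, 8, 12, 16]"

definition flat_wheel_lines :: "int list list" where
  "flat_wheel_lines = [[1, 2, 3], [1, 4, 5], [1, 6, 7], [2, 8, 10], [2, 9, 11], [3, 12, 15], [3, 13, 14],
     [16, 4, 20], [16, 8, 24], [16, 12, 28], [4, 17, 21], [8, 18, 26], [12, 19, 31]]"

lemma flat_wheel_check:
  "well_formed flat_wheel_points flat_wheel_lines"
  "\<not> covered flat_wheel_lines 22"
  "list_all (\<lambda>k. k = 22 \<or> covered flat_wheel_lines k \<or> covered flat_wheel_lines (22 XOR k)) [1..31]"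
  by code_simp+

lemma wheel_check:
  "well_formed wheel_points wheel_lines"
  "well_formed wheel_points wheel_hyperplane"
  "complete wheel_points wheel_hyperplane"
  "\<not> covered wheel_lines 13" "\<not> covered wheel_lines 14"
  "list_all (\<lambda>k. k = 13 \<or> covered wheel_lines k \<or> covered wheel_lines (13 XOR k) \<or> k = 22 \<or> k = 27) [1..31]"
  "list_all (\<lambda>k. k = 14 \<or> covered wheel_lines k \<or> covered wheel_lines (14 XOR k) \<or> k = 23 \<or> k = 25) [1..31]"
  by code_simp+

text \<open>
  The hub \<open>w\<close> is joined by \<open>a\<close>, \<open>u\<close>, \<open>v\<close> to the three points of the line \<open>{x, y, x + y}\<close>, the rim.
\<close>

locale wheel = deza_nbhd +
  fixes H x y a u v w
  assumes H: "hyperplane H" and D: "{x, y, x + y, a, u, v, w} \<subseteq> deep H"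
    and adjs: "adj x y" "adj x a" "adj y u" "adj (x + y) v" "adj w a" "adj w u" "adj w v"
    and far: "w \<notin> {x, y, x + y}" "\<not> adj w x" "\<not> adj w y" "\<not> adj w (x + y)"
begin

lemma rim: "adj x (x + y)" "adj y (x + y)"
  using adj_third [of x y] adj_third [of y x] adjs(1) adj_sym by (auto simp: add.commute)

lemma spokes_apart:
  assumes "adj r s" "adj r r'" "adj s s'" "adj w r'" "adj w s'"
    "\<not> adj w r" "\<not> adj w s" "\<not> adj w (r + s)"
  shows "\<not> adj r' s'" "r' \<noteq> s'"
proof -
  show "\<not> adj r' s'"
    using adj_quadrangle [of r' s' s r] assms adj_sym by blast
  show "r' \<noteq> s'"
    using adj_triangle [of r s r'] assms by auto
qed

lemma third: "x + (x + y) = y" "y + (x + y) = x"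
  by (simp, metis add.commute bit_vec_add_self_right)

lemma apart: "\<not> adj a u" "a \<noteq> u" "\<not> adj a v" "a \<noteq> v" "\<not> adj u v" "u \<noteq> v"
proof -
  show "\<not> adj a u" "a \<noteq> u"
    using spokes_apart [of x y a u] adjs far by auto
  show "\<not> adj a v" "a \<noteq> v"
    using spokes_apart [of x "x + y" a v] adjs far rim unfolding third by auto
  show "\<not> adj u v" "u \<noteq> v"
    using spokes_apart [of y "x + y" u v] adjs far rim unfolding third by auto
qed

lemma nonzero: "x \<noteq> 0" "y \<noteq> 0" "x + y \<noteq> 0" "a \<noteq> 0" "u \<noteq> 0" "v \<noteq> 0" "w \<noteq> 0"
  using adjs by (auto simp: adj_def)

lemma distinct: "a \<notin> {0, x, y, x + y}" "u \<notin> {0, x, y, x + y}" "v \<notin> {0, x, y, x + y}"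
  using adjs far nonzero by (metis insertE singletonD)+

lemma hub_plane: "P w = {0, w, a, w + a, u, u + w, u + a, u + (w + a)}"
proof (rule nbhd_plane)
  show "adj w a" by (rule adjs)
  show "u \<in> P w" using adjs by (simp add: adj_def)
  have "adj a (w + a)"
    using adj_third [OF adj_sym [OF adjs(5)]] by (simp add: add.commute)
  then show "u \<notin> {0, w, a, w + a}"
    using apart adjs nonzero by (auto simp: adj_def)
qed

text \<open>
  The three neighbours of the hub are on different lines through it but in one plane.
\<close>

lemma hub_cases: "v = a + u \<or> v = a + (u + w)"
proof -
  have "v \<in> P w" using adjs by (simp add: adj_def)
  moreover have "adj a (w + a)" "adj u (u + w)"
    using adj_third [OF adj_sym [OF adjs(5)]] adj_third [OF adj_sym [OF adjs(6)]]
    by (simp_all add: add.commute)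
  ultimately show ?thesis
    unfolding hub_plane using apart adjs nonzero
    by (elim insertE emptyE) (auto simp: adj_def add.commute add.left_commute)
qed

lemma rim_planes:
  "P x = {0, x, y, x + y, a, a + x, a + y, a + (x + y)}"
  "P y = {0, y, x, x + y, u, u + y, u + x, u + (x + y)}"
  "P (x + y) = {0, x + y, x, y, v, v + (x + y), v + x, v + y}"
proof -
  have "adj y x" "adj (x + y) x" "x + y + x = y"
    using adjs rim adj_sym third by (auto simp: add.commute)
  then show "P x = {0, x, y, x + y, a, a + x, a + y, a + (x + y)}"
      "P y = {0, y, x, x + y, u, u + y, u + x, u + (x + y)}"
      "P (x + y) = {0, x + y, x, y, v, v + (x + y), v + x, v + y}"
    using nbhd_plane [of x y a] nbhd_plane [of y x u] nbhd_plane [of "x + y" x v] adjs distinct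
    by (auto simp only: adj_def add.commute [of y x] insert_iff)
qed

lemma labelled:
  assumes "t \<notin> H"
  shows "labelled_hyperplane P H (comb [x, y, a, u, w, t])"
proof (rule labelled_hyperplane5I [OF H _ assms])
  show "{x, y, a, u, w} \<subseteq> H"
    using D self_mem by (auto simp: deep_def)
  show "x \<noteq> 0" by (rule nonzero)
  show "y \<notin> {0, x}"
    using adjs(1) by (auto simp: adj_def)
  show "a \<notin> {0, x, y, x + y}" by (rule distinct)
  have "u \<notin> P x"
    using adj_triangle [of x y u] adjs distinct nonzero by (auto simp: adj_def)
  then show "u \<notin> (let S = {0, a} \<union> (+) y ` {0, a} in S \<union> (+) x ` S)"
    unfolding rim_planes by (simp add: add_ac)
  have w: "w \<notin> P x" "w \<notin> P y" "w \<notin> P (x + y)"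
    using far nonzero adj_sym [of x w] adj_sym [of y w] adj_sym [of "x + y" w] unfolding adj_def by blast+
  have "w \<notin> {a + u, a + u + x, a + u + y, a + u + (x + y)}"
    using hub_cases
  proof
    assume "v = a + u"
    then show ?thesis
      using w(3) unfolding rim_planes by (simp add: add_ac)
  next
    assume v: "v = a + (u + w)"
    show ?thesis
    proof
      assume "w \<in> {a + u, a + u + x, a + u + y, a + u + (x + y)}"
      then have "a + u + w \<in> {0, x, y, x + y}"
        by (elim insertE emptyE) (simp_all only: bit_vec_add_self bit_vec_add_self_left insert_iff
            simp_thms)
      then show False
        using distinct(3) unfolding v by (simp add: add.assoc)
    qed
  qed
  then show "w \<notin> (let S = {0, u} \<union> (+) a ` {0, u}; S' = S \<union> (+) y ` S in S' \<union> (+) x ` S')"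
    using w(1,2) unfolding rim_planes by (simp add: add_ac)
qed

lemma wheel_joins: "y \<in> P x" "a \<in> P x" "x \<in> P y" "u \<in> P y" "v \<in> P (x + y)" "a \<in> P w" "u \<in> P w" "v \<in> P w"
    "w \<in> P a" "w \<in> P u" "w \<in> P v" "x \<in> P a" "y \<in> P u" "x + y \<in> P v"
  using adjs adjs [THEN adj_sym] unfolding adj_def by blast+

lemma wheel_joins_sums: "y + a \<in> P x" "x + u \<in> P y" "x + v \<in> P (x + y)" "x + w \<in> P a" "y + w \<in> P u"
    "a + u \<in> P w" "x + (y + w) \<in> P v"
proof -
  have "x \<in> P (x + y)"
    using rim(1) [THEN adj_sym] by (simp add: adj_def)
  then show "y + a \<in> P x" "x + u \<in> P y" "x + v \<in> P (x + y)" "x + w \<in> P a" "y + w \<in> P u"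
    "a + u \<in> P w" "x + (y + w) \<in> P v"
    using wheel_joins nonzero by (simp_all add: add_mem flip: add.assoc)
qed

lemma outside: obtains t where "t \<notin> H"
proof -
  have "card H < card (UNIV :: (bit ^ 6) set)"
    using H by (simp add: hyperplane_def CARD_vec card_bit)
  then have "H \<noteq> UNIV" by auto
  then show thesis
    using that by blast
qed

lemma labels:
  fixes t :: "bit ^ 6"
  defines "g \<equiv> comb [x, y, a, u, w, t]"
  shows "g 1 = x" "g 2 = y" "g 3 = x + y" "g 4 = a" "g 8 = u" "g 16 = w" "g 6 = y + a" "g 9 = x + u"
    "g 17 = x + w" "g 18 = y + w" "g 12 = a + u" "g 19 = x + (y + w)" "g 13 = x + (a + u)"
    "g 28 = a + (u + w)" "g 29 = x + (a + (u + w))"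
  by (simp_all add: g_def)

lemma planes_in_H: "P x \<subseteq> H" "P y \<subseteq> H" "P (x + y) \<subseteq> H" "P a \<subseteq> H" "P u \<subseteq> H" "P v \<subseteq> H" "P w \<subseteq> H"
  using D unfolding deep_def by blast+

text \<open>
  If \<open>v = a + u\<close>, the thirteen known lines leave six points of the hyperplane uncovered, and these are in
  one coset of the space spanned by \<open>x, y, a, u\<close>. Each of them needs a line consisting of uncovered
  points, but the sum of two of them is covered. The contradiction is derived at the point \<open>22\<close>.
\<close>

lemma not_flat: "v = a + (u + w)"
proof (rule ccontr)
  assume "v \<noteq> a + (u + w)"
  then have v: "a + u = v"
    using hub_cases by blast
  obtain t where t: "t \<notin> H"
    using outside .
  interpret labelled_hyperplane P H "comb [x, y, a, u, w, t]"
    by (rule labelled [OF t])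
  interpret hyperplane_frame P H "comb [x, y, a, u, w, t]" flat_wheel_points flat_wheel_lines
  proof
    show "well_formed flat_wheel_points flat_wheel_lines"
      by (rule flat_wheel_check)
    show "P (comb [x, y, a, u, w, t] n) \<subseteq> H" if "n \<in> set flat_wheel_points" for n
      using that unfolding flat_wheel_points_def set_simps
      by (elim insertE emptyE) (simp_all only: labels v planes_in_H)
    show "comb [x, y, a, u, w, t] j \<in> P (comb [x, y, a, u, w, t] i)"
      if "[i, j, k] \<in> set flat_wheel_lines" for i j k
      using that unfolding flat_wheel_lines_def set_simps
      by (elim insertE emptyE; simp only: list.inject; elim conjE; simp only: labels v wheel_joins
          wheel_joins_sums)
  qed
  obtain k where k: "0 < k" "k < 32" "k \<noteq> 22" "\<not> covered flat_wheel_lines k" "\<not> covered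
      flat_wheel_lines (22 XOR k)"
    using uncovered_nbhd [of 22] flat_wheel_check(2) by auto
  then have "k \<in> {1..31}" by simp
  then show False
    using k flat_wheel_check(3) unfolding list_all_iff set_upto by blast
qed

lemma wheel_frame:
  assumes t: "t \<notin> H"
  shows "hyperplane_frame P H (comb [x, y, a, u, w, t]) wheel_points wheel_lines"
proof -
  interpret labelled_hyperplane P H "comb [x, y, a, u, w, t]"
    by (rule labelled [OF t])
  note v = not_flat [symmetric]
  show ?thesis
  proof
    show "well_formed wheel_points wheel_lines"
      by (rule wheel_check)
    show "P (comb [x, y, a, u, w, t] n) \<subseteq> H" if "n \<in> set wheel_points" for n
      using that unfolding wheel_points_def set_simps
      by (elim insertE emptyE) (simp_all only: labels v planes_in_H)
    show "comb [x, y, a, u, w, t] j \<in> P (comb [x, y, a, u, w, t] i)"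
      if "[i, j, k] \<in> set wheel_lines" for i j k
      using that unfolding wheel_lines_def set_simps
      by (elim insertE emptyE; simp only: list.inject; elim conjE; simp only: labels v wheel_joins
          wheel_joins_sums)
  qed
qed

text \<open>
  The six points that the thirteen lines leave uncovered contain only two lines of the projective space, so
  both of them are edges.
\<close>

lemma wheel_complete_frame:
  assumes t: "t \<notin> H"
  shows "complete_frame P H (comb [x, y, a, u, w, t]) wheel_points wheel_hyperplane"
proof -
  interpret hyperplane_frame P H "comb [x, y, a, u, w, t]" wheel_points wheel_lines
    by (rule wheel_frame [OF t])
  \<comment> \<open>the uncovered points are 13, 22, 27 and 14, 23, 25\<close>
  have "Q 13 22"
  proof -
    obtain k where k: "0 < k" "k < 32" "k \<noteq> 13" "Q 13 k" "\<not> covered wheel_lines k" "\<not> covered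
        wheel_lines (13 XOR k)"
      using uncovered_nbhd [of 13] wheel_check(4) by auto
    then have "k = 22 \<or> k = 27"
      using bspec [OF wheel_check(6) [unfolded list_all_iff set_upto], of k] by simp
    moreover have "Q 13 (13 XOR k)"
      by (rule Q_xor [OF _ _ Q_self k(4)]) simp_all
    ultimately show ?thesis
      using k(4) by (auto simp del: comb.simps)
  qed
  moreover have "Q 14 23"
  proof -
    obtain k where k: "0 < k" "k < 32" "k \<noteq> 14" "Q 14 k" "\<not> covered wheel_lines k" "\<not> covered
        wheel_lines (14 XOR k)"
      using uncovered_nbhd [of 14] wheel_check(5) by auto
    then have "k = 23 \<or> k = 25"
      using bspec [OF wheel_check(7) [unfolded list_all_iff set_upto], of k] by simp
    moreover have "Q 14 (14 XOR k)"
      by (rule Q_xor [OF _ _ Q_self k(4)]) simp_all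
    ultimately show ?thesis
      using k(4) by (auto simp del: comb.simps)
  qed
  ultimately show ?thesis
    using wheel_check(2,3) deep_points lines
    by unfold_locales (auto simp: wheel_hyperplane_eq simp del: comb.simps)
qed

end

section \<open>Copies of a given geometry\<close>

text \<open>
  A list of pairs of integers stands for the lines joining the two points of each pair in coordinates. A
  copy is an image of all these lines under a surjective linear map.
\<close>

context deza_nbhd begin

definition has_copy :: "(int \<times> int) list \<Rightarrow> bool" where
  "has_copy T \<longleftrightarrow> (\<exists>fs. length fs = 6 \<and> (\<forall>v. \<exists>k. comb fs k = v) \<and>
     (\<forall>(i, j)\<in>set T. comb fs j \<in> P (comb fs i)))"

end

lemma lin_lin: "lin fs (lin gs k) = lin (map (lin fs) gs) k"
proof (induction gs arbitrary: k)
  case Nil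
  show ?case by (induction fs) simp_all
next
  case (Cons a gs)
  have "lin fs (i XOR j) = lin fs i XOR lin fs j" for i j
    by (induction fs arbitrary: i j) (simp_all add: xor_div_2 even_xor_iff xor.assoc xor.left_commute)
  then show ?case using Cons by simp
qed

lemma lin_powers: "0 \<le> k \<Longrightarrow> k < 64 \<Longrightarrow> lin [1, 2, 4, 8, 16, 32] k = k"
proof -
  assume "0 \<le> k" "k < 64"
  then have "k \<in> set [0..63]"
    unfolding set_upto by simp
  moreover have "list_all (\<lambda>k. lin [1, 2, 4, 8, 16, 32] k = k) [0..63]"
    by code_simp
  ultimately show ?thesis
    unfolding list_all_iff by blast
qed

lemma (in complete_frame) embeds_has_copy:
  assumes "embeds T"
  shows "has_copy T"
proof -
  obtain F G where F: "length F = 6" "map (lin F) G = [1, 2, 4, 8, 16, 32]"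
      "\<forall>(i, j)\<in>set T. Q (lin F i) (lin F j)"
    using assms unfolding embeds_def by (elim exE conjE)
  have comb: "comb (map g fs) k = g (lin fs k)" for fs k
    by (induction fs arbitrary: k) (simp_all add: g_xor g_0)
  show ?thesis
    unfolding has_copy_def
  proof (intro exI [of _ "map g F"] conjI allI)
    show "length (map g F) = 6"
      using F by simp
    fix v
    obtain k where k: "0 \<le> k" "k < 64" "g k = v"
      using g_surj .
    have "comb (map g F) (lin G k) = v"
      unfolding comb lin_lin F(2) lin_powers [OF k(1,2)] by (rule k(3))
    then show "\<exists>k. comb (map g F) k = v" ..
  next
    show "\<forall>(i, j)\<in>set T. comb (map g F) j \<in> P (comb (map g F) i)"
      using F(3) by (simp only: comb)
  qed
qed

definition search_succeeds :: "int list list \<Rightarrow> (int \<times> int) list \<Rightarrow> int \<Rightarrow> cert \<Rightarrow> bool" where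
  "search_succeeds L T n c \<longleftrightarrow> own_line L n \<noteq> [] \<and>
     list_all (check L T c) (survivors L [[(n, 32)]] ([], []))"

text \<open>
  The last basis vector is arbitrary outside the hyperplane, so it may be taken adjacent to \<open>n\<close>. This gives
  the search its first adjacency, between \<open>n\<close> and \<open>32\<close>.
\<close>

lemma (in deza_nbhd) has_copy_by_search:
  assumes frames: "\<And>t. t \<notin> H \<Longrightarrow> complete_frame P H (comb [b0, b1, b2, b3, b4, t]) D L"
    and H: "hyperplane H" and search: "search_succeeds L T n c"
  shows "has_copy T"
proof -
  let ?g = "\<lambda>t. comb [b0, b1, b2, b3, b4, t]"
  have "card H < card (UNIV :: (bit ^ 6) set)"
    using H by (simp add: hyperplane_def CARD_vec card_bit)
  then have "H \<noteq> UNIV" by auto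
  then obtain t where t: "t \<notin> H" by blast
  interpret F1: complete_frame P H "?g t" D L
    by (rule frames [OF t])
  have own: "own_line L n \<noteq> []"
    using search unfolding search_succeeds_def by blast
  obtain s where s: "F1.meets n s"
    using F1.meets_exists [OF own] by blast
  note n = F1.meets_Q [OF s]
  have t': "?g t s \<notin> H"
    using F1.g_in_H [of s] n by simp
  interpret F2: complete_frame P H "?g (?g t s)" D L
    by (rule frames [OF t'])
  have eq: "?g r n = comb [b0, b1, b2, b3, b4] n" for r
    using comb_append [of "[b0, b1, b2, b3, b4]" r n] n(3,4) by (simp del: comb.simps)
  have 32: "?g r 32 = r" for r
    by simp
  have "?g (?g t s) 32 \<in> P (?g (?g t s) n)"
    unfolding 32 eq [of "?g t s"] using n(1) unfolding eq [of t] .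
  then have "F2.meets n 32"
    using own by (simp only: F2.meets_def) simp
  then show ?thesis
    using F2.search_sound [of n 32 T c] F2.embeds_has_copy search
    unfolding search_succeeds_def list_all_iff by blast
qed

section \<open>Hyperplanes with a centre\<close>

context labelled_hyperplane begin

lemma Q_triangle:
  assumes "0 < i" "i < 64" "0 < j" "j < 64" "0 < k" "k < 64" "i \<noteq> j" "k \<noteq> i" "k \<noteq> j"
    and "Q i j" "Q i k" "Q j k"
  shows "k = i XOR j"
proof -
  have "adj (g i) (g j)" "adj (g i) (g k)" "adj (g j) (g k)"
    using assms g_nonzero g_inj by (auto simp: adj_def)
  then have "g k = g (i XOR j)"
    using adj_triangle by (simp add: g_xor)
  then show ?thesis
    using g_inj [of k "i XOR j"] xor_range [of i 6 j] assms by simp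
qed

lemma Q_common:
  assumes "0 < i" "i < 64" "0 < j" "j < 64" "i \<noteq> j" "0 < k" "k < 64" "0 < m" "m < 64"
    and "k \<noteq> i" "k \<noteq> j" "m \<noteq> i" "m \<noteq> j"
    and "Q i k" "Q j k" "Q i m" "Q j m"
  shows "k = m"
  using common_unique [of "g i" "g j" "g k" "g m"] assms g_nonzero g_inj by auto

lemma Q_0: "0 < i \<Longrightarrow> i < 64 \<Longrightarrow> Q i 0"
  using zero_mem g_nonzero g_0 by simp

end

definition centre_points :: "int list" where
  "centre_points = [1, 2, 3, 4, 5, 6, 7]"

text \<open>
  Basis of the hyperplane: \<open>p, a, b, c, d\<close> are \<open>1, 2, 4, 8, 16\<close>, where \<open>c\<close> and \<open>d\<close> are adjacent to
      \<open>a\<close> and \<open>b\<close>.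
  The plane of the centre is \<open>{0..7}\<close>. The parameter is \<open>0\<close> or \<open>2\<close> and tells which of \<open>6\<close> and \<open>7\<close> is
  adjacent to \<open>24\<close>.
\<close>

definition centre_lines :: "int \<Rightarrow> int list list" where
  "centre_lines e = [[1, 2, 3], [1, 4, 5], [1, 6, 7], [2, 8, 10], [2, 9, 11], [3, 12, 15], [3, 13, 14],
     [4, 16, 20], [4, 17, 21], [5, 18, 23], [5, 19, 22], [6, 24 XOR e, 30 XOR e],
     [6, 25 XOR e, 31 XOR e], [7, 26 XOR e, 29 XOR e], [7, 27 XOR e, 28 XOR e]]"

lemma centre_check:
  "well_formed centre_points (centre_lines 0)" "complete centre_points (centre_lines 0)"
  "well_formed centre_points (centre_lines 2)" "complete centre_points (centre_lines 2)"
  by code_simp+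

text \<open>
  Two planes spanned by \<open>1\<close> with points on different lines through \<open>1\<close> add up to the plane of the centre.
\<close>

lemma coset_check:
  "list_all (\<lambda>n. list_all (\<lambda>m. list_all (\<lambda>r. n = m \<or> n XOR m = 1 \<or>
     list_ex (\<lambda>e. list_ex (\<lambda>f. e XOR f = r) [0, 1, m, m XOR 1]) [0, 1, n, n XOR 1]) [0..7]) [2..7]) [2..7]"
  by code_simp

lemma xor_div_8: "(j XOR k) div 8 = (j div 8) XOR (k div 8 :: int)"
  using drop_bit_xor [of 3 j k] by (simp add: drop_bit_eq_div)

locale centred_hyperplane = labelled_hyperplane +
  assumes centre: "0 < n \<Longrightarrow> n < 8 \<Longrightarrow> P (g n) \<subseteq> H"
    and Q_basis: "Q 1 2" "Q 1 4" "Q 2 8" "Q 4 16"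
begin

lemma Q_centre: "0 \<le> n \<Longrightarrow> n < 8 \<Longrightarrow> Q 1 n"
proof -
  assume "0 \<le> n" "n < 8"
  then consider "n = 0" | "n = 1" | "n = 2" | "n = 3" | "n = 4" | "n = 5" | "n = 6" | "n = 7"
    by linarith
  moreover have "Q 1 0" "Q 1 1"
    using Q_0 Q_self by auto
  moreover have "Q 1 3" "Q 1 5" "Q 1 6"
    using Q_xor [of 1 1 2] Q_xor [of 1 1 4] Q_xor [of 1 2 4] \<open>Q 1 1\<close> Q_basis by simp_all
  moreover have "Q 1 7"
    using Q_xor [of 1 1 6] \<open>Q 1 1\<close> \<open>Q 1 6\<close> by simp
  ultimately show ?thesis
    using Q_basis by cases simp_all
qed

lemma Q_spoke:
  assumes "2 \<le> n" "n < 8" "e \<in> {0, 1, n, n XOR 1}"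
  shows "Q n e"
proof -
  have "Q n 0" "Q n n" using Q_0 Q_self assms by auto
  moreover have "Q n 1" using Q_centre [of n] Q_sym [of 1 n] assms by simp
  ultimately show ?thesis
    using assms(3) Q_xor [of n n 1] assms(1,2) by auto
qed

text \<open>
  Modulo the plane of the centre, points \<open>n\<close> and \<open>m\<close> on different lines through the centre have different
  neighbours: inside one coset the two affine lines of their neighbours would intersect, and the
  intersection would close a quadrangle with the centre.
\<close>

lemma coset_conflict:
  assumes nm: "2 \<le> n" "n < 8" "2 \<le> m" "m < 8" "n \<noteq> m" "n XOR m \<noteq> 1"
    and j: "8 \<le> j" "j < 32" "Q n j" and k: "8 \<le> k" "k < 32" "Q m k" and div: "j div 8 = k div 8"
  shows False
proof -
  have "(j XOR k) div 8 = 0"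
    using div by (simp add: xor_div_8)
  moreover have "0 \<le> j XOR k"
    using j k by simp
  ultimately have "j XOR k \<in> set [0..7]"
    unfolding set_upto by simp
  moreover have "n \<in> set [2..7]" "m \<in> set [2..7]"
    unfolding set_upto using nm by simp_all
  ultimately have "list_ex (\<lambda>e. list_ex (\<lambda>f. e XOR f = j XOR k) [0, 1, m, m XOR 1]) [0, 1, n, n XOR 1]"
    using coset_check nm(5,6) unfolding list_all_iff by blast
  then obtain e f where ef: "e \<in> {0, 1, n, n XOR 1}" "f \<in> {0, 1, m, m XOR 1}" "e XOR f = j XOR k"
    unfolding list_ex_iff set_simps by blast
  define q where "q = j XOR e"
  have "q = k XOR f"
    using ef(3) unfolding q_def by (metis xor.assoc xor.commute xor_cancel(1))
  then have Qq: "Q n q" "Q m q"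
    using Q_xor [of n j e] Q_xor [of m k f] Q_spoke ef j k nm by (simp_all add: q_def)
  have "0 \<le> e" "e < 8"
    using ef(1) nm xor_range [of n 3 1] by auto
  then have q: "q div 8 = j div 8" "0 \<le> q" "q < 32"
    using xor_range [of j 5 e] j by (simp_all add: q_def xor_div_8)
  then have "8 \<le> q"
    using j(1) by presburger
  then have "1 = q"
    using Q_common [of n m 1 q] nm q Qq Q_spoke by simp
  then show False
    using \<open>8 \<le> q\<close> by simp
qed

lemma escape:
  assumes n: "2 \<le> n" "n < 8"
  obtains j where "8 \<le> j" "j < 32" "Q n j"
proof -
  have "adj (g n) (g 1)"
    using n g_nonzero g_inj Q_spoke [of n 1] by (simp add: adj_def)
  then obtain v where v: "v \<in> P (g n)" "v \<notin> {0, g n, g 1, g n + g 1}"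
    by (rule outside_line)
  then have "v \<in> H"
    using centre [of n] n by auto
  then obtain j where j: "0 \<le> j" "j < 32" "g j = v"
    by (rule g_surj_H)
  then have j': "Q n j" "j \<noteq> 0" "j \<noteq> n" "j \<noteq> 1" "j \<noteq> n XOR 1"
    using v g_0 by (auto simp: g_xor)
  have "8 \<le> j"
  proof (rule ccontr)
    assume "\<not> 8 \<le> j"
    then have "j = n XOR 1"
      using Q_triangle [of n 1 j] Q_centre [of j] Q_spoke [of n 1] n j j' by simp
    then show False using j' by simp
  qed
  then show thesis
    using that j j' by blast
qed

text \<open>
  The cosets of \<open>8\<close> and \<open>16\<close> belong to the lines of \<open>2\<close> and \<open>4\<close>, which leaves one coset for the third line
  through the centre.
\<close>

lemma third_coset:
  assumes "n = 6 \<or> n = 7"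
  obtains j where "24 \<le> j" "j < 32" "Q n j"
proof -
  have "2 \<le> n" "n < 8"
    using assms by auto
  then obtain j where j: "8 \<le> j" "j < 32" "Q n j"
    by (rule escape)
  have "j div 8 \<noteq> 1" "j div 8 \<noteq> 2"
    using coset_conflict [of n 2 j 8] coset_conflict [of n 4 j 16] assms j Q_basis by auto
  then have "24 \<le> j"
    using j(1,2) by presburger
  with that j show thesis by blast
qed

lemma Q_3: "Q 3 12"
proof -
  obtain j where j: "8 \<le> j" "j < 32" "Q 3 j"
    using escape [of 3] by auto
  obtain i where i: "24 \<le> i" "i < 32" "Q 6 i"
    using third_coset [of 6] by auto
  have "i div 8 = 3"
    using i(1,2) by presburger
  have "j div 8 \<noteq> 2" "j div 8 \<noteq> 3"
    using coset_conflict [of 3 4 j 16] coset_conflict [of 3 6 j i] j i Q_basis \<open>i div 8 = 3\<close> by auto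
  then have "j < 16" using j(1,2) by presburger
  with j consider "j = 8" | "j = 9" | "j = 10" | "j = 11" | "j = 12" | "j = 13" | "j = 14" | "j = 15"
    by linarith
  moreover have "Q 3 1" "Q 3 2" "Q 3 3"
    using Q_spoke [of 3] by simp_all
  ultimately have "Q 3 8 \<or> Q 3 12"
    using j(3) Q_xor [of 3 j 1] Q_xor [of 3 j 2] Q_xor [of 3 j 3] by cases simp_all
  moreover have "\<not> Q 3 8"
    using Q_triangle [of 2 3 8] Q_basis Q_spoke [of 2 3] by auto
  ultimately show ?thesis by blast
qed

lemma Q_5: "Q 5 18"
proof -
  obtain j where j: "8 \<le> j" "j < 32" "Q 5 j"
    using escape [of 5] by auto
  obtain i where i: "24 \<le> i" "i < 32" "Q 6 i"
    using third_coset [of 6] by auto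
  have "i div 8 = 3"
    using i(1,2) by presburger
  have "j div 8 \<noteq> 1" "j div 8 \<noteq> 3"
    using coset_conflict [of 5 2 j 8] coset_conflict [of 5 6 j i] j i Q_basis \<open>i div 8 = 3\<close> by auto
  then have "16 \<le> j" "j < 24" using j(1,2) by presburger+
  then consider "j = 16" | "j = 17" | "j = 18" | "j = 19" | "j = 20" | "j = 21" | "j = 22" | "j = 23"
    by linarith
  moreover have "Q 5 1" "Q 5 4" "Q 5 5"
    using Q_spoke [of 5] by simp_all
  ultimately have "Q 5 16 \<or> Q 5 18"
    using j(3) Q_xor [of 5 j 1] Q_xor [of 5 j 4] Q_xor [of 5 j 5] by cases simp_all
  moreover have "\<not> Q 5 16"
    using Q_triangle [of 4 5 16] Q_basis Q_spoke [of 4 5] by auto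
  ultimately show ?thesis by blast
qed

text \<open>
  Within the last coset each of \<open>6\<close> and \<open>7\<close> has four of the eight points as neighbours, and they
      cannot share
  any.
\<close>

lemma Q_67: "Q 6 24 \<and> Q 7 26 \<or> Q 6 26 \<and> Q 7 24"
proof -
  have Q: "Q n 24 \<or> Q n 26" if n: "n = 6 \<or> n = 7" for n
  proof -
    obtain j where j: "24 \<le> j" "j < 32" "Q n j"
      using third_coset [OF n] .
    then consider "j = 24" | "j = 25" | "j = 26" | "j = 27" | "j = 28" | "j = 29" | "j = 30" | "j = 31"
      by linarith
    moreover have "Q n 1" "Q n 6" "Q n 7"
      using Q_spoke [of n] n by auto
    ultimately show ?thesis
      using j(3) n Q_xor [of n j 1] Q_xor [of n j 6] Q_xor [of n j 7] by cases auto
  qed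
  moreover have "\<not> (Q 6 k \<and> Q 7 k)" if "k = 24 \<or> k = 26" for k
    using Q_triangle [of 6 7 k] Q_spoke [of 6 7] that by auto
  ultimately show ?thesis
    by blast
qed

lemma complete_centre:
  "complete_frame P H g centre_points (centre_lines (if Q 6 24 then 0 else 2))"
proof -
  define e :: int where "e = (if Q 6 24 then 0 else 2)"
  have e: "Q 6 (24 XOR e)" "Q 7 (26 XOR e)" "e = 0 \<or> e = 2"
    using Q_67 Q_triangle [of 6 7 24] Q_spoke [of 6 7] by (auto simp: e_def)
  have basic: "Q 1 2" "Q 1 4" "Q 1 6" "Q 2 8" "Q 2 9" "Q 3 12" "Q 3 13" "Q 4 16" "Q 4 17" "Q 5 18" "Q 5 19"
    using Q_basis Q_centre [of 6] Q_3 Q_5 Q_xor [of 2 8 1] Q_xor [of 3 12 1] Q_xor [of 4 16 1] Q_xor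
        [of 5 18 1]
      Q_spoke [of 2 1] Q_spoke [of 3 1] Q_spoke [of 4 1] Q_spoke [of 5 1] by simp_all
  have "Q 6 (25 XOR e)" "Q 7 (27 XOR e)"
    using e Q_xor [of 6 "24 XOR e" 1] Q_xor [of 7 "26 XOR e" 1] Q_spoke [of 6 1] Q_spoke [of 7 1]
    by (auto simp only:) simp_all
  then have "complete_frame P H g centre_points (centre_lines e)"
  proof (unfold_locales, goal_cases)
    case 1
    then show ?case using e(3) centre_check by auto
  next
    case (2 n)
    then show ?case using centre [of n] by (auto simp: centre_points_def)
  next
    case (3 i j k)
    show ?case
      using 3(3) 3(1,2) basic e(1,2) unfolding centre_lines_def set_simps
      by (elim insertE emptyE; simp only: list.inject; elim conjE; simp only:)
  next
    case 4
    then show ?case using e(3) centre_check by auto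
  qed
  then show ?thesis
    by (simp only: e_def)
qed

end

context deza_nbhd begin

text \<open>
  A linear dependence of \<open>d\<close> on \<open>p, a, b, c\<close> would yield a common neighbour of \<open>a\<close> and \<open>b\<close> other than \<open>p\<close>.
\<close>

lemma centre_complete:
  assumes H: "hyperplane H" and p: "p \<noteq> 0" and centre: "\<And>n. n \<in> P p \<Longrightarrow> n \<noteq> 0 \<Longrightarrow> P n \<subseteq> H"
  obtains a b c d e where "e = 0 \<or> e = 2"
    "\<And>t. t \<notin> H \<Longrightarrow> complete_frame P H (comb [p, a, b, c, d, t]) centre_points (centre_lines e)"
proof -
  have "\<not> P p \<subseteq> {0, p}"
    using card_mono [of "{0, p}" "P p"] card_nbhd [OF p] by (auto simp: card_insert_if split: if_splits)
  then obtain a where "a \<in> P p" "a \<notin> {0, p}" by blast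
  then have pa: "adj p a"
    using p by (auto simp: adj_def)
  obtain b where b: "b \<in> P p" "b \<notin> {0, p, a, p + a}"
    using outside_line [OF pa] .
  then have pb: "adj p b"
    using p by (auto simp: adj_def)
  have ap: "adj a p" and bp: "adj b p"
    using pa pb adj_sym by blast+
  obtain c where c: "c \<in> P a" "c \<notin> {0, a, p, a + p}"
    using outside_line [OF ap] .
  obtain d where d: "d \<in> P b" "d \<notin> {0, b, p, b + p}"
    using outside_line [OF bp] .
  have Pp: "P p = {0, p, a, p + a, b, b + p, b + a, b + (p + a)}"
    by (rule nbhd_plane [OF pa b])
  have nz: "a \<noteq> 0" "b \<noteq> 0" "c \<noteq> 0" "d \<noteq> 0" "a \<noteq> b"
    using pa pb b c d by (auto simp: adj_def)
  have cp: "c \<notin> P p"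
  proof
    assume "c \<in> P p"
    then have "adj p c" "adj a c"
      using c nz p by (auto simp: adj_def)
    then show False
      using adj_triangle [OF pa] c(2) by (auto simp: add.commute)
  qed
  have dp: "d \<notin> P p"
  proof
    assume "d \<in> P p"
    then have "adj p d" "adj b d"
      using d nz p by (auto simp: adj_def)
    then show False
      using adj_triangle [OF pb] d(2) by (auto simp: add.commute)
  qed
  have cd: "c + d \<notin> P p"
  proof
    assume "c + d \<in> P p"
    then have "c + d \<in> {0, p, b, b + p} \<or> c + d + a \<in> {0, p, b, b + p}"
      unfolding Pp by (elim insertE emptyE) (simp_all add: add_ac)
    then obtain r where r: "r = 0 \<or> r = a" "c + d + r \<in> {0, p, b, b + p}"
      by (metis add.right_neutral)
    have "{0, p, b, b + p} \<subseteq> P b"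
      using bp zero_mem self_mem add_mem by (simp add: adj_def)
    then have "d + (c + d + r) \<in> P b"
      using r(2) d(1) nz add_mem by blast
    moreover have "d + (c + d + r) = c + r"
      by (simp add: add_ac)
    ultimately have q: "c + r \<in> P b"
      by simp
    have "c + r \<in> P a"
      using r(1) c(1) nz add_mem self_mem by auto
    moreover have "r \<in> P p" "b \<in> P p" "a \<in> P p" "0 \<in> P p" "p \<in> P p"
      using r(1) pa pb p zero_mem self_mem by (auto simp: adj_def)
    then have "c + r \<notin> P p"
      using cp add_mem [OF p, of "c + r" r] by auto
    moreover have "c + r \<notin> {0, a, b}"
      using \<open>c + r \<notin> P p\<close> \<open>b \<in> P p\<close> \<open>a \<in> P p\<close> \<open>0 \<in> P p\<close> by (metis insertE singletonD)
    moreover have "p \<notin> {0, a, b}"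
      using pa pb by (auto simp: adj_def)
    ultimately have "p = c + r"
      using common_unique [of a b p "c + r"] nz q ap bp unfolding adj_def by blast
    then show False
      using \<open>c + r \<notin> P p\<close> \<open>p \<in> P p\<close> by simp
  qed
  have planes: "P p \<subseteq> H" "P a \<subseteq> H" "P b \<subseteq> H"
    using centre p pa pb self_mem unfolding adj_def by blast+
  have labelled: "labelled_hyperplane P H (comb [p, a, b, c, d, t])" if "t \<notin> H" for t
  proof (rule labelled_hyperplane5I [OF H _ that])
    show "{p, a, b, c, d} \<subseteq> H"
      using planes c(1) d(1) self_mem p nz by blast
    show "p \<noteq> 0" by (rule p)
    show "a \<notin> {0, p}" using pa by (auto simp: adj_def)
    show "b \<notin> {0, p, a, p + a}" by (rule b)
    show "c \<notin> (let S = {0, b} \<union> (+) a ` {0, b} in S \<union> (+) p ` S)"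
      using cp unfolding Pp by (simp add: add_ac)
    have "d \<notin> (+) c ` P p"
    proof
      assume "d \<in> (+) c ` P p"
      then obtain s where "s \<in> P p" "d = c + s" by blast
      then show False using cd by simp
    qed
    then show "d \<notin> (let S = {0, c} \<union> (+) b ` {0, c}; S' = S \<union> (+) a ` S in S' \<union> (+) p ` S')"
      using dp unfolding Pp by (simp add: add_ac)
  qed
  \<comment> \<open>whether 24 is adjacent to 6, stated independently of the last basis vector\<close>
  let ?e = "if c + d \<in> P (a + b) then 0 else 2 :: int"
  have "complete_frame P H (comb [p, a, b, c, d, t]) centre_points (centre_lines ?e)" if t: "t \<notin> H" for t
  proof -
    let ?g = "comb [p, a, b, c, d, t]"
    have v: "?g 1 = p" "?g 2 = a" "?g 4 = b" "?g 8 = c" "?g 16 = d" "?g 24 = c + d" "?g 6 = a + b"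
      by simp_all
    interpret labelled_hyperplane P H ?g
      by (rule labelled [OF t])
    interpret centred_hyperplane P H ?g
    proof
      show "?g 2 \<in> P (?g 1)" "?g 4 \<in> P (?g 1)" "?g 8 \<in> P (?g 2)" "?g 16 \<in> P (?g 4)"
        unfolding v using pa pb c d by (auto simp: adj_def)
      show "P (?g n) \<subseteq> H" if n: "0 < n" "n < 8" for n
      proof (rule centre)
        have "?g n = comb [p, a, b] n"
          using n comb_append [of "[p, a, b, c, d]" t n] comb_append [of "[p, a, b, c]" d n]
            comb_append [of "[p, a, b]" c n] by (simp del: comb.simps)
        moreover have "comb [p, a, b] n \<in> P p"
          using p pa pb zero_mem self_mem by (simp add: adj_def add_mem)
        ultimately show "?g n \<in> P p" by (simp only:)
        show "?g n \<noteq> 0"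
          using g_nonzero [of n] n by simp
      qed
    qed
    show ?thesis
      using complete_centre unfolding v .
  qed
  moreover have "?e = 0 \<or> ?e = 2" by simp
  ultimately show thesis
    using that by blast
qed

end

lemma forall_6: "(\<forall>i::6. A i) \<longleftrightarrow> A 1 \<and> A 2 \<and> A 3 \<and> A 4 \<and> A 5 \<and> A 6"
proof -
  have "(UNIV :: 6 set) = {1, 2, 3, 4, 5, 6}"
    by (rule card_subset_eq [symmetric]) simp_all
  then show ?thesis
    by (metis UNIV_I insertE singletonD)
qed

lemma forall_7: "(\<forall>i::7. A i) \<longleftrightarrow> A 0 \<and> A 1 \<and> A 2 \<and> A 3 \<and> A 4 \<and> A 5 \<and> A 6"
proof -
  have "(UNIV :: 7 set) = {0, 1, 2, 3, 4, 5, 6}"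
    by (rule card_subset_eq [symmetric]) simp_all
  then show ?thesis
    by (metis UNIV_I insertE singletonD)
qed

section \<open>Standard coordinates\<close>

definition units :: "(bit ^ 6) list" where
  "units = [vector [1, 0, 0, 0, 0, 0], vector [0, 1, 0, 0, 0, 0], vector [0, 0, 1, 0, 0, 0],
     vector [0, 0, 0, 1, 0, 0], vector [0, 0, 0, 0, 1, 0], vector [0, 0, 0, 0, 0, 1]]"

text \<open>
  Integers as labels of the vectors in the standard basis, to compare with the given matrices and lines.
\<close>

definition std :: "int \<Rightarrow> bit ^ 6" where
  "std = comb units"

lemma vector_6_eq_iff:
  "(v :: 'a ^ 6) = w \<longleftrightarrow> v $ 1 = w $ 1 \<and> v $ 2 = w $ 2 \<and> v $ 3 = w $ 3 \<and> v $ 4 = w $ 4 \<and> v $ 5 = w $ 5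
      \<and> v $ 6 = w $ 6"
  by (simp add: vec_eq_iff forall_6)

lemma std_xor: "std (j XOR k) = std j + std k"
  by (simp add: std_def comb_xor)

lemma std_component:
  "std k $ 1 = of_bool (odd k)" "std k $ 2 = of_bool (odd (k div 2))"
  "std k $ 3 = of_bool (odd (k div 4))" "std k $ 4 = of_bool (odd (k div 8))"
  "std k $ 5 = of_bool (odd (k div 16))" "std k $ 6 = of_bool (odd (k div 32))"
  by (simp_all add: std_def units_def div_mult2_eq flip: zdiv_zmult2_eq)

lemma bit_eq_of_bool: "(b :: bit) = of_bool (b = 1)"
  by (cases b) simp_all

lemma std_surj: obtains k where "0 \<le> k" "k < 64" "std k = v"
proof -
  define k :: int where "k = of_bool (v $ 1 = 1) + 2 * (of_bool (v $ 2 = 1) + 2 * (of_bool (v $ 3 = 1)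
     + 2 * (of_bool (v $ 4 = 1) + 2 * (of_bool (v $ 5 = 1) + 2 * of_bool (v $ 6 = 1)))))"
  have "comb (b # bs) (of_bool c + 2 * j) = (if c then b else 0) + comb bs j" for b :: "bit ^ 6" and bs c j
    by simp
  then have "std k = v"
    by (simp add: k_def std_def units_def vector_6_eq_iff bit_eq_of_bool)
  moreover have "0 \<le> k" "k < 64"
    by (simp_all add: k_def)
  ultimately show thesis using that by blast
qed

definition mat_of :: "(bit ^ 6) list \<Rightarrow> bit ^ 6 ^ 6" where
  "mat_of fs = vector fs"

lemma comb_vector_matrix: "comb bs k v* A = comb (map (\<lambda>b. b v* A) bs) k"
  by (induction bs arbitrary: k) (simp_all add: vector_matrix_left_distrib)

lemma sum_6: "(\<Sum>i\<in>(UNIV :: 6 set). f i) = f 1 + f 2 + f 3 + f 4 + f 5 + (f 6 :: 'a :: comm_monoid_add)"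
proof -
  have "(UNIV :: 6 set) = {1, 2, 3, 4, 5, 6}"
    by (rule card_subset_eq [symmetric]) simp_all
  then have "sum f UNIV = sum f {1, 2, 3, 4, 5, 6}" by (rule arg_cong)
  also have "\<dots> = f 1 + f 2 + f 3 + f 4 + f 5 + f 6" by (simp add: add.assoc)
  finally show ?thesis .
qed

lemma std_vector_matrix: 
  assumes "length fs = 6"
  shows "std k v* mat_of fs = comb fs k"
proof -
  obtain a b c d e f where fs: "fs = [a, b, c, d, e, f]"
    using assms by (auto simp: eval_nat_numeral length_Suc_conv)
  have "map (\<lambda>b. b v* A) units = [A $ 1, A $ 2, A $ 3, A $ 4, A $ 5, A $ 6]" for A :: "bit ^ 6 ^ 6"
    by (simp add: units_def vec_eq_iff vector_matrix_mult_def sum_6)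
  then have "map (\<lambda>b. b v* mat_of fs) units = fs"
    by (simp add: fs mat_of_def)
  then show ?thesis
    by (simp add: std_def comb_vector_matrix)
qed

lemma invertible_mat_of:
  assumes "length fs = 6" "\<forall>v. \<exists>k. comb fs k = v"
  shows "invertible (mat_of fs)"
proof -
  have "surj ((*v) (transpose (mat_of fs)))"
    unfolding surj_def
  proof

    fix v
    obtain k where "comb fs k = v" using assms(2) by blast
    then show "\<exists>w. v = transpose (mat_of fs) *v w"
      using std_vector_matrix [OF assms(1), of k] by (intro exI [of _ "std k"]) simp
  qed
  then obtain B where "transpose (mat_of fs) ** B = mat 1"
    unfolding matrix_right_invertible_surjective [symmetric] by blast
  then have "transpose B ** mat_of fs = mat 1"
    by (metis matrix_transpose_mul transpose_mat transpose_transpose)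
  then show ?thesis
    using invertible_left_inverse by blast
qed

lemma mat_of_mult:
  assumes "length fs = 6" "length js = 6"
  shows "mat_of (map std js) ** mat_of fs = mat_of (map (comb fs) js)"
proof -
  obtain a b c d e f where js: "js = [a, b, c, d, e, f]"
    using assms(2) by (auto simp: eval_nat_numeral length_Suc_conv)
  have row: "(A ** B) $ i = A $ i v* B" for A B :: "bit ^ 6 ^ 6" and i
    by (simp add: vec_eq_iff matrix_matrix_mult_def vector_matrix_mult_def)
  show ?thesis
    unfolding js mat_of_def vec_eq_iff forall_6 row
    using std_vector_matrix [OF assms(1)] by (simp add: mat_of_def)
qed

section \<open>Sets of lines given by pairs of points\<close>

definition line_of :: "int \<times> int \<Rightarrow> (bit ^ 6) set" where
  "line_of p = (case p of (i, j) \<Rightarrow> {0, std i, std j, std i + std j})"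

definition lines_of :: "(int \<times> int) list \<Rightarrow> (bit ^ 6) set set" where
  "lines_of T = line_of ` set T"

definition points_on :: "int \<times> int \<Rightarrow> int list" where
  "points_on p = [fst p, snd p, fst p XOR snd p]"

text \<open>
  With repetitions; \<open>m\<close> itself is among its entries once for each line.
\<close>

definition joined :: "(int \<times> int) list \<Rightarrow> int \<Rightarrow> int list" where
  "joined T m = concat (map points_on (filter (\<lambda>p. m \<in> set (points_on p)) T))"

definition three_per_point :: "(int \<times> int) list \<Rightarrow> bool" where
  "three_per_point T \<longleftrightarrow>
     list_all (\<lambda>(i, j). 0 < i \<and> i < 64 \<and> 0 < j \<and> j < 64 \<and> i \<noteq> j) T \<and>
     list_all (\<lambda>m. length (remdups (joined T m)) = 7) [1..63]"

lemma subspace_image_line_of: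
  "length fs = 6 \<Longrightarrow> subspace_image (line_of (i, j)) (mat_of fs) = {0, comb fs i, comb fs j, comb fs i
      + comb fs j}"
  by (simp add: subspace_image_def line_of_def vector_matrix_left_distrib std_vector_matrix)

lemma subspace_image_mult: "subspace_image (subspace_image l A) B = subspace_image l (A ** B)"
  by (simp add: subspace_image_def image_image vector_matrix_mul_assoc)

lemma subspace_image_one: "subspace_image l (mat 1) = l"
  by (simp add: subspace_image_def)

lemma projectively_equivalent_sym:
  fixes E F :: "(bit ^ 'n) set set"
  assumes "projectively_equivalent E F"
  shows "projectively_equivalent F E"
proof -
  obtain A where A: "invertible A" "(\<lambda>l. subspace_image l A) ` E = F"
    using assms by (auto simp: projectively_equivalent_def)
  then obtain B where B: "A ** B = mat 1" "B ** A = mat 1"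
    by (auto simp: invertible_def)
  then have "invertible B"
    by (auto simp: invertible_def)
  moreover have "(\<lambda>l. subspace_image l B) ` F = E"
    using B by (simp add: A(2) [symmetric] image_image subspace_image_mult subspace_image_one)
  ultimately show ?thesis
    by (auto simp: projectively_equivalent_def)
qed

lemma projectively_equivalent_trans:
  fixes E F F' :: "(bit ^ 'n) set set"
  assumes "projectively_equivalent E F" "projectively_equivalent F F'"
  shows "projectively_equivalent E F'"
proof -
  obtain A B where "invertible A" "(\<lambda>l. subspace_image l A) ` E = F"
      "invertible B" "(\<lambda>l. subspace_image l B) ` F = F'"
    using assms by (auto simp: projectively_equivalent_def)
  then have "invertible (A ** B)" "(\<lambda>l. subspace_image l (A ** B)) ` E = F'"
    using invertible_mult by (auto simp: image_image subspace_image_mult)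
  then show ?thesis
    by (auto simp: projectively_equivalent_def)
qed

lemma comb_surj_64:
  fixes fs :: "(bit ^ 6) list"
  assumes "length fs = 6" "\<forall>v. \<exists>k. comb fs k = v"
  shows "comb fs ` {0..<64} = UNIV"
proof -
  have "v \<in> comb fs ` {0..<64}" for v
  proof -
    obtain k where k: "comb fs k = v" using assms by blast
    obtain k' where "0 \<le> k'" "k' < 64" "std k' = std k"
      using std_surj .
    then have "comb fs k' = v"
      using k std_vector_matrix [OF assms(1)] by metis
    then show ?thesis
      using \<open>0 \<le> k'\<close> \<open>k' < 64\<close> by auto
  qed
  then show ?thesis by (metis UNIV_eq_I)
qed

text \<open>
  The image of the copy consists of edges. Three lines through a point account for all the seven points of
  its plane, so no edge is missing.
\<close>

lemma (in deza_nbhd) has_copy_equivalent: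
  assumes "has_copy T" "three_per_point T"
  shows "projectively_equivalent (lines_of T)
    {{0, x, y, x + y} | x y. x \<noteq> 0 \<and> y \<noteq> 0 \<and> x \<noteq> y \<and> y \<in> P x}" (is "projectively_equivalent _ ?E")
proof -
  obtain fs where fs: "length fs = 6" "\<forall>v. \<exists>k. comb fs k = v"
      "\<And>i j. (i, j) \<in> set T \<Longrightarrow> comb fs j \<in> P (comb fs i)"
    using assms(1) unfolding has_copy_def by fast
  let ?f = "comb fs"
  have surj: "?f ` {0..<64} = UNIV"
    using comb_surj_64 fs by blast
  have "inj_on ?f {0..<64}"
    by (rule eq_card_imp_inj_on) (simp_all only: surj card_bit_6, simp_all)
  then have inj: "?f j = ?f k \<longleftrightarrow> j = k" if "0 \<le> j" "j < 64" "0 \<le> k" "k < 64" for j k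
    using that by (auto simp: inj_on_def)
  have nonzero: "?f k \<noteq> 0" if "0 < k" "k < 64" for k
    using inj [of k 0] that by (simp add: comb_0)
  have T: "0 < i" "i < 64" "0 < j" "j < 64" "i \<noteq> j" "0 < i XOR j" "i XOR j < 64" if "(i, j) \<in> set T" for i j
  proof -
    show b: "0 < i" "i < 64" "0 < j" "j < 64" "i \<noteq> j"
      using assms(2) that by (auto simp: three_per_point_def list_all_iff)
    then show "0 < i XOR j" "i XOR j < 64"
      using xor_range [of i 6 j] xor_eq_0 [of i j] by (auto simp: less_le)
  qed
  have on: "0 < m \<and> m < 64 \<and> ?f n \<in> P (?f m)"
    if p: "p \<in> set T" "m \<in> set (points_on p)" "n \<in> set (points_on p)" for p m n
  proof -
    obtain i j where p': "p = (i, j)" by fastforce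
    note b = T [OF p(1) [unfolded p']]
    have 0: "?f i \<noteq> 0" "?f j \<noteq> 0" "?f (i XOR j) \<noteq> 0"
      using b nonzero by auto
    have 1: "?f i \<in> P (?f i)" "?f j \<in> P (?f i)" "?f i \<in> P (?f j)" "?f j \<in> P (?f j)"
      using fs(3) p(1) p' 0 nbhd_sym self_mem by auto
    then have 2: "?f (i XOR j) \<in> P (?f i)" "?f (i XOR j) \<in> P (?f j)"
      using add_mem 0 by (simp_all add: comb_xor)
    then have "?f i \<in> P (?f (i XOR j))" "?f j \<in> P (?f (i XOR j))" "?f (i XOR j) \<in> P (?f (i XOR j))"
      using 0 nbhd_sym self_mem by auto
    then show ?thesis
      using 1 2 b p(2,3) by (auto simp: p' points_on_def)
  qed
  have "(\<lambda>l. subspace_image l (mat_of fs)) ` lines_of T = ?E"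
  proof (intro Set.set_eqI iffI)
    fix l assume "l \<in> (\<lambda>l. subspace_image l (mat_of fs)) ` lines_of T"
    then obtain i j where ij: "(i, j) \<in> set T" "l = subspace_image (line_of (i, j)) (mat_of fs)"
      unfolding lines_of_def by fast
    then have "l = {0, ?f i, ?f j, ?f i + ?f j}"
      using subspace_image_line_of fs(1) by simp
    moreover have "?f i \<noteq> 0" "?f j \<noteq> 0" "?f i \<noteq> ?f j" "?f j \<in> P (?f i)"
      using T [OF ij(1)] nonzero inj fs(3) [OF ij(1)] by auto
    ultimately show "l \<in> ?E" by blast
  next
    fix l assume "l \<in> ?E"
    then obtain x y where xy: "l = {0, x, y, x + y}" "x \<noteq> 0" "y \<noteq> 0" "x \<noteq> y" "y \<in> P x" by blast
    have "x \<in> ?f ` {0..<64}"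
      by (simp only: surj UNIV_I)
    then obtain m where m: "0 \<le> m" "m < 64" "x = ?f m"
      by auto
    then have "0 < m"
      using xy(2) comb_0 by (auto simp: less_le)
    then have "m \<in> set [1..63]"
      unfolding set_upto using m by simp
    then have "length (remdups (joined T m)) = 7"
      using assms(2) unfolding three_per_point_def list_all_iff by blast
    then have card: "card (set (joined T m)) = 7"
      by (metis length_remdups_card_conv)
    have joined: "0 < n \<and> n < 64 \<and> ?f n \<in> P x" if "n \<in> set (joined T m)" for n
      using that on [of _ m n] on [of _ n m] m(3) by (auto simp: joined_def)
    have "0 \<notin> set (joined T m)"
      using joined by blast
    then have "card (insert 0 (set (joined T m))) = 8"
      using card by simp
    moreover have "inj_on ?f (insert 0 (set (joined T m)))"
    proof (rule inj_onI)
      fix j k assume "j \<in> insert 0 (set (joined T m))" "k \<in> insert 0 (set (joined T m))" "?f j = ?f k"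
      moreover have "0 \<le> j \<and> j < 64" "0 \<le> k \<and> k < 64"
        using joined [of j] joined [of k] calculation by force+
      ultimately show "j = k" using inj by simp
    qed
    ultimately have "card (?f ` insert 0 (set (joined T m))) = 8"
      by (simp only: card_image)
    moreover have "?f ` insert 0 (set (joined T m)) \<subseteq> P x"
      using joined zero_mem xy(2) by (auto simp: comb_0)
    ultimately have "P x = ?f ` insert 0 (set (joined T m))"
      using nbhd_eqI xy(2) by blast
    then obtain n where n: "n \<in> set (joined T m)" "y = ?f n"
      using xy(3,5) comb_0 by auto
    then obtain i j where ij: "(i, j) \<in> set T" "m \<in> set (points_on (i, j))" "n \<in> set (points_on (i, j))"
      by (auto simp: joined_def)
    have "m \<noteq> n"
      using xy(4) m(3) n(2) by auto
    have "{0, ?f m, ?f n, ?f m + ?f n} = {0, ?f i, ?f j, ?f i + ?f j}"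
    proof -
      have s: "?f i + (?f i + ?f j) = ?f j" "?f j + (?f i + ?f j) = ?f i" "?f i + ?f j + ?f i = ?f j"
          "?f i + ?f j + ?f j = ?f i" "?f j + ?f i = ?f i + ?f j"
        by (simp_all add: add_ac)
      show ?thesis
        using ij(2,3) \<open>m \<noteq> n\<close> unfolding points_on_def fst_conv snd_conv set_simps
        by (elim insertE emptyE) (simp_all only: comb_xor s insert_commute simp_thms)
    qed
    then have "l = subspace_image (line_of (i, j)) (mat_of fs)"
      using subspace_image_line_of fs(1) xy(1) m(3) n(2) by simp
    then show "l \<in> (\<lambda>l. subspace_image l (mat_of fs)) ` lines_of T"
      using ij(1) by (simp add: lines_of_def)
  qed
  moreover have "invertible (mat_of fs)"
    using invertible_mat_of fs by blast
  ultimately show ?thesis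
    unfolding projectively_equivalent_def by blast
qed

section \<open>Orbits of lines\<close>

definition same_line :: "int \<times> int \<Rightarrow> int \<times> int \<Rightarrow> bool" where
  "same_line p q \<longleftrightarrow> fst p \<noteq> snd p \<and> fst p \<in> set (points_on q) \<and> snd p \<in> set (points_on q)"

lemma same_line_of: "same_line p q \<Longrightarrow> line_of p = line_of q"
proof -
  assume pq: "same_line p q"
  obtain i j k l where p: "p = (i, j)" and q: "q = (k, l)" by fastforce
  have s: "std k + (std k + std l) = std l" "std l + (std k + std l) = std k" "std k + std l + std k
      = std l"
      "std k + std l + std l = std k" "std l + std k = std k + std l"
    by (simp_all add: add_ac)
  have ij: "i \<noteq> j" "i \<in> {k, l, k XOR l}" "j \<in> {k, l, k XOR l}"
    using pq by (simp_all add: p q same_line_def points_on_def)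
  then show ?thesis
    unfolding p q line_of_def prod.case
    by (elim insertE emptyE) (simp_all only: std_xor s insert_commute simp_thms)
qed

definition act :: "int list \<Rightarrow> int \<times> int \<Rightarrow> int \<times> int" where
  "act r p = (lin r (fst p), lin r (snd p))"

definition closed_under :: "int list \<Rightarrow> (int \<times> int) list \<Rightarrow> (int \<times> int) list \<Rightarrow> bool" where
  "closed_under r T T' \<longleftrightarrow> list_all (\<lambda>p. list_ex (same_line (act r p)) T') T"

text \<open>
  Each listed line is the image of an earlier one under one of the two generators.
\<close>

fun reached :: "int list \<Rightarrow> int list \<Rightarrow> (int \<times> int) list \<Rightarrow> (int \<times> int) list \<Rightarrow> bool" where
  "reached r s seen [] \<longleftrightarrow> True"
| "reached r s seen (p # ps) \<longleftrightarrow> list_ex (\<lambda>q. p = act r q \<or> p = act s q) seen \<and> reached r s (p # seen) ps"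

lemma comb_std: "comb (map std r) k = std (lin r k)"
  by (simp add: std_def comb_lin)

lemma subspace_image_act:
  "length r = 6 \<Longrightarrow> subspace_image (line_of p) (mat_of (map std r)) = line_of (act r p)"
  using subspace_image_line_of [of "map std r" "fst p" "snd p"]
  by (simp add: comb_std act_def line_of_def split_beta)

lemma closed_under_image:
  assumes "length r = 6" "closed_under r T T'" "l \<in> lines_of T"
  shows "subspace_image l (mat_of (map std r)) \<in> lines_of T'"
proof -
  obtain p where p: "p \<in> set T" "l = line_of p"
    using assms(3) by (auto simp: lines_of_def)
  then obtain q where q: "q \<in> set T'" "same_line (act r p) q"
    using assms(2) by (auto simp: closed_under_def list_all_iff list_ex_iff)
  then show ?thesis
    using p subspace_image_act [OF assms(1)] same_line_of by (auto simp: lines_of_def)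
qed

lemma std_powers: "map std [1, 2, 4, 8, 16, 32] = units"
  by (simp add: std_def units_def)

lemma comb_inverse:
  assumes "map (lin r) r' = [1, 2, 4, 8, 16, 32]"
  shows "comb (map std r) (lin r' k) = std k"
proof -
  have "comb (map std r) (lin r' k) = std (lin [1, 2, 4, 8, 16, 32] k)"
    by (simp only: comb_std lin_lin assms)
  also have "\<dots> = comb (map std [1, 2, 4, 8, 16, 32]) k"
    by (simp only: comb_std)
  also have "\<dots> = std k"
    by (subst std_powers) (simp only: std_def)
  finally show ?thesis .
qed

lemma invertible_rows:
  assumes "length r = 6" "map (lin r) r' = [1, 2, 4, 8, 16, 32]"
  shows "invertible (mat_of (map std r))"
proof (rule invertible_mat_of)
  show "length (map std r) = 6"
    using assms(1) by simp
  show "\<forall>v. \<exists>k. comb (map std r) k = v"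
  proof
    fix v
    obtain k where "std k = v"
      using std_surj by blast
    then show "\<exists>k. comb (map std r) k = v"
      using comb_inverse [OF assms(2), of k] by blast
  qed
qed

lemma projectively_equivalent_lines_of:
  assumes r: "length r = 6" "map (lin r) r' = [1, 2, 4, 8, 16, 32]"
    and closed: "closed_under r T T'" "closed_under r' T' T"
  shows "projectively_equivalent (lines_of T) (lines_of T')"
proof -
  let ?R = "mat_of (map std r)"
  have "l \<in> (\<lambda>l. subspace_image l ?R) ` lines_of T" if "l \<in> lines_of T'" for l
  proof -
    obtain i j where l: "(i, j) \<in> set T'" "l = line_of (i, j)"
      using \<open>l \<in> lines_of T'\<close> unfolding lines_of_def by fast
    then obtain q where q: "q \<in> set T" "same_line (act r' (i, j)) q"
      using closed(2) unfolding closed_under_def list_all_iff list_ex_iff by blast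
    have "line_of (act r (lin r' i, lin r' j)) = l"
      by (simp add: l line_of_def act_def comb_inverse [OF r(2)] flip: comb_std)
    then have "subspace_image (line_of q) ?R = l"
      using same_line_of [OF q(2)] subspace_image_act [OF r(1), of "act r' (i, j)"]
      by (simp add: act_def)
    then show ?thesis
      using q(1) by (auto simp: lines_of_def)
  qed
  then have "(\<lambda>l. subspace_image l ?R) ` lines_of T = lines_of T'"
    using closed_under_image [OF r(1) closed(1)] by blast
  then show ?thesis
    using invertible_rows [OF r] unfolding projectively_equivalent_def by blast
qed

lemma group_GL: "group (GL :: (bit ^ 6 ^ 6) monoid)"
proof (rule groupI)
  fix A B C :: "bit ^ 6 ^ 6"
  assume A: "A \<in> carrier GL"
  show "\<one>\<^bsub>GL\<^esub> \<otimes>\<^bsub>GL\<^esub> A = A"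
    by (simp add: GL_def)
  show "\<exists>B\<in>carrier GL. B \<otimes>\<^bsub>GL\<^esub> A = \<one>\<^bsub>GL\<^esub>"
    using A by (auto simp: GL_def invertible_def)
  assume "B \<in> carrier GL"
  then show "A \<otimes>\<^bsub>GL\<^esub> B \<in> carrier GL"
    using A by (simp add: GL_def invertible_mult)
  show "A \<otimes>\<^bsub>GL\<^esub> B \<otimes>\<^bsub>GL\<^esub> C = A \<otimes>\<^bsub>GL\<^esub> (B \<otimes>\<^bsub>GL\<^esub> C)"
    by (simp add: GL_def matrix_mul_assoc)
next
  show "\<one>\<^bsub>GL\<^esub> \<in> carrier (GL :: (bit ^ 6 ^ 6) monoid)"
    by (auto simp: GL_def invertible_def intro!: exI [of _ "mat 1"])
qed

text \<open>
  A generator maps the finite set of listed lines injectively into itself, hence onto itself, so that the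
  set is invariant under the inverses of the generators, too. Conversely each listed line is reached.
\<close>

lemma orbit_eq_lines_of:
  assumes T: "T = p # ps" "reached r s [p] ps" "closed_under r T T" "closed_under s T T"
    and r: "length r = 6" "invertible (mat_of (map std r))"
    and s: "length s = 6" "invertible (mat_of (map std s))"
  shows "{subspace_image (line_of p) A | A. A \<in> generate GL {mat_of (map std r), mat_of (map std
      s)}} = lines_of T"
    (is "?O = _")
proof
  let ?R = "mat_of (map std r)" and ?S = "mat_of (map std s)"
  let ?G = "generate GL {?R, ?S}"
  interpret GL: group "GL :: (bit ^ 6 ^ 6) monoid"
    by (rule group_GL)
  have gen: "?R \<in> carrier GL" "?S \<in> carrier GL"
    using r(2) s(2) by (simp_all add: GL_def)
  have maps: "subspace_image l h \<in> lines_of T" if "h \<in> {?R, ?S}" "l \<in> lines_of T" for h l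
    using that closed_under_image T r s by auto
  have inverse: "h ** inv\<^bsub>GL\<^esub> h = mat 1" if "h \<in> {?R, ?S}" for h
    using that GL.r_inv [of h] gen by (auto simp: GL_def)
  have "subspace_image l A \<in> lines_of T" if "A \<in> ?G" "l \<in> lines_of T" for A l
    using that
  proof (induction arbitrary: l)
    case one
    then show ?case by (simp add: GL_def subspace_image_one)
  next
    case (incl h)
    then show ?case using maps by blast
  next
    case (inv h)
    have "inj_on (\<lambda>l. subspace_image l h) (lines_of T)"
    proof (rule inj_onI)
      fix l l' assume "subspace_image l h = subspace_image l' h"
      then have "subspace_image (subspace_image l h) (inv\<^bsub>GL\<^esub> h) = subspace_image (subspace_image l'
          h) (inv\<^bsub>GL\<^esub> h)"
        by simp
      then show "l = l'"
        by (simp add: subspace_image_mult inverse [OF inv.hyps] subspace_image_one)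
    qed
    moreover have "finite (lines_of T)"
      by (simp add: lines_of_def)
    moreover have "(\<lambda>l. subspace_image l h) ` lines_of T \<subseteq> lines_of T"
      using maps inv.hyps by blast
    ultimately have "(\<lambda>l. subspace_image l h) ` lines_of T = lines_of T"
      by (intro endo_inj_surj)
    then obtain l' where "l' \<in> lines_of T" "l = subspace_image l' h"
      using inv.prems by blast
    then show ?case
      by (simp add: subspace_image_mult inverse [OF inv.hyps] subspace_image_one)
  next
    case (eng h1 h2)
    have "subspace_image l (h1 ** h2) = subspace_image (subspace_image l h1) h2"
      by (simp add: subspace_image_mult)
    then show ?case
      using eng by (simp add: GL_def)
  qed
  then show "?O \<subseteq> lines_of T"
    using T(1) by (auto simp: lines_of_def)
  have step: "subspace_image l h \<in> ?O" if lh: "l \<in> ?O" "h \<in> {?R, ?S}" for l h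
  proof -
    obtain A where A: "A \<in> ?G" "l = subspace_image (line_of p) A"
      using lh(1) by blast
    have "A \<otimes>\<^bsub>GL\<^esub> h \<in> ?G"
      by (rule generate.eng [OF A(1) generate.incl [OF lh(2)]])
    moreover have "subspace_image l h = subspace_image (line_of p) (A \<otimes>\<^bsub>GL\<^esub> h)"
      by (simp add: A(2) subspace_image_mult GL_def)
    ultimately show ?thesis
      by blast
  qed
  have reach: "\<forall>q\<in>set qs. line_of q \<in> ?O" if "reached r s seen qs" "\<forall>q\<in>set seen. line_of q \<in> ?O" for seen qs
    using that
  proof (induction qs arbitrary: seen)
    case (Cons q qs)
    then obtain q' where q': "q' \<in> set seen" "q = act r q' \<or> q = act s q'"
      by (auto simp: list_ex_iff)
    then have "line_of q \<in> ?O"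
      using Cons.prems(2) step [of "line_of q'" ?R] step [of "line_of q'" ?S]
        subspace_image_act [OF r(1), of q'] subspace_image_act [OF s(1), of q'] by auto
    moreover from this have "\<forall>q\<in>set qs. line_of q \<in> ?O"
      using Cons.IH [of "q # seen"] Cons.prems by simp
    ultimately show ?case
      by simp
  qed simp
  have "line_of p = subspace_image (line_of p) (\<one>\<^bsub>GL\<^esub>)"
    by (simp add: GL_def subspace_image_one)
  then have "line_of p \<in> ?O"
    using generate.one [of GL "{?R, ?S}"] by blast
  then show "lines_of T \<subseteq> ?O"
    using reach [OF T(2)] T(1) by (auto simp: lines_of_def)
qed

section \<open>The group K\<close>

text \<open>
  The orbits are listed so that each line arises from an earlier one by a generator.
\<close>

definition orbit1 :: "(int \<times> int) list" where
  "orbit1 =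
     [(1, 6), (8, 48), (27, 1), (53, 8), (41, 27), (36, 53), (23, 41), (14, 36), (43, 23), (52, 14),
     (33, 43), (63, 52), (34, 33), (39, 63), (15, 34), (35, 39), (47, 15), (20, 35), (22, 47), (6, 20),
     (48, 22), (40, 51), (44, 25), (12, 37), (59, 31), (2, 21), (16, 30), (54, 29), (49, 5), (9, 40),
     (19, 44), (46, 12), (28, 59), (13, 2), (51, 16), (25, 54), (37, 49), (31, 9), (21, 19), (30, 46),
     (29, 28), (5, 13), (55, 62), (57, 42), (18, 60), (38, 58), (7, 10), (56, 11), (26, 3), (61, 24),
     (50, 45), (17, 4), (62, 32), (42, 55), (60, 57), (58, 18), (10, 38), (11, 7), (3, 56), (24, 26),
     (45, 61), (4, 50), (32, 17)]"

definition orbit2 :: "(int \<times> int) list" where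
  "orbit2 =
     [(1, 12), (8, 59), (27, 2), (53, 16), (41, 54), (36, 49), (23, 9), (14, 19), (43, 46), (52, 28),
     (33, 13), (63, 51), (34, 25), (39, 37), (15, 31), (35, 21), (47, 30), (20, 29), (22, 5), (6, 40),
     (48, 44), (40, 50), (44, 17), (12, 62), (59, 42), (2, 60), (16, 58), (54, 10), (49, 11), (9, 3),
     (19, 24), (46, 45), (28, 4), (13, 32), (51, 55), (25, 57), (37, 18), (31, 38), (21, 7), (30, 56),
     (29, 26), (5, 61), (55, 22), (57, 6), (18, 48), (38, 1), (7, 8), (56, 27), (26, 53), (61, 41),
     (50, 36), (17, 23), (62, 14), (42, 43), (60, 52), (58, 33), (10, 63), (11, 34), (3, 39), (24, 15),
     (45, 35), (4, 47), (32, 20)]"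

definition orbit3 :: "(int \<times> int) list" where
  "orbit3 =
     [(2, 12), (16, 59), (54, 2), (49, 16), (9, 54), (19, 49), (46, 9), (28, 19), (13, 46), (51, 28),
     (25, 13), (37, 51), (31, 25), (21, 37), (30, 31), (29, 21), (5, 30), (40, 29), (44, 5), (12, 40),
     (59, 44), (3, 50), (24, 17), (45, 62), (4, 42), (32, 60), (55, 58), (57, 10), (18, 11), (38, 3),
     (7, 24), (56, 45), (26, 4), (61, 32), (50, 55), (17, 57), (62, 18), (42, 38), (60, 7), (58, 56),
     (10, 26), (11, 61), (43, 22), (52, 6), (33, 48), (63, 1), (34, 8), (39, 27), (15, 53), (35, 41),
     (47, 36), (20, 23), (22, 14), (6, 43), (48, 52), (1, 33), (8, 63), (27, 34), (53, 39), (41, 15),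
     (36, 35), (23, 47), (14, 20)]"

definition sigma_rows :: "int list" where "sigma_rows = [2, 4, 8, 16, 32, 27]"
definition sigma3_rows :: "int list" where "sigma3_rows = [8, 16, 32, 27, 54, 55]"
definition phi_rows :: "int list" where "phi_rows = [40, 3, 48, 2, 32, 53]"

lemma orbit_check:
  "three_per_point orbit1"
  "orbit1 = (1, 6) # tl orbit1" "reached sigma3_rows phi_rows [(1, 6)] (tl orbit1)"
  "closed_under sigma3_rows orbit1 orbit1" "closed_under phi_rows orbit1 orbit1"
  "orbit2 = (1, 12) # tl orbit2" "reached sigma3_rows phi_rows [(1, 12)] (tl orbit2)"
  "closed_under sigma3_rows orbit2 orbit2" "closed_under phi_rows orbit2 orbit2"
  "orbit3 = (2, 12) # tl orbit3" "reached sigma3_rows phi_rows [(2, 12)] (tl orbit3)"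
  "closed_under sigma3_rows orbit3 orbit3" "closed_under phi_rows orbit3 orbit3"
  by code_simp+

lemma orbit_equivalence_check:
  "closed_under [42, 15, 30, 60, 35, 29] orbit1 orbit2" "closed_under [28, 56, 43, 13, 26, 52]
      orbit2 orbit1"
  "map (lin [42, 15, 30, 60, 35, 29]) [28, 56, 43, 13, 26, 52] = [1, 2, 4, 8, 16, 32]"
  "closed_under [43, 21, 3, 53, 13, 42] orbit1 orbit3" "closed_under [33, 37, 62, 15, 29, 10] orbit3 orbit1"
  "map (lin [43, 21, 3, 53, 13, 42]) [33, 37, 62, 15, 29, 10] = [1, 2, 4, 8, 16, 32]"
  by code_simp+

lemma rows_check:
  "map (lin sigma3_rows) [48, 59, 45, 1, 2, 4] = [1, 2, 4, 8, 16, 32]"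
  "map (lin phi_rows) [10, 8, 46, 17, 20, 16] = [1, 2, 4, 8, 16, 32]"
  "map (lin sigma_rows) (map (lin sigma_rows) sigma_rows) = sigma3_rows"
  by code_simp+

lemma std_vectors:
  "std 1 = vector [1, 0, 0, 0, 0, 0]" "std 2 = vector [0, 1, 0, 0, 0, 0]" "std 4 = vector [0, 0, 1,
      0, 0, 0]"
  "std 8 = vector [0, 0, 0, 1, 0, 0]" "std 16 = vector [0, 0, 0, 0, 1, 0]" "std 32 = vector [0, 0,
      0, 0, 0, 1]"
  "std 27 = vector [1, 1, 0, 1, 1, 0]" "std 40 = vector [0, 0, 0, 1, 0, 1]" "std 3 = vector [1, 1,
      0, 0, 0, 0]"
  "std 48 = vector [0, 0, 0, 0, 1, 1]" "std 53 = vector [1, 0, 1, 0, 1, 1]"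
  "std 6 = vector [0, 1, 1, 0, 0, 0]" "std 12 = vector [0, 0, 1, 1, 0, 0]"
  by (simp_all add: vector_6_eq_iff std_component)

lemma sigma_eq: "sigma = mat_of (map std sigma_rows)"
  by (simp only: sigma_def sigma_rows_def mat_of_def list.map std_vectors)

lemma phi_eq: "phi = mat_of (map std phi_rows)"
  by (simp only: phi_def phi_rows_def mat_of_def list.map std_vectors)

lemma sigma3_eq: "sigma [^]\<^bsub>GL\<^esub> (3 :: nat) = mat_of (map std sigma3_rows)"
proof -
  interpret GL: group "GL :: (bit ^ 6 ^ 6) monoid"
    by (rule group_GL)
  have mult: "mat_of (map std js) ** mat_of (map std r) = mat_of (map std (map (lin r) js))"
    if "length r = 6" "length js = 6" for r js
  proof -
    have eq: "map (comb (map std r)) js = map std (map (lin r) js)"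
      by (simp add: comb_std)
    show ?thesis
      using mat_of_mult [of "map std r" js, unfolded eq] that by (simp only: length_map)
  qed
  have len: "length sigma_rows = 6" "length (map (lin sigma_rows) sigma_rows) = 6"
    by (simp_all add: sigma_rows_def)
  have "sigma [^]\<^bsub>GL\<^esub> (3 :: nat) = sigma ** sigma ** sigma"
    by (simp add: numeral_3_eq_3 GL_def)
  also have "\<dots> = mat_of (map std sigma3_rows)"
    unfolding sigma_eq mult [OF len(1,1)] mult [OF len] rows_check(3) ..
  finally show ?thesis .
qed

lemma lines_eq: "line1 = line_of (1, 6)" "line2 = line_of (1, 12)" "line3 = line_of (2, 12)"
  by (simp_all only: line1_def line2_def line3_def line_of_def prod.case span_pair_bit std_vectors)

lemma K_orbit_eq:
  assumes "T = p # tl T" "reached sigma3_rows phi_rows [p] (tl T)"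
    "closed_under sigma3_rows T T" "closed_under phi_rows T T"
  shows "K_orbit (line_of p) = lines_of T"
  unfolding K_orbit_def group_K_def sigma3_eq phi_eq
proof (rule orbit_eq_lines_of [OF assms])
  show "length sigma3_rows = 6" "length phi_rows = 6"
    by (simp_all add: sigma3_rows_def phi_rows_def)
  then show "invertible (mat_of (map std sigma3_rows))" "invertible (mat_of (map std phi_rows))"
    using invertible_rows [OF _ rows_check(1)] invertible_rows [OF _ rows_check(2)] by (simp_all only:)
qed

lemma K_orbits:
  "K_orbit line1 = lines_of orbit1" "K_orbit line2 = lines_of orbit2" "K_orbit line3 = lines_of orbit3"
  unfolding lines_eq
  using K_orbit_eq [OF orbit_check(2-5)] K_orbit_eq [OF orbit_check(6-9)] K_orbit_eq [OF orbit_check(10-13)]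
  by simp_all

lemma K_orbits_equivalent:
  "projectively_equivalent (K_orbit line1) (K_orbit line2)"
  "projectively_equivalent (K_orbit line1) (K_orbit line3)"
  "projectively_equivalent (K_orbit line2) (K_orbit line3)"
proof -
  show 12: "projectively_equivalent (K_orbit line1) (K_orbit line2)"
    unfolding K_orbits
    by (rule projectively_equivalent_lines_of [OF _ orbit_equivalence_check(3,1,2)]) simp
  show 13: "projectively_equivalent (K_orbit line1) (K_orbit line3)"
    unfolding K_orbits
    by (rule projectively_equivalent_lines_of [OF _ orbit_equivalence_check(6,4,5)]) simp
  show "projectively_equivalent (K_orbit line2) (K_orbit line3)"
    by (rule projectively_equivalent_trans [OF projectively_equivalent_sym [OF 12] 13])
qed

section \<open>The split Cayley hexagon\<close>

text \<open>
  A point of \<open>PG(5,2)\<close> is the projection of a unique point of the quadric, since \<open>X\<^sub>3\<close> is its own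
      square. With
  the coordinate \<open>X\<^sub>3\<close> restored in this way, the conditions on a hexagon line become Boolean conditions on
  two points.
\<close>

definition quadric_bit :: "bool \<Rightarrow> bool \<Rightarrow> bool \<Rightarrow> bool \<Rightarrow> bool \<Rightarrow> bool \<Rightarrow> bool" where
  "quadric_bit x0 x1 x2 x4 x5 x6 \<longleftrightarrow> (((x0 \<and> x4) \<noteq> (x1 \<and> x5)) \<noteq> (x2 \<and> x6))"

definition minor_bit :: "bool \<Rightarrow> bool \<Rightarrow> bool \<Rightarrow> bool \<Rightarrow> bool" where
  "minor_bit xi xj yi yj \<longleftrightarrow> (xi \<and> yj) \<noteq> (xj \<and> yi)"

definition hexagon_bits where
  "hexagon_bits x0 x1 x2 x3 x4 x5 x6 y0 y1 y2 y3 y4 y5 y6 \<longleftrightarrow>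
     minor_bit x1 x2 y1 y2 = minor_bit x3 x4 y3 y4 \<and> minor_bit x5 x4 y5 y4 = minor_bit x3 x2 y3 y2 \<and>
     minor_bit x2 x0 y2 y0 = minor_bit x3 x5 y3 y5 \<and> minor_bit x6 x5 y6 y5 = minor_bit x3 x0 y3 y0 \<and>
     minor_bit x0 x1 y0 y1 = minor_bit x3 x6 y3 y6 \<and> minor_bit x4 x6 y4 y6 = minor_bit x3 x1 y3 y1 \<and>
     quadric_bit (x0 \<noteq> y0) (x1 \<noteq> y1) (x2 \<noteq> y2) (x4 \<noteq> y4) (x5 \<noteq> y5) (x6 \<noteq> y6) = (x3 \<noteq> y3)"

definition with_quadric :: "(bool \<Rightarrow> bool \<Rightarrow> bool \<Rightarrow> bool \<Rightarrow> bool \<Rightarrow> bool \<Rightarrow> bool \<Rightarrow> 'a) \<Rightarrow> int \<Rightarrow> 'a" where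
  "with_quadric f m = f (odd m) (odd (m div 2)) (odd (m div 4))
     (quadric_bit (odd m) (odd (m div 2)) (odd (m div 4)) (odd (m div 8)) (odd (m div 16)) (odd (m div 32)))
     (odd (m div 8)) (odd (m div 16)) (odd (m div 32))"

definition hexagon_pair :: "int \<Rightarrow> int \<Rightarrow> bool" where
  "hexagon_pair m n = with_quadric (with_quadric hexagon_bits m) n"

text \<open>
  The inverse of the projection on the quadric.
\<close>

definition lift :: "bit ^ 6 \<Rightarrow> bit ^ 7" where
  "lift v = (\<chi> i. if i = 0 then v $ 1 else if i = 1 then v $ 2 else if i = 2 then v $ 3
     else if i = 3 then v $ 1 * v $ 4 + v $ 2 * v $ 5 + v $ 3 * v $ 6
     else if i = 4 then v $ 4 else if i = 5 then v $ 5 else v $ 6)"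

lemma lift_component:
  "lift v $ 0 = v $ 1" "lift v $ 1 = v $ 2" "lift v $ 2 = v $ 3"
  "lift v $ 3 = v $ 1 * v $ 4 + v $ 2 * v $ 5 + v $ 3 * v $ 6"
  "lift v $ 4 = v $ 4" "lift v $ 5 = v $ 5" "lift v $ 6 = v $ 6"
  by (simp_all add: lift_def)

lemma bit_ops:
  "(a :: bit) = b \<longleftrightarrow> (a = 1) = (b = 1)"
  "a * b = 1 \<longleftrightarrow> a = 1 \<and> (b :: bit) = 1"
  "a + b = 1 \<longleftrightarrow> (a = 1) \<noteq> ((b :: bit) = 1)"
  "a - b = 1 \<longleftrightarrow> (a = 1) \<noteq> ((b :: bit) = 1)"
  "a ^ 2 = 1 \<longleftrightarrow> (a :: bit) = 1"
  by (cases a; cases b; simp)+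

lemma quadric_iff: "x \<in> parabolic_quadric \<longleftrightarrow>
    ((x $ 3 = 1) = quadric_bit (x $ 0 = 1) (x $ 1 = 1) (x $ 2 = 1) (x $ 4 = 1) (x $ 5 = 1) (x $ 6 = 1))"
  unfolding parabolic_quadric_def mem_Collect_eq quadric_bit_def
  by (subst bit_ops(1)) (simp only: bit_ops(2-5), blast)

lemma delete_X3_add: "delete_X3 (x + y) = delete_X3 x + delete_X3 y"
  by (simp add: delete_X3_def vector_6_eq_iff)

lemma delete_X3_inj:
  assumes "x \<in> parabolic_quadric" "y \<in> parabolic_quadric" "delete_X3 x = delete_X3 y"
  shows "x = y"
proof -
  have eq: "x $ 0 = y $ 0" "x $ 1 = y $ 1" "x $ 2 = y $ 2" "x $ 4 = y $ 4" "x $ 5 = y $ 5" "x $ 6 = y $ 6"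
    using assms(3) by (simp_all add: delete_X3_def vector_6_eq_iff)
  then have "(x $ 3 = 1) = (y $ 3 = 1)"
    using assms(1,2) unfolding quadric_iff by simp
  then have "x $ 3 = y $ 3"
    by (rule bit_ops(1) [THEN iffD2])
  then show ?thesis
    using eq by (simp add: vec_eq_iff forall_7)
qed

lemma lift_quadric: "lift v \<in> parabolic_quadric"
  unfolding quadric_iff lift_component bit_ops(2,3) quadric_bit_def by blast

lemma delete_lift: "delete_X3 (lift v) = v"
  by (simp add: delete_X3_def lift_component vector_6_eq_iff)

definition pluecker_conditions :: "bit ^ 7 \<Rightarrow> bit ^ 7 \<Rightarrow> bool" where
  "pluecker_conditions x y \<longleftrightarrow> (let p = pluecker x y in
     p 1 2 = p 3 4 \<and> p 5 4 = p 3 2 \<and> p 2 0 = p 3 5 \<and> p 6 5 = p 3 0 \<and> p 0 1 = p 3 6 \<and> p 4 6 = p 3 1)"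

lemma hexagon_pair_iff:
  assumes x: "x \<in> parabolic_quadric" "delete_X3 x = std m" and y: "y \<in> parabolic_quadric" "delete_X3
      y = std n"
  shows "hexagon_pair m n \<longleftrightarrow> pluecker_conditions x y \<and> x + y \<in> parabolic_quadric"
proof -
  have c: "(z $ 0 = 1) = odd k" "(z $ 1 = 1) = odd (k div 2)" "(z $ 2 = 1) = odd (k div 4)"
      "(z $ 4 = 1) = odd (k div 8)" "(z $ 5 = 1) = odd (k div 16)" "(z $ 6 = 1) = odd (k div 32)"
    if "delete_X3 z = std k" for z k
    using that by (simp_all add: delete_X3_def vector_6_eq_iff std_component)
  have "hexagon_pair m n = hexagon_bits (x $ 0 = 1) (x $ 1 = 1) (x $ 2 = 1) (x $ 3 = 1) (x $ 4 = 1)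
      (x $ 5 = 1) (x $ 6 = 1)
      (y $ 0 = 1) (y $ 1 = 1) (y $ 2 = 1) (y $ 3 = 1) (y $ 4 = 1) (y $ 5 = 1) (y $ 6 = 1)"
    using x(1) y(1) unfolding hexagon_pair_def with_quadric_def quadric_iff
    by (simp only: c [OF x(2)] c [OF y(2)])
  also have "\<dots> \<longleftrightarrow> pluecker_conditions x y \<and> x + y \<in> parabolic_quadric"
  proof -
    have m: "(pluecker x y i j = 1) = minor_bit (x $ i = 1) (x $ j = 1) (y $ i = 1) (y $ j = 1)" for i j
      by (simp only: pluecker_def bit_ops(2,4) minor_bit_def)
    have p: "pluecker x y i j = pluecker x y k l \<longleftrightarrow>
        minor_bit (x $ i = 1) (x $ j = 1) (y $ i = 1) (y $ j = 1) =
        minor_bit (x $ k = 1) (x $ l = 1) (y $ k = 1) (y $ l = 1)" for i j k l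
      by (subst bit_ops(1)) (simp only: m)
    show ?thesis
      unfolding hexagon_bits_def pluecker_conditions_def Let_def p quadric_iff vector_add_component
          bit_ops(3)
      by blast
  qed
  finally show ?thesis .
qed

definition hexagon_lines :: "(int \<times> int) list" where
  "hexagon_lines =
     [(1, 16), (1, 32), (1, 48), (2, 8), (2, 32), (2, 40), (3, 24), (3, 32), (3, 56), (4, 8), (4, 16),
     (4, 24), (5, 16), (5, 40), (5, 56), (6, 8), (6, 48), (6, 56), (7, 24), (7, 40), (7, 48), (9, 20),
     (9, 34), (9, 54), (10, 36), (10, 38), (11, 23), (11, 34), (11, 53), (12, 18), (12, 22), (13, 20),
     (13, 39), (13, 51), (14, 50), (14, 52), (15, 19), (15, 37), (15, 54), (17, 36), (17, 37), (18,
     33), (18, 45), (19, 33), (19, 46), (21, 41), (21, 44), (22, 39), (22, 43), (23, 38), (23, 45),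
     (25, 35), (25, 46), (26, 35), (26, 47), (27, 36), (27, 39), (29, 38), (29, 47), (30, 37), (30,
     41), (31, 43), (31, 44)]"

text \<open>
  The last check uses a conditional instead of an implication, because the simplifier then does not
  evaluate the membership test for the pairs that fail the first test.
\<close>

lemma hexagon_check:
  "three_per_point hexagon_lines"
  "list_all (\<lambda>(m, n). hexagon_pair m n) hexagon_lines"
  "list_all (\<lambda>m. list_all (\<lambda>n. if hexagon_pair m n then m = n \<or> list_ex (same_line (m, n)) hexagon_lines
     else True) [1..63]) [1..63]"
  by code_simp+

lemma delete_X3_line:
  "delete_X3 ` {0, x, y, x + y} = {0, delete_X3 x, delete_X3 y, delete_X3 x + delete_X3 y}"
  using delete_X3_add [of 0 0] by (simp add: delete_X3_add)

text \<open>
  The pairs of points that satisfy the conditions are found by running through all of them.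
\<close>

lemma split_Cayley_hexagon_lines_eq: "split_Cayley_hexagon_lines = lines_of hexagon_lines"
proof (intro Set.set_eqI iffI)
  fix l assume "l \<in> split_Cayley_hexagon_lines"
  then obtain L where L: "L \<in> hexagon_lines_PG6" "l = delete_X3 ` L"
    by (auto simp: split_Cayley_hexagon_lines_def)
  then obtain x y where xy: "L = vec.span {x, y}" "pluecker_conditions x y"
    by (auto simp: hexagon_lines_PG6_def pluecker_conditions_def)
  have L': "L \<in> subspaces_of_dim 2" "L \<subseteq> parabolic_quadric"
    using L by (simp_all add: hexagon_lines_PG6_def)
  have Leq: "L = {0, x, y, x + y}"
    unfolding xy(1) by (rule span_pair_bit)
  have "x \<noteq> 0 \<and> y \<noteq> 0 \<and> x \<noteq> y"
  proof (rule ccontr)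
    assume "\<not> (x \<noteq> 0 \<and> y \<noteq> 0 \<and> x \<noteq> y)"
    then have "L = {0, x} \<or> L = {0, y}"
      unfolding Leq by auto
    then have "card L \<le> 2"
      by (auto simp: card_insert_if)
    then show False
      using card_subspace_bit [OF L'(1)] by simp
  qed
  note nz = this
  have Q: "0 \<in> parabolic_quadric" "x \<in> parabolic_quadric" "y \<in> parabolic_quadric" "x + y \<in>
      parabolic_quadric"
    using L'(2) unfolding Leq by auto
  obtain m where m: "0 \<le> m" "m < 64" "std m = delete_X3 x"
    using std_surj .
  obtain n where n: "0 \<le> n" "n < 64" "std n = delete_X3 y"
    using std_surj .
  have d0: "delete_X3 0 = 0"
    using delete_X3_add [of 0 0] by simp
  have "std 0 = 0"
    by (simp add: std_def comb_0)
  then have "m \<noteq> 0" "n \<noteq> 0" "m \<noteq> n"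
    using m n nz Q delete_X3_inj [of x 0] delete_X3_inj [of y 0] delete_X3_inj [of x y] d0 by metis+
  then have "m \<in> set [1..63]" "n \<in> set [1..63]"
    unfolding set_upto using m n by simp_all
  moreover have "hexagon_pair m n"
    using hexagon_pair_iff [OF Q(2) m(3) [symmetric] Q(3) n(3) [symmetric]] xy(2) Q(4) by blast
  ultimately have "list_ex (same_line (m, n)) hexagon_lines"
    using hexagon_check(3) \<open>m \<noteq> n\<close> unfolding list_all_iff if_bool_eq_conj by blast
  then obtain q where "q \<in> set hexagon_lines" "same_line (m, n) q"
    unfolding list_ex_iff by blast
  moreover have "l = line_of (m, n)"
    by (simp only: L(2) Leq delete_X3_line line_of_def prod.case m(3) n(3))
  ultimately show "l \<in> lines_of hexagon_lines"
    using same_line_of by (simp add: lines_of_def)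
next
  fix l assume "l \<in> lines_of hexagon_lines"
  then obtain m n where mn: "(m, n) \<in> set hexagon_lines" "l = line_of (m, n)"
    unfolding lines_of_def by fast
  define x where "x = lift (std m)"
  define y where "y = lift (std n)"
  have x: "x \<in> parabolic_quadric" "delete_X3 x = std m" and y: "y \<in> parabolic_quadric" "delete_X3 y = std n"
    by (simp_all add: x_def y_def lift_quadric delete_lift)
  have "hexagon_pair m n"
    using hexagon_check(2) mn(1) unfolding list_all_iff by blast
  then have xy: "pluecker_conditions x y" "x + y \<in> parabolic_quadric"
    using hexagon_pair_iff [OF x y] by blast+
  have b: "0 < m" "m < 64" "0 < n" "n < 64" "m \<noteq> n"
    using hexagon_check(1) mn(1) unfolding three_per_point_def list_all_iff by auto
  have inj: "std i = std j \<Longrightarrow> i = j" if "0 \<le> i" "i < 64" "0 \<le> j" "j < 64" for i j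
  proof -
    have "std ` {0..<64} = UNIV"
      using std_surj by (metis UNIV_eq_I atLeastLessThan_iff image_eqI)
    then have "inj_on std {0..<64}"
      by (intro eq_card_imp_inj_on) (simp_all only: card_bit_6, simp_all)
    then show "std i = std j \<Longrightarrow> i = j"
      using that by (simp add: inj_on_def)
  qed
  have d0: "delete_X3 0 = 0"
    using delete_X3_add [of 0 0] by simp
  have "std 0 = 0"
    by (simp add: std_def comb_0)
  then have "x \<noteq> 0" "y \<noteq> 0" "x \<noteq> y"
    using inj [of m 0] inj [of n 0] inj [of m n] b x(2) y(2) d0 by auto
  then have "{0, x, y, x + y} \<in> subspaces_of_dim 2"
    by (rule line_in_subspaces_of_dim_2)
  moreover have "0 \<in> parabolic_quadric"
    by (simp add: parabolic_quadric_def)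
  then have "{0, x, y, x + y} \<subseteq> parabolic_quadric"
    using x(1) y(1) xy(2) by simp
  moreover have "{0, x, y, x + y} = vec.span {x, y}"
    by (rule span_pair_bit [symmetric])
  ultimately have "{0, x, y, x + y} \<in> hexagon_lines_PG6"
    using xy(1) unfolding hexagon_lines_PG6_def pluecker_conditions_def by blast
  moreover have "l = delete_X3 ` {0, x, y, x + y}"
    by (simp only: mn(2) delete_X3_line line_of_def prod.case x(2) y(2))
  ultimately show "l \<in> split_Cayley_hexagon_lines"
    unfolding split_Cayley_hexagon_lines_def by blast
qed

section \<open>The classification\<close>

text \<open>
  The lists for the two values of the parameter, written out so that they are not recomputed in each step
  of the search, and the case trees.
\<close>

definition centre_hyperplane0 :: "int list list" where
  "centre_hyperplane0 =
     [[1, 2, 3], [1, 4, 5], [1, 6, 7], [2, 8, 10], [2, 9, 11], [3, 12, 15], [3, 13, 14], [4, 16, 20],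
     [4, 17, 21], [5, 18, 23], [5, 19, 22], [6, 24, 30], [6, 25, 31], [7, 26, 29], [7, 27, 28]]"

definition centre_cert0 :: cert where
  "centre_cert0 =
     Branch 8 32 [Branch 8 34 [Branch 8 40 [Branch 16 48 [Branch 30 33 [Leaf [1, 11, 31, 37, 6, 2] [1,
     32, 48, 35, 54, 57]]]]], Branch 8 34 [Branch 8 40 [Branch 26 48 [Branch 21 33 [Leaf [1, 11, 31,
     39, 6, 2] [1, 32, 48, 35, 54, 25]]]]], Branch 8 34 [Branch 8 40 [Branch 24 48 [Branch 23 33 [Leaf
     [1, 11, 31, 45, 6, 2] [1, 32, 48, 35, 54, 26]]]]], Branch 8 34 [Branch 8 40 [Branch 18 48 [Branch
     28 33 [Leaf [1, 11, 31, 47, 6, 2] [1, 32, 48, 35, 54, 58]]]]], Branch 8 34 [Branch 20 36 []],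
     Branch 8 34 [Branch 21 36 []], Branch 8 34 [Branch 31 36 []], Branch 8 34 [Branch 30 36 []]]"

definition centre_hyperplane2 :: "int list list" where
  "centre_hyperplane2 =
     [[1, 2, 3], [1, 4, 5], [1, 6, 7], [2, 8, 10], [2, 9, 11], [3, 12, 15], [3, 13, 14], [4, 16, 20],
     [4, 17, 21], [5, 18, 23], [5, 19, 22], [6, 26, 28], [6, 27, 29], [7, 24, 31], [7, 25, 30]]"

definition centre_cert2 :: cert where
  "centre_cert2 =
     Branch 8 32 [Branch 8 34 [Branch 16 36 []], Branch 8 34 [Branch 17 36 []], Branch 8 34 [Branch 27
     36 []], Branch 8 34 [Branch 26 36 []], Branch 8 34 [Branch 8 40 [Branch 20 48 [Branch 26 33 [Leaf
     [1, 11, 27, 37, 6, 2] [1, 32, 48, 35, 6, 57]]]]], Branch 8 34 [Branch 8 40 [Branch 31 48 [Branch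
     17 33 [Leaf [1, 11, 27, 39, 6, 2] [1, 32, 48, 35, 6, 25]]]]], Branch 8 34 [Branch 8 40 [Branch 23
     48 [Branch 25 33 [Leaf [1, 11, 27, 45, 6, 2] [1, 32, 48, 35, 6, 26]]]]], Branch 8 34 [Branch 8 40
     [Branch 28 48 [Branch 18 33 [Leaf [1, 11, 27, 47, 6, 2] [1, 32, 48, 35, 6, 58]]]]]]"

definition wheel_cert :: cert where
  "wheel_cert =
     Branch 14 32 [Branch 5 37 [Branch 14 46 [Branch 24 52 [Leaf [6, 48, 29, 22, 33, 18] [27, 41, 40,
     62, 9, 11]]], Branch 14 46 [], Branch 14 46 [Branch 31 38 [Leaf [30, 54, 7, 14, 37, 18] [50, 41,
     31, 62, 9, 61]]], Branch 27 62 [Branch 27 40 [Leaf [9, 32, 30, 25, 50, 17] [41, 27, 62, 40, 9,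
     2]], Branch 27 40 [Leaf [29, 37, 11, 13, 54, 17] [41, 50, 62, 31, 9, 21]]]], Branch 14 55 [Branch
     7 39 [Branch 13 49 [Leaf [9, 55, 30, 25, 37, 17] [41, 27, 62, 40, 9, 7], Leaf [6, 39, 29, 22, 54,
     18] [27, 41, 40, 62, 9, 24]]], Branch 9 41 [], Branch 9 34 [Branch 19 36 [Cosets 13 (Branch 13 37
     [])]], Branch 26 37 [Branch 23 50 [Branch 19 59 [Leaf [11, 34, 6, 27, 48, 19] [50, 27, 31, 40, 9,
     25]]]], Branch 14 46 []], Branch 31 63 [Branch 31 60 [Branch 14 57 [Cosets 13 (Branch 13 38 [])]],
     Branch 9 48 [Branch 14 46 [Leaf [9, 46, 30, 25, 60, 17] [41, 27, 62, 40, 9, 15]]], Branch 22 41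
     [Branch 17 49 [Leaf [30, 47, 7, 14, 60, 18] [50, 41, 31, 62, 9, 56]]], Branch 14 57 [Branch 14 55
     [Leaf [7, 60, 9, 23, 45, 19] [27, 50, 40, 31, 9, 60]]]], Branch 14 55 [Branch 11 53 [], Branch 9
     53 [Branch 10 39 [Cosets 13 (Branch 13 36 [])]], Branch 20 39 [Branch 22 34 [Leaf [29, 43, 11, 13,
     56, 17] [41, 50, 62, 31, 9, 6]]], Branch 6 53 [Branch 24 45 [Leaf [6, 41, 29, 22, 56, 18] [27, 41,
     40, 62, 9, 39]]], Branch 22 44 [Branch 14 46 [Leaf [7, 37, 9, 23, 52, 19] [27, 50, 40, 31, 9,
     49]]]], Branch 20 52 [Branch 14 57 [], Branch 7 34 [Branch 20 48 [Leaf [29, 60, 11, 13, 47, 17]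
     [41, 50, 62, 31, 9, 42]]], Branch 31 43 [Branch 14 46 [Cosets 13 (Branch 13 39 [])]], Branch 26 50
     [Branch 27 34 [Leaf [30, 33, 7, 14, 50, 18] [50, 41, 31, 62, 9, 48]], Branch 14 46 [Branch 27 34
     [Leaf [11, 53, 6, 27, 39, 19] [50, 27, 31, 40, 9, 38]]]]], Branch 27 45 [Branch 27 59 [Branch 14
     57 [Branch 19 61 [Leaf [7, 43, 9, 23, 58, 19] [27, 50, 40, 31, 9, 52]]]], Branch 14 57 [], Branch
     25 38 [Branch 25 40 [Branch 23 35 [Leaf [6, 62, 29, 22, 47, 18] [27, 41, 40, 62, 9, 52]]]], Branch
     26 43 [Branch 26 35 [Leaf [30, 56, 7, 14, 43, 18] [50, 41, 31, 62, 9, 53]], Branch 14 55 [Branch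
     22 33 [Leaf [11, 44, 6, 27, 62, 19] [50, 27, 31, 40, 9, 53]]]]], Branch 24 56 [Branch 11 50
     [Branch 19 44 [Leaf [9, 57, 30, 25, 43, 17] [41, 27, 62, 40, 9, 10]]], Branch 31 36 [Branch 31 39
     [Leaf [11, 59, 6, 27, 41, 19] [50, 27, 31, 40, 9, 10]]], Branch 17 60 [Branch 22 59 [Leaf [29, 50,
     11, 13, 33, 17] [41, 50, 62, 31, 9, 57]]], Branch 19 36 [Branch 14 57 [Leaf [7, 50, 9, 23, 35, 19]
     [27, 50, 40, 31, 9, 57]]]]]"

lemma centre_hyperplanes: "centre_lines 0 = centre_hyperplane0" "centre_lines 2 = centre_hyperplane2"
  by code_simp+

lemma centre_search0: "search_succeeds centre_hyperplane0 hexagon_lines 8 centre_cert0"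
  by code_simp

lemma centre_search2: "search_succeeds centre_hyperplane2 hexagon_lines 8 centre_cert2"
  by code_simp

lemma wheel_search: "search_succeeds wheel_hyperplane orbit1 14 wheel_cert"
  by code_simp

lemma (in deza_nbhd) has_copy_cases: "has_copy hexagon_lines \<or> has_copy orbit1"
proof (cases rule: hyperplane_configuration)
  case (centre H p)
  show ?thesis
  proof (rule centre_complete [OF centre])
    fix a b c d and e :: int
    assume frames: "\<And>t. t \<notin> H \<Longrightarrow> complete_frame P H (comb [p, a, b, c, d, t]) centre_points (centre_lines e)"
    assume "e = 0 \<or> e = 2"
    then have "search_succeeds (centre_lines e) hexagon_lines 8 (if e = 0 then centre_cert0 else
        centre_cert2)"
      using centre_search0 centre_search2 unfolding centre_hyperplanes [symmetric] by auto
    then show ?thesis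
      using has_copy_by_search [OF frames centre(1)] by blast
  qed
next
  case (wheel H x y a u v w)
  interpret wheel P H x y a u v w
    using wheel by unfold_locales
  show ?thesis
    using has_copy_by_search [OF wheel_complete_frame wheel(1) wheel_search] by blast
qed

theorem proposition3p18:
  fixes E :: "(bit ^ 6) set set"
  assumes "qary_deza_graph 6 2 1 0 2 E"
  shows "(projectively_equivalent E split_Cayley_hexagon_lines \<or>
          projectively_equivalent E (K_orbit line1) \<or>
          projectively_equivalent E (K_orbit line2) \<or>
          projectively_equivalent E (K_orbit line3)) \<and>
         projectively_equivalent (K_orbit line1) (K_orbit line2) \<and>
         projectively_equivalent (K_orbit line1) (K_orbit line3) \<and>
         projectively_equivalent (K_orbit line2) (K_orbit line3)"
proof -
  interpret deza_nbhd "nbhd E"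
    by (rule qary_deza_graph_nbhd(1) [OF assms])
  have "projectively_equivalent (lines_of T) E" if "has_copy T" "three_per_point T" for T
    using has_copy_equivalent [OF that] qary_deza_graph_nbhd(2) [OF assms] by simp
  then have "projectively_equivalent E (lines_of hexagon_lines) \<or> projectively_equivalent E
      (lines_of orbit1)"
    using has_copy_cases hexagon_check(1) orbit_check(1) projectively_equivalent_sym by blast
  then show ?thesis
    unfolding split_Cayley_hexagon_lines_eq K_orbits(1) [symmetric]
    using K_orbits_equivalent by blast
qed

end
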